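(* Let $d\ge1$. Suppose that $\{g_n\}_{n\in\mathbb{Z}}\in\ell^1(\mathbb{Z})$ and $g_0=1$. Let $\phi(t,x)$ be a real-valued function for which there exist positive numbers $a<b$ such that for any $f,g\in L^2(\mathbb{R}^d)$, any $\sigma\in[a,b]$, and any integer $n\neq0$, $$\lim_{t\to\infty}\big(e^{in(\sigma t|x|^2+\phi(\sigma t))}f,\,g\big)_{L^2}=0.$$ Let $T\in\mathbb{R}$ and let $u(t)$ be a solution to $i\partial_tu+\Delta u=F(u)$ on $[T,\infty)$. If $u$ satisfies $$\lim_{t\to\infty}\|u(t)-V_\phi(t)\|_{L^2(\mathbb{R}^d)}=0,\qquad\lim_{t\to\infty}t^{\frac{d}{2(d+2)}}\|u-V_\phi\|_{L^{\frac{2(d+2)}{d}}_{t,x}([t,\infty)\times\mathbb{R}^d)}=0$$ for some $u_+\in H^{0,\frac{d}{d+2}}(\mathbb{R}^d)$, where $$V_\phi(t,x)=e^{-i\frac{\pi}{4}d}\,M(t)D(t)\big[e^{i\phi(t)}\widehat{u_+}\big](x),$$ then $u_+\equiv0$.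
   Context: Nonlinearity: $F:\mathbb{C}\to\mathbb{C}$ is homogeneous of degree $1+2/d$, i.e. $F(\lambda z)=\lambda^{1+2/d}F(z)$ for all $z\in\mathbb{C}$, $\lambda>0$. Its coefficients are $g_n=\frac1{2\pi}\int_0^{2\pi}F(e^{i\theta})e^{-in\theta}\,d\theta$, $n\in\mathbb{Z}$, and $F$ is decomposed as $F(u)=\sum_{n\in\mathbb{Z}}g_nF_n(u)$ with $F_n(u)=|u|^{1+\frac2d-n}u^n$. Solution: for an interval $I\subset\mathbb{R}$, a function $u:I\times\mathbb{R}^d\to\mathbb{C}$ is a solution to $i\partial_tu+\Delta u=F(u)$ on $I$ if $u\in C_t(I;L^2_x(\mathbb{R}^d))\cap L^{\frac{2(d+2)}{d}}_{t,\mathrm{loc}}(I;L_x^{\frac{2(d+2)}{d}}(\mathbb{R}^d))$ and $u(t_2)=U(t_2-t_1)u(t_1)-i\int_{t_1}^{t_2}U(t_2-s)F(u(s))\,ds$ in $L^2(\mathbb{R}^d)$ for all $t_1,t_2\in I$, where $U(t)=e^{it\Delta}$ is the free Schrödinger group. Notation: $(f,g)_{L^2}=\int_{\mathbb{R}^d}f\,\overline{g}\,dx$; $\phi(t)$ denotes the function $x\mapsto\phi(t,x)$; $\widehat{f}(\xi)=(2\pi)^{-d/2}\int_{\mathbb{R}^d}e^{-ix\cdot\xi}f(x)\,dx$; $[M(t)f](x)=e^{i|x|^2/(4t)}f(x)$; $[D(t)f](x)=(2t)^{-d/2}f(x/(2t))$; $H^{m,s}=\{u\in\mathcal{S}'(\mathbb{R}^d):\langle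 i\nabla\rangle^m\langle x\rangle^su\in L^2(\mathbb{R}^d)\}$ with $\langle a\rangle=(1+|a|^2)^{1/2}$. *)

theory Defs
  imports "HOL-Analysis.Analysis"
begin

section \<open>Lebesgue spaces\<close>

text \<open>
  Elements of \<open>L\<^sup>p\<close> are represented by (Lebesgue measurable) functions, and equality in \<open>L\<^sup>p\<close> is
  equality almost everywhere. Norms take values in the extended nonnegative reals, so that
  non-integrable functions have norm \<open>\<infinity>\<close> and a limit statement about norms includes finiteness.
\<close>

definition Lp_norm :: "real \<Rightarrow> 'a::euclidean_space set \<Rightarrow> ('a \<Rightarrow> complex) \<Rightarrow> ennreal" where
  "Lp_norm p S f =
     (let N = (\<integral>\<^sup>+ x. ennreal (cmod (f x) powr p) \<partial>(lebesgue_on S))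
      in if N = \<infinity> then \<infinity> else ennreal (enn2real N powr (1 / p)))"

definition Lp :: "real \<Rightarrow> 'a::euclidean_space set \<Rightarrow> ('a \<Rightarrow> complex) set" where
  "Lp p S = {f \<in> borel_measurable (lebesgue_on S). Lp_norm p S f < \<infinity>}"

abbreviation L2_norm :: "('a::euclidean_space \<Rightarrow> complex) \<Rightarrow> ennreal" where
  "L2_norm \<equiv> Lp_norm 2 UNIV"

abbreviation L2 :: "('a::euclidean_space \<Rightarrow> complex) set" where
  "L2 \<equiv> Lp 2 UNIV"

definition L2_inner :: "('a::euclidean_space \<Rightarrow> complex) \<Rightarrow> ('a \<Rightarrow> complex) \<Rightarrow> complex" where
  "L2_inner f g = (\<integral> x. f x * cnj (g x) \<partial>lebesgue)"

text \<open>
  The space \<open>H\<^sup>0\<^sup>,\<^sup>s\<close>. It is used for \<open>s \<ge> 0\<close> only, where a tempered distribution \<open>v\<close> with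
  \<open>\<langle>x\<rangle>\<^sup>s v \<in> L\<^sup>2\<close> is itself an \<open>L\<^sup>2\<close> function, so that nothing is lost by taking \<open>v\<close> to be a function.
\<close>

definition japanese_bracket :: "'a::real_normed_vector \<Rightarrow> real" where
  "japanese_bracket x = sqrt (1 + (norm x)\<^sup>2)"

definition H0 :: "real \<Rightarrow> ('a::euclidean_space \<Rightarrow> complex) set" where
  "H0 s = {v \<in> borel_measurable lebesgue.
             (\<lambda>x. complex_of_real (japanese_bracket x powr s) * v x) \<in> L2}"


section \<open>The Bochner integral of functions with values in \<open>L\<^sup>2\<close>\<close>

text \<open>
  This follows the usual definition (cf. \<^const>\<open>has_bochner_integral\<close>), which is not directly
  applicable since \<open>L\<^sup>2\<close> is not available as a type here. The almost everywhere approximation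
  by simple functions expresses strong measurability of the integrand.
\<close>

definition L2_simple :: "real set \<Rightarrow> (real \<Rightarrow> 'a::euclidean_space \<Rightarrow> complex) \<Rightarrow> bool" where
  "L2_simple A S \<longleftrightarrow> finite (S ` A) \<and> S ` A \<subseteq> L2 \<and>
     (\<forall>h \<in> S ` A. {s \<in> A. S s = h} \<in> lmeasurable)"

definition L2_simple_integral ::
  "real set \<Rightarrow> (real \<Rightarrow> 'a::euclidean_space \<Rightarrow> complex) \<Rightarrow> 'a \<Rightarrow> complex" where
  "L2_simple_integral A S x =
     (\<Sum>h \<in> S ` A. complex_of_real (measure lebesgue {s \<in> A. S s = h}) * h x)"

definition has_L2_integral ::
  "(real \<Rightarrow> 'a::euclidean_space \<Rightarrow> complex) \<Rightarrow> real set \<Rightarrow> ('a \<Rightarrow> complex) \<Rightarrow> bool" where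
  "has_L2_integral G A w \<longleftrightarrow> w \<in> L2 \<and> (AE s in lebesgue_on A. G s \<in> L2) \<and>
     (\<exists>S. (\<forall>k::nat. L2_simple A (S k)) \<and>
        (AE s in lebesgue_on A. (\<lambda>k. L2_norm (\<lambda>x. S k s x - G s x)) \<longlonglongrightarrow> 0) \<and>
        (\<lambda>k. \<integral>\<^sup>+ s. L2_norm (\<lambda>x. S k s x - G s x) \<partial>(lebesgue_on A)) \<longlonglongrightarrow> 0 \<and>
        (\<lambda>k. L2_norm (\<lambda>x. L2_simple_integral A (S k) x - w x)) \<longlonglongrightarrow> 0)"

text \<open>\<open>w\<close> is the oriented integral of \<open>G\<close> from \<open>a\<close> to \<open>b\<close>, where \<open>b < a\<close> is allowed.\<close>

definition has_L2_interval_integral ::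
  "(real \<Rightarrow> 'a::euclidean_space \<Rightarrow> complex) \<Rightarrow> real \<Rightarrow> real \<Rightarrow> ('a \<Rightarrow> complex) \<Rightarrow> bool" where
  "has_L2_interval_integral G a b w \<longleftrightarrow>
     (if a \<le> b then has_L2_integral G {a..b} w
      else has_L2_integral G {b..a} (\<lambda>x. - w x))"


section \<open>Fourier transform and free Schroedinger group on \<open>L\<^sup>2\<close>\<close>

text \<open>
  The Fourier transform on \<open>L\<^sup>2\<close> (Plancherel) is the \<open>L\<^sup>2\<close>-limit of the Fourier integrals of the
  truncations to balls of radius \<open>R \<rightarrow> \<infinity>\<close>; these are integrable for \<open>f \<in> L\<^sup>2\<close>. The limit is
  determined up to null sets. The sign \<open>\<epsilon>\<close> is \<open>-1\<close> for the transform and \<open>1\<close> for its inverse.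
\<close>

definition truncated_fourier ::
  "real \<Rightarrow> real \<Rightarrow> (real^'n \<Rightarrow> complex) \<Rightarrow> real^'n \<Rightarrow> complex" where
  "truncated_fourier \<epsilon> R f \<xi> =
     complex_of_real ((2 * pi) powr (- real CARD('n) / 2)) *
     (\<integral> x. cis (\<epsilon> * (x \<bullet> \<xi>)) * f x \<partial>(lebesgue_on (cball 0 R)))"

definition fourier_limit :: "real \<Rightarrow> (real^'n \<Rightarrow> complex) \<Rightarrow> real^'n \<Rightarrow> complex" where
  "fourier_limit \<epsilon> f =
     (SOME h. h \<in> L2 \<and>
        ((\<lambda>R. L2_norm (\<lambda>\<xi>. truncated_fourier \<epsilon> R f \<xi> - h \<xi>)) \<longlongrightarrow> 0) at_top)"

definition fourier :: "(real^'n \<Rightarrow> complex) \<Rightarrow> real^'n \<Rightarrow> complex" where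
  "fourier = fourier_limit (- 1)"

definition inverse_fourier :: "(real^'n \<Rightarrow> complex) \<Rightarrow> real^'n \<Rightarrow> complex" where
  "inverse_fourier = fourier_limit 1"

text \<open>\<open>U(t) = e\<^sup>i\<^sup>t\<^sup>\<Delta>\<close>, i.e. the Fourier multiplier with symbol \<open>exp (- i t |\<xi>|\<^sup>2)\<close>.\<close>

definition schroedinger_group ::
  "real \<Rightarrow> (real^'n \<Rightarrow> complex) \<Rightarrow> real^'n \<Rightarrow> complex" where
  "schroedinger_group t f =
     inverse_fourier (\<lambda>\<xi>. cis (- t * (norm \<xi>)\<^sup>2) * fourier f \<xi>)"


section \<open>The nonlinearity\<close>

definition homogeneous :: "real \<Rightarrow> (complex \<Rightarrow> complex) \<Rightarrow> bool" where
  "homogeneous p F \<longleftrightarrow>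
     (\<forall>z. \<forall>r::real. r > 0 \<longrightarrow> F (complex_of_real r * z) = complex_of_real (r powr p) * F z)"

definition F_coeff :: "(complex \<Rightarrow> complex) \<Rightarrow> int \<Rightarrow> complex" where
  "F_coeff F n =
     1 / (2 * complex_of_real pi) *
     (\<integral> \<theta>. F (cis \<theta>) * cis (- real_of_int n * \<theta>) \<partial>(lebesgue_on {0..2 * pi}))"

text \<open>\<open>F\<^sub>n(z) = |z|\<^bsup>p-n\<^esup> z\<^bsup>n\<^esup>\<close>; since \<open>0 powr a = 0\<close>, this gives \<open>F\<^sub>n(0) = 0\<close> for every \<open>n\<close>.\<close>

definition F_mode :: "real \<Rightarrow> int \<Rightarrow> complex \<Rightarrow> complex" where
  "F_mode p n z = complex_of_real (cmod z powr (p - real_of_int n)) * z powi n"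


section \<open>Solutions and asymptotic profile\<close>

text \<open>
  \<open>u\<close> solves \<open>i \<partial>\<^sub>t u + \<Delta>u = F(u)\<close> on the interval \<open>I\<close>: it is a jointly measurable function in
  \<open>C(I; L\<^sup>2) \<inter> L\<^sup>q\<^sub>l\<^sub>o\<^sub>c(I; L\<^sup>q)\<close>, \<open>q = 2(d+2)/d\<close>, satisfying the Duhamel formula in \<open>L\<^sup>2\<close>.
\<close>

definition is_solution ::
  "(complex \<Rightarrow> complex) \<Rightarrow> real set \<Rightarrow> (real \<Rightarrow> real^'n \<Rightarrow> complex) \<Rightarrow> bool" where
  "is_solution F I u \<longleftrightarrow>
     (\<lambda>(t, x). u t x) \<in> borel_measurable (lebesgue_on (I \<times> UNIV)) \<and>
     (\<forall>t\<in>I. u t \<in> L2) \<and>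
     (\<forall>t\<in>I. ((\<lambda>s. L2_norm (\<lambda>x. u s x - u t x)) \<longlongrightarrow> 0) (at t within I)) \<and>
     (\<forall>K. compact K \<and> K \<subseteq> I \<longrightarrow>
        Lp_norm (2 * (real CARD('n) + 2) / real CARD('n)) (K \<times> UNIV) (\<lambda>(t, x). u t x) < \<infinity>) \<and>
     (\<forall>t1\<in>I. \<forall>t2\<in>I. \<exists>w.
        has_L2_interval_integral (\<lambda>s. schroedinger_group (t2 - s) (\<lambda>x. F (u s x))) t1 t2 w \<and>
        (AE x in lebesgue. u t2 x = schroedinger_group (t2 - t1) (u t1) x - \<i> * w x))"

definition M_op :: "real \<Rightarrow> (real^'n \<Rightarrow> complex) \<Rightarrow> real^'n \<Rightarrow> complex" where
  "M_op t f x = cis ((norm x)\<^sup>2 / (4 * t)) * f x"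

definition D_op :: "real \<Rightarrow> (real^'n \<Rightarrow> complex) \<Rightarrow> real^'n \<Rightarrow> complex" where
  "D_op t f x = complex_of_real ((2 * t) powr (- real CARD('n) / 2)) * f (x /\<^sub>R (2 * t))"

text \<open>This is meaningful for \<open>t > 0\<close>, and used as \<open>t \<rightarrow> \<infinity>\<close> only.\<close>

definition V_profile ::
  "(real \<Rightarrow> real^'n \<Rightarrow> real) \<Rightarrow> (real^'n \<Rightarrow> complex) \<Rightarrow> real \<Rightarrow> real^'n \<Rightarrow> complex" where
  "V_profile \<phi> v t x =
     cis (- (pi / 4) * real CARD('n)) *
     M_op t (D_op t (\<lambda>\<xi>. cis (\<phi> t \<xi>) * fourier v \<xi>)) x"

end

theory Submission
  imports Defs "HOL-Probability.Characteristic_Functions"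
begin

text \<open>
  Write \<open>p = 1 + 2/d\<close>, \<open>q = 2p\<close>, let \<open>W\<close> be the Fourier transform of \<open>u\<^sub>+\<close> and \<open>V\<close> the profile. A real
  phase such as \<open>\<phi>\<close> may compensate the gauge invariant mode \<open>|u|\<^sup>2\<^sup>/\<^sup>d u\<close> of the nonlinearity. It has no
  effect on the mode \<open>n = 0\<close>, the term \<open>|u|\<^sup>p\<close>, which does not oscillate and has a sign. The proof
  isolates this term by testing the Duhamel formula between the times \<open>a t\<close> and \<open>b t\<close> against the
  Gaussian \<open>h\<^sub>t(x) = t\<^sup>-\<^sup>d\<^sup>/\<^sup>2 exp(- |x|\<^sup>2 / (2t\<^sup>2))\<close> (\<open>test_fun\<close>). Three properties single it out.

  \<^item> Its frequencies have size \<open>1/t\<close>, so that the free flow over a time \<open>\<tau> = O(t)\<close> moves it only by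
    \<open>O(\<tau> / t\<^sup>2) = O(1/t)\<close> in \<open>L\<^sup>2\<close> (\<open>schroedinger_group_test_fun\<close>). Hence the propagators can be dropped
    from the Duhamel formula.

  \<^item> It lives at the scale \<open>|x| \<sim> t\<close> of the profile: for \<open>s = \<sigma>t\<close> and \<open>x = 2s\<xi>\<close> it becomes the Gaussian
    \<open>exp(- 2\<sigma>\<^sup>2|\<xi>|\<^sup>2)\<close>, which is independent of \<open>t\<close> up to the normalising factor \<open>t\<^sup>-\<^sup>d\<^sup>/\<^sup>2\<close>.

  \<^item> It has no quadratic phase. In the variable \<open>\<xi>\<close> the mode \<open>F\<^sub>n(V)\<close> carries the phase
    \<open>n (s|\<xi>|\<^sup>2 + \<phi>(s))\<close>, so by the assumed weak convergence every mode with \<open>n \<noteq> 0\<close> disappears from the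
    pairing in the limit (\<open>mode_Z_limit\<close>, \<open>F_Z_limit\<close>). The same convergence with \<open>n = 1\<close> removes the
    boundary terms \<open>(u(at), h\<^sub>t)\<close> and \<open>(u(bt), h\<^sub>t)\<close> (\<open>u_pairing_limit\<close>).

  The mode \<open>n = 0\<close> contributes \<open>(1/t) (2\<sigma>)\<^sup>d\<^sup>/\<^sup>2\<^sup>-\<^sup>1 \<integral> |W|\<^sup>p exp(- 2\<sigma>\<^sup>2|\<xi>|\<^sup>2) d\<xi>\<close> to the integrand at time
  \<open>s = \<sigma>t\<close>. Integrating over \<open>[at, bt]\<close> and letting \<open>t \<rightarrow> \<infinity>\<close>, the average of this nonnegative quantity
  over \<open>\<sigma> \<in> [a, b]\<close> is zero (\<open>main_integral_zero\<close>). Therefore \<open>W = 0\<close>, and \<open>u\<^sub>+ = 0\<close> because the Fourier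
  transform is injective on \<open>L\<^sup>2\<close> (\<open>fourier_limit_injective\<close>, \<open>profile_zero\<close>).

  The replacement of \<open>F(u)\<close> by \<open>F(V)\<close> uses the space-time norm. Summable coefficients make \<open>F\<close>
  continuous, but not necessarily Lipschitz; homogeneity turns continuity into
  \<open>|F(z) - F(w)| \<le> \<epsilon>|w|\<^sup>p + C\<^sub>\<epsilon>|z - w|\<^sup>p\<close> (\<open>F_difference\<close>). The first term is harmless because
  \<open>\<parallel>V(s)\<parallel>\<^sub>q\<^sup>q\<close> is a multiple of \<open>s\<^sup>-\<^sup>2\<close>; the second is integrated in time with the help of
  \<open>t \<integral> \<parallel>u(s) - V(s)\<parallel>\<^sub>q\<^sup>q ds \<rightarrow> 0\<close>, the integral being over \<open>s \<ge> t\<close> (\<open>deviation\<close>, \<open>pointwise_error\<close>).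

  Of the Fourier transform on \<open>L\<^sup>2\<close> only three properties enter: it is a contraction, it can be moved
  onto Gaussians in a pairing, and it is injective. All three follow from the explicit transform of
  Gaussians: the contraction by regularising with a Gaussian weight (\<open>FT_smoothed_norm_le\<close>), the pairing
  by the multiplication formula (\<open>fourier_limit_pairing\<close>), and the injectivity since the pairings with
  modulated Gaussians are Gaussian averages of the original function
  (\<open>AE_zero_of_gaussian_averages\<close>).
\<close>

section \<open>The space \<open>L\<^sup>2\<close>\<close>

definition l2 :: "('a::euclidean_space \<Rightarrow> complex) \<Rightarrow> real" where
  "l2 f = sqrt (\<integral>x. (cmod (f x))\<^sup>2 \<partial>lebesgue)"

lemma L2_iff:
  "f \<in> L2 \<longleftrightarrow> f \<in> borel_measurable lebesgue \<and> integrable lebesgue (\<lambda>x. (cmod (f x))\<^sup>2)"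
proof (cases "f \<in> borel_measurable lebesgue")
  case True
  then have "(\<lambda>x. (cmod (f x))\<^sup>2) \<in> borel_measurable lebesgue" by measurable
  moreover have "(\<lambda>x. ennreal (cmod (f x) powr 2)) = (\<lambda>x. ennreal ((cmod (f x))\<^sup>2))"
    by (simp add: powr_numeral)
  ultimately show ?thesis using True
    by (auto simp: Lp_def Lp_norm_def Let_def lebesgue_on_UNIV_eq integrable_iff_bounded less_top)
next
  case False
  then show ?thesis by (simp add: Lp_def lebesgue_on_UNIV_eq)
qed

lemma L2_measurable: "f \<in> L2 \<Longrightarrow> f \<in> borel_measurable lebesgue"
  by (simp add: L2_iff)

lemma l2_nonneg [simp]: "0 \<le> l2 f"
  by (simp add: l2_def)

lemma l2_power2: "(l2 f)\<^sup>2 = (\<integral>x. (cmod (f x))\<^sup>2 \<partial>lebesgue)"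
  by (simp add: l2_def)

lemma L2_norm_eq_l2:
  assumes "f \<in> L2"
  shows "L2_norm f = ennreal (l2 f)"
proof -
  have i: "integrable lebesgue (\<lambda>x. (cmod (f x))\<^sup>2)" using assms by (simp add: L2_iff)
  have "(\<integral>\<^sup>+ x. ennreal (cmod (f x) powr 2) \<partial>lebesgue) = ennreal (\<integral>x. (cmod (f x))\<^sup>2 \<partial>lebesgue)"
    using nn_integral_eq_integral[OF i] by (simp add: powr_numeral)
  then show ?thesis
    by (simp add: Lp_norm_def lebesgue_on_UNIV_eq l2_def powr_half_sqrt)
qed

lemma L2_product_integrable:
  assumes "f \<in> L2" "g \<in> L2"
  shows "integrable lebesgue (\<lambda>x. f x * g x)"
proof (rule Bochner_Integration.integrable_bound)
  show "integrable lebesgue (\<lambda>x. (cmod (f x))\<^sup>2 + (cmod (g x))\<^sup>2)"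
    using assms by (auto simp: L2_iff)
  have [measurable]: "f \<in> borel_measurable lebesgue" "g \<in> borel_measurable lebesgue"
    using assms by (auto simp: L2_iff)
  show "(\<lambda>x. f x * g x) \<in> borel_measurable lebesgue" by measurable
  have "cmod (f x * g x) \<le> (cmod (f x))\<^sup>2 + (cmod (g x))\<^sup>2" for x
    using sum_squares_bound[of "cmod (f x)" "cmod (g x)"] mult_nonneg_nonneg[of "cmod (f x)" "cmod (g x)"]
    by (simp add: norm_mult del: mult_nonneg_nonneg)
  then show "AE x in lebesgue. norm (f x * g x) \<le> norm ((cmod (f x))\<^sup>2 + (cmod (g x))\<^sup>2)"
    by simp
qed

lemma L2_add: assumes "f \<in> L2" "g \<in> L2" shows "(\<lambda>x. f x + g x) \<in> L2"
proof -
  have [measurable]: "f \<in> borel_measurable lebesgue" "g \<in> borel_measurable lebesgue"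
    using assms by (auto simp: L2_iff)
  have "integrable lebesgue (\<lambda>x. (cmod (f x + g x))\<^sup>2)"
  proof (rule Bochner_Integration.integrable_bound)
    show "integrable lebesgue (\<lambda>x. 2 * (cmod (f x))\<^sup>2 + 2 * (cmod (g x))\<^sup>2)"
      using assms by (auto simp: L2_iff)
    have "(cmod (f x + g x))\<^sup>2 \<le> 2 * (cmod (f x))\<^sup>2 + 2 * (cmod (g x))\<^sup>2" for x
    proof -
      have "(cmod (f x + g x))\<^sup>2 \<le> (cmod (f x) + cmod (g x))\<^sup>2"
        by (intro power_mono norm_triangle_ineq) auto
      also have "\<dots> \<le> 2 * (cmod (f x))\<^sup>2 + 2 * (cmod (g x))\<^sup>2"
        using sum_squares_bound[of "cmod (f x)" "cmod (g x)"] by (simp add: power2_sum)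
      finally show ?thesis .
    qed
    then show "AE x in lebesgue. norm ((cmod (f x + g x))\<^sup>2) \<le> norm (2 * (cmod (f x))\<^sup>2 + 2 * (cmod (g x))\<^sup>2)"
      by simp
  qed auto
  then show ?thesis by (auto simp: L2_iff)
qed

lemma L2_mult_left: assumes "f \<in> L2" shows "(\<lambda>x. c * f x) \<in> L2"
proof -
  have [measurable]: "f \<in> borel_measurable lebesgue"
    using assms by (auto simp: L2_iff)
  show ?thesis using assms by (auto simp: L2_iff norm_mult power_mult_distrib)
qed

lemma L2_diff: assumes "f \<in> L2" "g \<in> L2" shows "(\<lambda>x. f x - g x) \<in> L2"
  using L2_add[OF assms(1) L2_mult_left[OF assms(2), of "-1"]] by simp

lemma L2_zero: "(\<lambda>x. 0) \<in> L2" by (simp add: L2_iff)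

lemma L2_dominated:
  assumes "g \<in> L2" "f \<in> borel_measurable lebesgue" "\<And>x. cmod (f x) \<le> C * cmod (g x)"
  shows "f \<in> L2"
proof -
  have [measurable]: "f \<in> borel_measurable lebesgue" by fact
  have "integrable lebesgue (\<lambda>x. (cmod (f x))\<^sup>2)"
  proof (rule Bochner_Integration.integrable_bound)
    show "integrable lebesgue (\<lambda>x. C\<^sup>2 * (cmod (g x))\<^sup>2)" using assms by (auto simp: L2_iff)
    have "(cmod (f x))\<^sup>2 \<le> C\<^sup>2 * (cmod (g x))\<^sup>2" for x
      using power_mono[OF assms(3)[of x], of 2] by (simp add: power_mult_distrib)
    then show "AE x in lebesgue. norm ((cmod (f x))\<^sup>2) \<le> norm (C\<^sup>2 * (cmod (g x))\<^sup>2)" by simp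
  qed auto
  then show ?thesis using assms by (auto simp: L2_iff)
qed

lemma l2_cong_AE:
  assumes "AE x in lebesgue. f x = g x" "f \<in> borel_measurable lebesgue" "g \<in> borel_measurable lebesgue"
  shows "l2 f = l2 g"
proof -
  have "(\<integral>x. (cmod (f x))\<^sup>2 \<partial>lebesgue) = (\<integral>x. (cmod (g x))\<^sup>2 \<partial>lebesgue)"
    using assms by (intro integral_cong_AE) auto
  then show ?thesis by (simp add: l2_def)
qed

lemma L2_cong_AE:
  assumes "AE x in lebesgue. f x = g x" "f \<in> L2"
  shows "g \<in> L2"
proof -
  have m: "f \<in> borel_measurable lebesgue" "g \<in> borel_measurable lebesgue"
    using assms borel_measurable_AE by (auto simp: L2_iff)
  have "integrable lebesgue (\<lambda>x. (cmod (f x))\<^sup>2) \<longleftrightarrow> integrable lebesgue (\<lambda>x. (cmod (g x))\<^sup>2)"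
    using assms m by (intro integrable_cong_AE) auto
  then show ?thesis using assms m by (auto simp: L2_iff)
qed

lemma integral_abs_product_le_l2:
  assumes "f \<in> L2" "g \<in> L2"
  shows "(\<integral>x. cmod (f x) * cmod (g x) \<partial>lebesgue) \<le> l2 f * l2 g"
proof -
  have [measurable]: "f \<in> borel_measurable lebesgue" "g \<in> borel_measurable lebesgue"
    using assms by (auto simp: L2_iff)
  have i: "integrable lebesgue (\<lambda>x. cmod (f x) * cmod (g x))"
    using integrable_norm[OF L2_product_integrable[OF assms]] by (simp add: norm_mult)
  have i1: "integrable lebesgue (\<lambda>x. (cmod (f x))\<^sup>2)" and i2: "integrable lebesgue (\<lambda>x. (cmod (g x))\<^sup>2)"
    using assms by (auto simp: L2_iff)
  let ?C = "\<integral>x. cmod (f x) * cmod (g x) \<partial>lebesgue"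
  have "(\<integral>\<^sup>+x. ennreal (cmod (f x)) * ennreal (cmod (g x)) \<partial>lebesgue)\<^sup>2
     \<le> (\<integral>\<^sup>+x. (ennreal (cmod (f x)))\<^sup>2 \<partial>lebesgue) * (\<integral>\<^sup>+x. (ennreal (cmod (g x)))\<^sup>2 \<partial>lebesgue)"
    by (rule Cauchy_Schwarz_nn_integral) auto
  moreover have "(\<integral>\<^sup>+x. ennreal (cmod (f x)) * ennreal (cmod (g x)) \<partial>lebesgue) = ennreal ?C"
    using nn_integral_eq_integral[OF i] by (simp add: ennreal_mult)
  moreover have "(\<integral>\<^sup>+x. (ennreal (cmod (f x)))\<^sup>2 \<partial>lebesgue) = ennreal ((l2 f)\<^sup>2)"
    using nn_integral_eq_integral[OF i1] by (simp add: ennreal_power l2_power2)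
  moreover have "(\<integral>\<^sup>+x. (ennreal (cmod (g x)))\<^sup>2 \<partial>lebesgue) = ennreal ((l2 g)\<^sup>2)"
    using nn_integral_eq_integral[OF i2] by (simp add: ennreal_power l2_power2)
  ultimately have "ennreal (?C\<^sup>2) \<le> ennreal ((l2 f)\<^sup>2 * (l2 g)\<^sup>2)"
    by (simp add: ennreal_power ennreal_mult)
  then have "?C\<^sup>2 \<le> (l2 f * l2 g)\<^sup>2"
    by (simp add: power_mult_distrib)
  then show ?thesis by (rule power2_le_imp_le) simp
qed

lemma L2_Cauchy_Schwarz:
  assumes "f \<in> L2" "g \<in> L2"
  shows "cmod (\<integral>x. f x * g x \<partial>lebesgue) \<le> l2 f * l2 g"
proof -
  have "cmod (\<integral>x. f x * g x \<partial>lebesgue) \<le> (\<integral>x. cmod (f x * g x) \<partial>lebesgue)"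
    by (rule integral_norm_bound)
  also have "\<dots> \<le> l2 f * l2 g"
    using integral_abs_product_le_l2[OF assms] by (simp add: norm_mult)
  finally show ?thesis .
qed

lemma l2_triangle:
  assumes "f \<in> L2" "g \<in> L2"
  shows "l2 (\<lambda>x. f x + g x) \<le> l2 f + l2 g"
proof (rule power2_le_imp_le)
  have i1: "integrable lebesgue (\<lambda>x. (cmod (f x))\<^sup>2)" and i2: "integrable lebesgue (\<lambda>x. (cmod (g x))\<^sup>2)"
    using assms by (auto simp: L2_iff)
  have i: "integrable lebesgue (\<lambda>x. cmod (f x) * cmod (g x))"
    using integrable_norm[OF L2_product_integrable[OF assms]] by (simp add: norm_mult)
  have "(l2 (\<lambda>x. f x + g x))\<^sup>2 = (\<integral>x. (cmod (f x + g x))\<^sup>2 \<partial>lebesgue)" by (rule l2_power2)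
  also have "\<dots> \<le> (\<integral>x. (cmod (f x))\<^sup>2 + (cmod (g x))\<^sup>2 + 2 * (cmod (f x) * cmod (g x)) \<partial>lebesgue)"
  proof (rule integral_mono)
    show "integrable lebesgue (\<lambda>x. (cmod (f x + g x))\<^sup>2)" using L2_add[OF assms] by (simp add: L2_iff)
    show "integrable lebesgue (\<lambda>x. (cmod (f x))\<^sup>2 + (cmod (g x))\<^sup>2 + 2 * (cmod (f x) * cmod (g x)))"
      using i i1 i2 by auto
    fix x
    have "(cmod (f x + g x))\<^sup>2 \<le> (cmod (f x) + cmod (g x))\<^sup>2"
      by (intro power_mono norm_triangle_ineq) auto
    then show "(cmod (f x + g x))\<^sup>2 \<le> (cmod (f x))\<^sup>2 + (cmod (g x))\<^sup>2 + 2 * (cmod (f x) * cmod (g x))"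
      by (simp add: power2_sum)
  qed
  also have "\<dots> = (l2 f)\<^sup>2 + (l2 g)\<^sup>2 + 2 * (\<integral>x. cmod (f x) * cmod (g x) \<partial>lebesgue)"
    using i i1 i2 by (simp add: l2_power2)
  also have "\<dots> \<le> (l2 f)\<^sup>2 + (l2 g)\<^sup>2 + 2 * (l2 f * l2 g)"
    using integral_abs_product_le_l2[OF assms] by simp
  also have "\<dots> = (l2 f + l2 g)\<^sup>2" by (simp add: power2_sum)
  finally show "(l2 (\<lambda>x. f x + g x))\<^sup>2 \<le> (l2 f + l2 g)\<^sup>2" .
qed simp

lemma l2_minus_commute: "l2 (\<lambda>x. f x - g x) = l2 (\<lambda>x. g x - f x)"
  by (simp add: l2_def norm_minus_commute)

lemma l2_triangle_diff:
  assumes "f \<in> L2" "g \<in> L2" "h \<in> L2"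
  shows "l2 (\<lambda>x. f x - h x) \<le> l2 (\<lambda>x. f x - g x) + l2 (\<lambda>x. g x - h x)"
  using l2_triangle[OF L2_diff[OF assms(1,2)] L2_diff[OF assms(2,3)]] by simp

lemma l2_le_diff_add:
  assumes "f \<in> L2" "g \<in> L2"
  shows "l2 f \<le> l2 (\<lambda>x. f x - g x) + l2 g"
  using l2_triangle[OF L2_diff[OF assms] assms(2)] by simp

lemma L2_norm_tendsto_0_iff:
  assumes "eventually (\<lambda>k. f k \<in> L2) A"
  shows "((\<lambda>k. L2_norm (f k)) \<longlongrightarrow> 0) A \<longleftrightarrow> ((\<lambda>k. l2 (f k)) \<longlongrightarrow> 0) A"
proof -
  have "((\<lambda>k. L2_norm (f k)) \<longlongrightarrow> 0) A \<longleftrightarrow> ((\<lambda>k. ennreal (l2 (f k))) \<longlongrightarrow> 0) A"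
    using assms by (intro tendsto_cong) (auto elim!: eventually_mono simp: L2_norm_eq_l2)
  also have "\<dots> \<longleftrightarrow> ((\<lambda>k. l2 (f k)) \<longlongrightarrow> 0) A"
    using tendsto_ennreal_iff[of "\<lambda>k. l2 (f k)" A 0] by simp
  finally show ?thesis .
qed

lemma L2_pairing_tendsto:
  assumes f: "eventually (\<lambda>k. f k \<in> L2) A" "f0 \<in> L2" and g: "g \<in> L2"
    and lim: "((\<lambda>k. l2 (\<lambda>x. f k x - f0 x)) \<longlongrightarrow> 0) A"
  shows "((\<lambda>k. \<integral>x. f k x * g x \<partial>lebesgue) \<longlongrightarrow> (\<integral>x. f0 x * g x \<partial>lebesgue)) A"
proof -
  have "((\<lambda>k. (\<integral>x. f k x * g x \<partial>lebesgue) - (\<integral>x. f0 x * g x \<partial>lebesgue)) \<longlongrightarrow> 0) A"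
  proof (rule Lim_null_comparison)
    show "((\<lambda>k. l2 (\<lambda>x. f k x - f0 x) * l2 g) \<longlongrightarrow> 0) A"
      using tendsto_mult_right[OF lim, of "l2 g"] by simp
    show "eventually (\<lambda>k. norm ((\<integral>x. f k x * g x \<partial>lebesgue) - (\<integral>x. f0 x * g x \<partial>lebesgue)) \<le> l2 (\<lambda>x. f k x - f0 x) * l2 g) A"
      using f(1)
    proof eventually_elim
      case (elim k)
      have "(\<integral>x. f k x * g x \<partial>lebesgue) - (\<integral>x. f0 x * g x \<partial>lebesgue) = (\<integral>x. (f k x - f0 x) * g x \<partial>lebesgue)"
        using L2_product_integrable[OF elim g] L2_product_integrable[OF f(2) g]
        by (simp add: left_diff_distrib)
      then show ?case using L2_Cauchy_Schwarz[OF L2_diff[OF elim f(2)] g] by simp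
    qed
  qed
  then show ?thesis by (simp add: LIM_zero_iff)
qed

lemma l2_Fatou:
  fixes f :: "nat \<Rightarrow> 'a::euclidean_space \<Rightarrow> complex"
  assumes f: "\<And>k. f k \<in> L2" and b: "\<And>k. k \<ge> K \<Longrightarrow> l2 (f k) \<le> B"
    and lim: "AE x in lebesgue. (\<lambda>k. f k x) \<longlonglongrightarrow> g x"
    and g [measurable]: "g \<in> borel_measurable lebesgue"
  shows "g \<in> L2" "l2 g \<le> B"
proof -
  have fm [measurable]: "\<And>k. f k \<in> borel_measurable lebesgue" using f by (simp add: L2_iff)
  have B: "0 \<le> B" using b[of K] l2_nonneg[of "f K"] by linarith
  have "(\<integral>\<^sup>+x. ennreal ((cmod (g x))\<^sup>2) \<partial>lebesgue)
      = (\<integral>\<^sup>+x. liminf (\<lambda>k. ennreal ((cmod (f k x))\<^sup>2)) \<partial>lebesgue)"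
  proof (rule nn_integral_cong_AE)
    show "AE x in lebesgue. ennreal ((cmod (g x))\<^sup>2) = liminf (\<lambda>k. ennreal ((cmod (f k x))\<^sup>2))"
      using lim
    proof eventually_elim
      case (elim x)
      then have "(\<lambda>k. ennreal ((cmod (f k x))\<^sup>2)) \<longlonglongrightarrow> ennreal ((cmod (g x))\<^sup>2)"
        by (intro tendsto_ennrealI tendsto_power tendsto_norm)
      from lim_imp_Liminf[OF _ this] show ?case by simp
    qed
  qed
  also have "\<dots> \<le> liminf (\<lambda>k. \<integral>\<^sup>+x. ennreal ((cmod (f k x))\<^sup>2) \<partial>lebesgue)"
    by (rule nn_integral_liminf) auto
  also have "\<dots> \<le> ennreal (B\<^sup>2)"
  proof (rule Liminf_le)
    have "(\<integral>\<^sup>+x. ennreal ((cmod (f k x))\<^sup>2) \<partial>lebesgue) \<le> ennreal (B\<^sup>2)" if "k \<ge> K" for k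
    proof -
      have "integrable lebesgue (\<lambda>x. (cmod (f k x))\<^sup>2)" using f[of k] by (simp add: L2_iff)
      from nn_integral_eq_integral[OF this]
      have "(\<integral>\<^sup>+x. ennreal ((cmod (f k x))\<^sup>2) \<partial>lebesgue) = ennreal ((l2 (f k))\<^sup>2)"
        by (simp add: l2_power2)
      also have "\<dots> \<le> ennreal (B\<^sup>2)" using b[OF that] by (intro ennreal_leI power_mono) auto
      finally show ?thesis .
    qed
    then show "\<forall>\<^sub>F k in sequentially. (\<integral>\<^sup>+x. ennreal ((cmod (f k x))\<^sup>2) \<partial>lebesgue) \<le> ennreal (B\<^sup>2)"
      by (auto simp: eventually_sequentially)
  qed simp
  finally have *: "(\<integral>\<^sup>+x. ennreal ((cmod (g x))\<^sup>2) \<partial>lebesgue) \<le> ennreal (B\<^sup>2)" .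
  then have i: "integrable lebesgue (\<lambda>x. (cmod (g x))\<^sup>2)"
    by (subst integrable_iff_bounded) (auto intro: le_less_trans)
  then show "g \<in> L2" by (simp add: L2_iff)
  have "ennreal ((l2 g)\<^sup>2) \<le> ennreal (B\<^sup>2)"
    using * nn_integral_eq_integral[OF i] by (simp add: l2_power2)
  then have "(l2 g)\<^sup>2 \<le> B\<^sup>2" by simp
  then show "l2 g \<le> B" using B by (rule power2_le_imp_le)
qed

text \<open>
  The Riesz--Fischer argument. Along a subsequence whose consecutive distances decay geometrically the
  functions converge almost everywhere, and Fatou's lemma upgrades this to convergence in \<open>L\<^sup>2\<close>.
\<close>

lemma L2_complete:
  fixes f :: "nat \<Rightarrow> 'a::euclidean_space \<Rightarrow> complex"
  assumes f: "\<And>k. f k \<in> L2"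
    and Cauchy: "\<And>e. e > 0 \<Longrightarrow> \<exists>N. \<forall>m\<ge>N. \<forall>n\<ge>N. l2 (\<lambda>x. f m x - f n x) < e"
  shows "\<exists>h\<in>L2. (\<lambda>k. l2 (\<lambda>x. f k x - h x)) \<longlonglongrightarrow> 0"
proof -
  have fm [measurable]: "\<And>k. f k \<in> borel_measurable lebesgue" using f by (simp add: L2_iff)
  have "\<forall>j. \<exists>N. \<forall>m\<ge>N. \<forall>n\<ge>N. l2 (\<lambda>x. f m x - f n x) < (1/4)^j"
    using Cauchy by simp
  then obtain N where N: "\<And>j m n. m \<ge> N j \<Longrightarrow> n \<ge> N j \<Longrightarrow> l2 (\<lambda>x. f m x - f n x) < (1/4)^j"
    by metis
  define r where "r j = (\<Sum>i\<le>j. N i) + j" for j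
  have rN: "r j \<ge> N j" for j
    unfolding r_def using member_le_sum[of j "{..j}" N] by auto
  have rmono: "r j \<le> r (Suc j)" for j unfolding r_def by simp
  have rj: "j \<le> r j" for j unfolding r_def by simp
  let ?d = "\<lambda>j x. f (r (Suc j)) x - f (r j) x"
  have d: "l2 (?d j) \<le> (1/4)^j" for j
    using N[where j = j and m = "r (Suc j)" and n = "r j"] rN[of j] rmono[of j] by simp
  have dL2: "?d j \<in> L2" for j by (intro L2_diff f)
  \<comment> \<open>The squared distances are at most \<open>16\<^sup>-\<^sup>j\<close>. The weight \<open>4\<^sup>j\<close> keeps the series of integrals convergent
    and leaves the summable pointwise bound \<open>O(2\<^sup>-\<^sup>j)\<close> for the increments.\<close>
  have i: "(\<integral>\<^sup>+x. ennreal (4^j * (cmod (?d j x))\<^sup>2) \<partial>lebesgue) \<le> ennreal ((1/4)^j)" for j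
  proof -
    have "integrable lebesgue (\<lambda>x. 4^j * (cmod (?d j x))\<^sup>2)" using dL2[of j] by (simp add: L2_iff)
    then have "(\<integral>\<^sup>+x. ennreal (4^j * (cmod (?d j x))\<^sup>2) \<partial>lebesgue) = ennreal (4^j * (l2 (?d j))\<^sup>2)"
      by (subst nn_integral_eq_integral) (auto simp: l2_power2)
    also have "\<dots> \<le> ennreal (4^j * ((1/4)^j)\<^sup>2)"
      using d[of j] by (intro ennreal_leI mult_left_mono power_mono) auto
    also have "4^j * ((1/4)^j)\<^sup>2 = (1/4::real)^j"
      by (simp add: power2_eq_square power_mult_distrib[symmetric] mult.assoc[symmetric])
    finally show ?thesis .
  qed
  have "(\<integral>\<^sup>+x. (\<Sum>j. ennreal (4^j * (cmod (?d j x))\<^sup>2)) \<partial>lebesgue)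
      = (\<Sum>j. \<integral>\<^sup>+x. ennreal (4^j * (cmod (?d j x))\<^sup>2) \<partial>lebesgue)"
    by (rule nn_integral_suminf) auto
  also have "\<dots> \<le> (\<Sum>j. ennreal ((1/4)^j))" by (intro suminf_le i) auto
  also have "(\<Sum>j. ennreal ((1/4)^j)) = ennreal (\<Sum>j. (1/4)^j)"
    by (rule suminf_ennreal2) (simp_all add: summable_geometric)
  also have "\<dots> < \<infinity>" by simp
  finally have "AE x in lebesgue. (\<Sum>j. ennreal (4^j * (cmod (?d j x))\<^sup>2)) \<noteq> \<infinity>"
    by (intro nn_integral_noteq_infinite) auto
  then have conv: "AE x in lebesgue. convergent (\<lambda>j. f (r j) x)"
  proof eventually_elim
    case (elim x)
    define S where "S = (\<Sum>j. ennreal (4^j * (cmod (?d j x))\<^sup>2))"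
    have S: "S \<noteq> \<infinity>" using elim by (simp add: S_def)
    have le: "4^j * (cmod (?d j x))\<^sup>2 \<le> enn2real S" for j
    proof -
      have "(\<Sum>j\<in>{j}. ennreal (4^j * (cmod (?d j x))\<^sup>2)) \<le> S"
        unfolding S_def by (rule sum_le_suminf) auto
      then have "ennreal (4^j * (cmod (?d j x))\<^sup>2) \<le> S"
        by (simp only: sum.insert finite.emptyI empty_iff not_False_eq_True sum.empty add_0_right)
      then show ?thesis using S enn2real_mono[of "ennreal (4^j * (cmod (?d j x))\<^sup>2)" S]
        by (simp add: less_top)
    qed
    have le2: "norm (?d j x) \<le> sqrt (enn2real S) * (1/2)^j" for j
    proof (rule power2_le_imp_le)
      have "((1/2)^j)\<^sup>2 = (1/4::real)^j" by (simp add: power2_eq_square power_mult_distrib[symmetric])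
      moreover have "(cmod (?d j x))\<^sup>2 \<le> enn2real S * (1/4)^j"
        using le[of j] by (simp add: field_simps power_divide)
      ultimately show "(norm (?d j x))\<^sup>2 \<le> (sqrt (enn2real S) * (1/2)^j)\<^sup>2"
        by (simp add: power_mult_distrib)
    qed auto
    have "summable (\<lambda>j. ?d j x)"
      by (rule summable_comparison_test'[OF _ le2]) (intro summable_mult summable_geometric, simp)
    then have "convergent (\<lambda>n. (\<Sum>j<n. ?d j x))" by (simp add: summable_iff_convergent)
    then have "convergent (\<lambda>n. (\<Sum>j<n. ?d j x) + f (r 0) x)"
      by (intro convergent_add convergent_const)
    moreover have "(\<Sum>j<n. ?d j x) + f (r 0) x = f (r n) x" for n
      using sum_lessThan_telescope[of "\<lambda>j. f (r j) x" n] by simp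
    ultimately show ?case by simp
  qed
  define h where "h x = lim (\<lambda>j. f (r j) x)" for x
  have hm [measurable]: "h \<in> borel_measurable lebesgue"
    unfolding h_def by measurable
  have hlim: "AE x in lebesgue. (\<lambda>j. f (r j) x) \<longlonglongrightarrow> h x"
    using conv by eventually_elim (simp add: h_def convergent_LIMSEQ_iff)
  have small: "(\<lambda>x. f k x - h x) \<in> L2 \<and> l2 (\<lambda>x. f k x - h x) \<le> e"
    if M: "\<And>m n. m \<ge> M \<Longrightarrow> n \<ge> M \<Longrightarrow> l2 (\<lambda>x. f m x - f n x) < e" and k: "k \<ge> M" for M k e
  proof -
    have "l2 (\<lambda>x. f k x - f (r j) x) \<le> e" if "j \<ge> M" for j
      using M[OF k, of "r j"] rj[of j] that by simp
    moreover have "AE x in lebesgue. (\<lambda>j. f k x - f (r j) x) \<longlonglongrightarrow> f k x - h x"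
      using hlim by eventually_elim (intro tendsto_intros)
    ultimately show ?thesis
      using l2_Fatou[where f = "\<lambda>j x. f k x - f (r j) x" and g = "\<lambda>x. f k x - h x" and K = M and B = e]
        L2_diff[OF f f] by auto
  qed
  obtain M where "\<forall>m\<ge>M. \<forall>n\<ge>M. l2 (\<lambda>x. f m x - f n x) < 1" using Cauchy[of 1] by auto
  then have "(\<lambda>x. f M x - h x) \<in> L2" using small[of M 1 M] by auto
  from L2_diff[OF f[of M] this] have hL2: "h \<in> L2" by simp
  have "(\<lambda>k. l2 (\<lambda>x. f k x - h x)) \<longlonglongrightarrow> 0"
  proof (rule LIMSEQ_I)
    fix e :: real assume "e > 0"
    then obtain M where "\<forall>m\<ge>M. \<forall>n\<ge>M. l2 (\<lambda>x. f m x - f n x) < e/2" using Cauchy[of "e/2"] by auto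
    then have le: "l2 (\<lambda>x. f k x - h x) \<le> e/2" if "k \<ge> M" for k using small[of M "e/2" k] that by auto
    have "norm (l2 (\<lambda>x. f k x - h x) - 0) < e" if "k \<ge> M" for k
      using le[OF that] \<open>e > 0\<close> by simp
    then show "\<exists>no. \<forall>n\<ge>no. norm (l2 (\<lambda>x. f n x - h x) - 0) < e" by blast
  qed
  with hL2 show ?thesis by blast
qed

lemma lebesgue_borel_representative:
  fixes f :: "'a::euclidean_space \<Rightarrow> complex"
  assumes "f \<in> borel_measurable lebesgue"
  shows "\<exists>g\<in>borel_measurable borel. AE x in lborel. f x = g x"
proof -
  have "(\<lambda>x. Re (f x)) \<in> borel_measurable lebesgue" "(\<lambda>x. Im (f x)) \<in> borel_measurable lebesgue"
    using assms by measurable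
  then obtain g1 g2 where g: "g1 \<in> borel_measurable lborel" "g2 \<in> borel_measurable lborel"
     "AE x in lborel. Re (f x) = g1 x" "AE x in lborel. Im (f x) = g2 x"
    using completion_ex_borel_measurable_real by metis
  have "AE x in lborel. f x = Complex (g1 x) (g2 x)"
    using g(3,4) by eventually_elim (simp add: complex_eq_iff)
  moreover have "(\<lambda>x. Complex (g1 x) (g2 x)) \<in> borel_measurable borel"
    using g(1,2) by (simp add: borel_measurable_complex_iff)
  ultimately show ?thesis by (rule bexI)
qed

section \<open>Gaussians\<close>

abbreviation gauss :: "real \<Rightarrow> 'a::real_normed_vector \<Rightarrow> real" where
  "gauss c x \<equiv> exp (- c * (norm x)\<^sup>2)"

text \<open>
  Rescaling by \<open>sqrt (2c)\<close> turns the integral into the characteristic function of the standard normal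
  distribution.
\<close>

lemma gaussian_fourier_1D:
  fixes t c :: real
  assumes c: "c > 0"
  shows "integrable lborel (\<lambda>x::real. cis (t * x) * complex_of_real (exp (- c * x\<^sup>2)))" (is ?i)
    and "(\<integral>x. cis (t * x) * complex_of_real (exp (- c * x\<^sup>2)) \<partial>lborel)
         = complex_of_real (sqrt (pi / c) * exp (- t\<^sup>2 / (4 * c)))" (is ?e)
proof -
  define r where "r = sqrt (2 * c)"
  have r: "r > 0" "r\<^sup>2 = 2 * c" using c by (auto simp: r_def)
  let ?g = "\<lambda>x::real. iexp (t / r * x) * complex_of_real (std_normal_density x)"
  have [measurable]: "std_normal_density \<in> borel_measurable borel" by simp
  have gi: "integrable lborel ?g"
  proof (rule Bochner_Integration.integrable_bound)
    show "integrable lborel std_normal_density" by (rule integrable_normal_density) simp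
    show "?g \<in> borel_measurable lborel" by measurable
  qed (simp add: norm_mult)
  have "char std_normal_distribution (t / r) = (\<integral>x. std_normal_density x *\<^sub>R iexp (t / r * x) \<partial>lborel)"
    unfolding char_def by (subst integral_density) auto
  then have ge: "(\<integral>x. ?g x \<partial>lborel) = complex_of_real (exp (- (t / r)\<^sup>2 / 2))"
    by (simp add: char_std_normal_distribution scaleR_conv_of_real mult.commute)
  have eq: "?g (0 + r * x) = complex_of_real (1 / sqrt (2 * pi)) * (cis (t * x) * complex_of_real (exp (- c * x\<^sup>2)))" for x
  proof -
    have "t / r * (0 + r * x) = t * x" using r by simp
    moreover have "(0 + r * x)\<^sup>2 / 2 = c * x\<^sup>2" using r by (simp add: power_mult_distrib)
    then have "std_normal_density (0 + r * x) = 1 / sqrt (2 * pi) * exp (- c * x\<^sup>2)"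
      by (simp add: std_normal_density_def)
    ultimately show ?thesis by (simp add: cis_conv_exp)
  qed
  have "integrable lborel (\<lambda>x. ?g (0 + r * x))"
    using r by (intro lborel_integrable_real_affine gi) simp
  then have i: "integrable lborel (\<lambda>x. complex_of_real (1 / sqrt (2 * pi)) * (cis (t * x) * complex_of_real (exp (- c * x\<^sup>2))))"
    unfolding eq .
  have "integrable lborel (\<lambda>x. complex_of_real (sqrt (2 * pi)) * (complex_of_real (1 / sqrt (2 * pi)) * (cis (t * x) * complex_of_real (exp (- c * x\<^sup>2)))))"
    by (intro integrable_mult_right i)
  then show i': ?i by (simp add: mult.assoc[symmetric] of_real_mult[symmetric] del: of_real_mult)
  have "(\<integral>x. ?g x \<partial>lborel) = \<bar>r\<bar> *\<^sub>R (\<integral>x. ?g (0 + r * x) \<partial>lborel)"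
    using r by (intro lborel_integral_real_affine) simp
  also have "\<dots> = \<bar>r\<bar> *\<^sub>R (complex_of_real (1 / sqrt (2 * pi)) * (\<integral>x. cis (t * x) * complex_of_real (exp (- c * x\<^sup>2)) \<partial>lborel))"
    unfolding eq by (simp only: integral_mult_right_zero)
  finally have "complex_of_real (exp (- (t / r)\<^sup>2 / 2)) = complex_of_real (r / sqrt (2 * pi)) * (\<integral>x. cis (t * x) * complex_of_real (exp (- c * x\<^sup>2)) \<partial>lborel)"
    using r ge by (simp add: scaleR_conv_of_real)
  then have "(\<integral>x. cis (t * x) * complex_of_real (exp (- c * x\<^sup>2)) \<partial>lborel)
    = complex_of_real (exp (- (t / r)\<^sup>2 / 2)) / complex_of_real (r / sqrt (2 * pi))"
    using r by (simp add: field_simps)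
  also have "\<dots> = complex_of_real (sqrt (2 * pi) / r * exp (- (t / r)\<^sup>2 / 2))"
    by simp
  also have "sqrt (2 * pi) / r = sqrt (pi / c)"
    unfolding r_def using c by (simp add: real_sqrt_divide real_sqrt_mult)
  also have "- (t / r)\<^sup>2 / 2 = - t\<^sup>2 / (4 * c)"
    using r by (simp add: power_divide)
  finally show ?e .
qed

text \<open>
  The integrand is a product of functions of the single coordinates, and Lebesgue measure is the
  image of a product measure.
\<close>

lemma gaussian_fourier:
  fixes \<xi> :: "'a::euclidean_space"
  assumes c: "c > 0"
  shows "integrable lborel (\<lambda>x::'a. cis (x \<bullet> \<xi>) * complex_of_real (gauss c x))" (is ?i)
    and "(\<integral>x. cis (x \<bullet> \<xi>) * complex_of_real (gauss c x) \<partial>lborel)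
         = complex_of_real ((pi / c) powr (DIM('a) / 2) * exp (- (norm \<xi>)\<^sup>2 / (4 * c)))" (is ?e)
proof -
  interpret P: product_sigma_finite "\<lambda>b::'a. lborel :: real measure" by standard
  let ?T = "\<lambda>f. \<Sum>b\<in>(Basis::'a set). f b *\<^sub>R b"
  let ?k = "\<lambda>x::'a. cis (x \<bullet> \<xi>) * complex_of_real (gauss c x)"
  let ?k1 = "\<lambda>b x::real. cis ((b \<bullet> \<xi>) * x) * complex_of_real (exp (- c * x\<^sup>2))"
  have T [measurable]: "?T \<in> (\<Pi>\<^sub>M b\<in>Basis. lborel) \<rightarrow>\<^sub>M borel" by measurable
  have km [measurable]: "?k \<in> borel_measurable borel"
    by (simp add: cis_conv_exp)
  have cisprod: "cis (\<Sum>b\<in>A. g b) = (\<Prod>b\<in>A. cis (g b))" if "finite A" for g and A :: "'a set"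
    using that by induction (simp_all add: cis_mult[symmetric])
  have Tk: "?k (?T f) = (\<Prod>b\<in>Basis. ?k1 b (f b))" for f
  proof -
    have "(norm (?T f))\<^sup>2 = (\<Sum>b\<in>Basis. (f b)\<^sup>2)"
      by (subst norm_sum_Pythagorean)
         (auto simp: pairwise_def orthogonal_def inner_Basis)
    moreover have "?T f \<bullet> \<xi> = (\<Sum>b\<in>Basis. (b \<bullet> \<xi>) * f b)"
      by (simp add: inner_sum_left mult.commute)
    ultimately show ?thesis
      by (simp add: cisprod prod.distrib sum_distrib_left sum_negf[symmetric] exp_sum of_real_prod[symmetric] del: of_real_prod)
  qed
  have "integrable (\<Pi>\<^sub>M b\<in>(Basis::'a set). lborel) (\<lambda>f. \<Prod>b\<in>Basis. ?k1 b (f b))"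
    by (intro P.product_integrable_prod gaussian_fourier_1D[OF c]) simp
  then have "integrable (distr (\<Pi>\<^sub>M b\<in>(Basis::'a set). lborel) borel ?T) ?k"
    by (simp only: integrable_distr_eq[OF T km] Tk)
  then show ?i by (subst lborel_eq)
  have "(\<integral>x. ?k x \<partial>lborel) = (\<integral>f. ?k (?T f) \<partial>(\<Pi>\<^sub>M b\<in>(Basis::'a set). lborel))"
    using integral_distr[OF T km] by (simp only: lborel_eq[symmetric])
  also have "\<dots> = (\<Prod>b\<in>(Basis::'a set). \<integral>x. ?k1 b x \<partial>lborel)"
    unfolding Tk by (intro P.product_integral_prod gaussian_fourier_1D[OF c]) simp
  also have "\<dots> = (\<Prod>b\<in>(Basis::'a set). complex_of_real (sqrt (pi / c) * exp (- (b \<bullet> \<xi>)\<^sup>2 / (4 * c))))"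
    by (intro prod.cong refl gaussian_fourier_1D[OF c])
  also have "\<dots> = complex_of_real (sqrt (pi / c) ^ DIM('a) * exp (\<Sum>b\<in>(Basis::'a set). - (b \<bullet> \<xi>)\<^sup>2 / (4 * c)))"
    by (simp add: prod.distrib exp_sum)
  also have "(\<Sum>b\<in>(Basis::'a set). - (b \<bullet> \<xi>)\<^sup>2 / (4 * c)) = - (norm \<xi>)\<^sup>2 / (4 * c)"
    by (simp add: sum_divide_distrib[symmetric] sum_negf norm_eq_sqrt_inner[of \<xi>] euclidean_inner[of \<xi> \<xi>] power2_eq_square[symmetric] sum_nonneg inner_commute)
  also have "sqrt (pi / c) ^ DIM('a) = (pi / c) powr (DIM('a) / 2)"
    using c by (simp add: powr_half_sqrt[symmetric] powr_powr powr_realpow[symmetric])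
  finally show ?e .
qed

lemma gaussian_integral:
  assumes c: "c > 0"
  shows "integrable lborel (\<lambda>x::'a::euclidean_space. gauss c x)" (is ?i)
    and "(\<integral>x. gauss c x \<partial>(lborel :: 'a measure)) = (pi / c) powr (DIM('a) / 2)" (is ?e)
proof -
  have i: "integrable lborel (\<lambda>x::'a. complex_of_real (gauss c x))"
    using gaussian_fourier(1)[OF c, of 0] by simp
  then show ?i by (simp only: complex_of_real_integrable_eq)
  then show ?e using gaussian_fourier(2)[OF c, of "0::'a"]
    by (simp del: of_real_mult)
qed

lemma lborel_translate:
  fixes f :: "'a::euclidean_space \<Rightarrow> 'b::{banach, second_countable_topology}"
  assumes "f \<in> borel_measurable borel"
  shows "(\<integral>x. f (t + x) \<partial>lborel) = (\<integral>x. f x \<partial>lborel)"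
    and "integrable lborel (\<lambda>x. f (t + x)) \<longleftrightarrow> integrable lborel f"
proof -
  have eq: "lborel = distr lborel borel (\<lambda>x::'a. t + x)"
    using lborel_affine[of 1 t] by (simp add: density_1)
  have [measurable]: "f \<in> borel_measurable borel" by fact
  show "(\<integral>x. f (t + x) \<partial>lborel) = (\<integral>x. f x \<partial>lborel)"
    by (subst (2) eq, subst integral_distr) auto
  show "integrable lborel (\<lambda>x. f (t + x)) \<longleftrightarrow> integrable lborel f"
    by (subst (2) eq, subst integrable_distr_eq) auto
qed

lemma gaussian_translate_integral:
  fixes y :: "'a::euclidean_space"
  assumes c: "c > 0"
  shows "integrable lborel (\<lambda>x. gauss c (x - y))"
    and "(\<integral>x. gauss c (x - y) \<partial>lborel) = (pi / c) powr (DIM('a) / 2)"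
  using lborel_translate[of "\<lambda>x::'a. gauss c x" "- y"] gaussian_integral[OF c, where 'a = 'a]
  by (auto simp: )

lemma integrable_lborel_imp_lebesgue:
  fixes f :: "'a::euclidean_space \<Rightarrow> 'b::{banach, second_countable_topology}"
  assumes "integrable lborel f" shows "integrable lebesgue f"
  using assms by (subst integrable_completion) (auto dest: borel_measurable_integrable)

lemma integral_lebesgue_eq_lborel:
  fixes f :: "'a::euclidean_space \<Rightarrow> 'b::{banach, second_countable_topology}"
  assumes "f \<in> borel_measurable borel" shows "(\<integral>x. f x \<partial>lebesgue) = (\<integral>x. f x \<partial>lborel)"
  using assms by (intro integral_completion) simp

lemma borel_measurable_imp_lebesgue:
  "f \<in> borel_measurable borel \<Longrightarrow> f \<in> borel_measurable lebesgue"
  by (rule measurable_completion) simp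

lemma gaussian_translate_L2:
  fixes y :: "'a::euclidean_space"
  assumes c: "c > 0"
  shows "(\<lambda>x. complex_of_real (gauss c (x - y))) \<in> L2"
proof -
  have "(cmod (complex_of_real (gauss c (x - y))))\<^sup>2 = gauss (2 * c) (x - y)" for x
    by (simp add: power2_eq_square exp_add[symmetric])
  moreover have "integrable lebesgue (\<lambda>x. gauss (2 * c) (x - y))"
    using gaussian_translate_integral(1)[of "2 * c" y] c by (intro integrable_lborel_imp_lebesgue) simp
  moreover have "(\<lambda>x. complex_of_real (gauss c (x - y))) \<in> borel_measurable lebesgue"
    by (rule borel_measurable_imp_lebesgue) measurable
  ultimately show ?thesis by (simp only: L2_iff)
qed

lemma gaussian_L2: "c > 0 \<Longrightarrow> (\<lambda>x::'a::euclidean_space. complex_of_real (gauss c x)) \<in> L2"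
  using gaussian_translate_L2[of c 0] by simp

section \<open>The Fourier transform of integrable functions\<close>

definition FT :: "real \<Rightarrow> (real^'n \<Rightarrow> complex) \<Rightarrow> real^'n \<Rightarrow> complex" where
  "FT \<epsilon> f \<xi> = complex_of_real ((2 * pi) powr (- real CARD('n) / 2)) *
     (\<integral> x. cis (\<epsilon> * (x \<bullet> \<xi>)) * f x \<partial>lebesgue)"

lemma borel_measurable_cis [measurable]: "f \<in> borel_measurable M \<Longrightarrow> (\<lambda>x. cis (f x)) \<in> borel_measurable M"
  by (simp add: cis_conv_exp)

lemma integrable_cis_mult:
  assumes "integrable M f" "g \<in> borel_measurable M"
  shows "integrable M (\<lambda>x. cis (g x) * f x)"
proof (rule Bochner_Integration.integrable_bound[OF assms(1)])
  show "(\<lambda>x. cis (g x) * f x) \<in> borel_measurable M"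
    using assms by (intro borel_measurable_times borel_measurable_cis) auto
qed (simp add: norm_mult)

lemma inner_lebesgue_measurable [measurable]:
  "(\<lambda>x::'a::euclidean_space. x \<bullet> \<xi>) \<in> borel_measurable lebesgue"
  by (rule borel_measurable_imp_lebesgue) measurable

lemma FT_cong_AE:
  assumes "AE x in lebesgue. f x = g x" "f \<in> borel_measurable lebesgue" "g \<in> borel_measurable lebesgue"
  shows "FT \<epsilon> f = FT \<epsilon> g"
proof
  fix \<xi>
  have "(\<integral> x. cis (\<epsilon> * (x \<bullet> \<xi>)) * f x \<partial>lebesgue) = (\<integral> x. cis (\<epsilon> * (x \<bullet> \<xi>)) * g x \<partial>lebesgue)"
    using assms by (intro integral_cong_AE borel_measurable_times borel_measurable_cis borel_measurable_const inner_lebesgue_measurable) auto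
  then show "FT \<epsilon> f \<xi> = FT \<epsilon> g \<xi>" by (simp add: FT_def)
qed

lemma FT_borel:
  assumes [measurable]: "f \<in> borel_measurable borel"
  shows "FT \<epsilon> f \<xi> = complex_of_real ((2 * pi) powr (- real CARD('n) / 2)) *
     (\<integral> x. cis (\<epsilon> * (x \<bullet> \<xi>)) * f (x::real^'n) \<partial>lborel)"
  unfolding FT_def by (subst integral_lebesgue_eq_lborel) auto

lemma integrable_borel_representative:
  fixes f :: "'a::euclidean_space \<Rightarrow> complex"
  assumes "integrable lebesgue f"
  obtains g where "g \<in> borel_measurable borel" "AE x in lebesgue. f x = g x" "integrable lborel g"
proof -
  obtain g where g: "g \<in> borel_measurable borel" "AE x in lborel. f x = g x"
    using lebesgue_borel_representative[of f] assms by auto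
  have ae: "AE x in lebesgue. f x = g x" using g(2) by (rule AE_completion)
  have "integrable lebesgue g"
    using assms ae borel_measurable_imp_lebesgue[OF g(1)]
    by (subst integrable_cong_AE[of _ _ f]) (auto simp: eq_commute)
  then have "integrable lborel g" using g(1) by (subst (asm) integrable_completion) simp_all
  then show ?thesis using that g ae by blast
qed

lemma FT_borel_measurable:
  assumes "integrable lebesgue f"
  shows "FT \<epsilon> (f :: real^'n \<Rightarrow> complex) \<in> borel_measurable borel"
proof -
  obtain g where g: "g \<in> borel_measurable borel" "AE x in lebesgue. f x = g x" "integrable lborel g"
    using integrable_borel_representative[OF assms] .
  have "FT \<epsilon> f = FT \<epsilon> g" using assms g by (intro FT_cong_AE) (auto intro: borel_measurable_imp_lebesgue)
  also have "FT \<epsilon> g \<in> borel_measurable borel"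
  proof -
    have [measurable]: "g \<in> borel_measurable borel" by fact
    have "(\<lambda>\<xi>. complex_of_real ((2 * pi) powr (- real CARD('n) / 2)) *
     (\<integral> x. cis (\<epsilon> * (x \<bullet> \<xi>)) * g x \<partial>lborel)) \<in> borel_measurable borel"
      by measurable
    moreover have "FT \<epsilon> g = (\<lambda>\<xi>. complex_of_real ((2 * pi) powr (- real CARD('n) / 2)) *
     (\<integral> x. cis (\<epsilon> * (x \<bullet> \<xi>)) * g x \<partial>lborel))"
      using FT_borel[OF g(1)] by (intro ext)
    ultimately show ?thesis by simp
  qed
  finally show ?thesis .
qed

lemma FT_bounded: "cmod (FT \<epsilon> f \<xi>) \<le> (2 * pi) powr (- real CARD('n) / 2) * (\<integral> x. cmod (f x) \<partial>lebesgue)"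
  for f :: "real^'n \<Rightarrow> complex"
proof -
  have "cmod (\<integral> x. cis (\<epsilon> * (x \<bullet> \<xi>)) * f x \<partial>lebesgue) \<le> (\<integral> x. cmod (cis (\<epsilon> * (x \<bullet> \<xi>)) * f x) \<partial>lebesgue)"
    by (rule integral_norm_bound)
  then show ?thesis by (simp add: FT_def norm_mult mult_left_mono)
qed

lemma integrable_pair_mult:
  fixes f :: "'a::euclidean_space \<Rightarrow> complex" and g :: "'b::euclidean_space \<Rightarrow> complex"
  assumes "integrable lborel f" "integrable lborel g"
  shows "integrable (lborel \<Otimes>\<^sub>M lborel) (\<lambda>(x, y). f x * g y)"
proof (rule lborel_pair.Fubini_integrable)
  have [measurable]: "f \<in> borel_measurable borel" "g \<in> borel_measurable borel"
    using assms by (auto dest: borel_measurable_integrable)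
  show "(\<lambda>(x, y). f x * g y) \<in> borel_measurable (lborel \<Otimes>\<^sub>M lborel)" by measurable
  show "integrable lborel (\<lambda>x. LBINT y. norm (case (x, y) of (x, y) \<Rightarrow> f x * g y))"
    using assms by (auto simp: norm_mult)
  show "AE x in lborel. integrable lborel (\<lambda>y. case (x, y) of (x, y) \<Rightarrow> f x * g y)"
    using assms by auto
qed

text \<open>
  The multiplication formula is Fubini's theorem applied to \<open>e\<^sup>i\<^sup>\<epsilon>\<^sup>x\<^sup>\<xi> f(x) k(\<xi>)\<close>. Borel representatives are
  needed because completed Lebesgue measure is not a product measure.
\<close>

lemma FT_multiplication:
  fixes f k :: "real^'n \<Rightarrow> complex"
  assumes f: "integrable lebesgue f" and k: "integrable lebesgue k"
  shows "(\<integral>\<xi>. FT \<epsilon> f \<xi> * k \<xi> \<partial>lebesgue) = (\<integral>x. f x * FT \<epsilon> k x \<partial>lebesgue)"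
proof -
  obtain f' where f': "f' \<in> borel_measurable borel" "AE x in lebesgue. f x = f' x" "integrable lborel f'"
    using integrable_borel_representative[OF f] .
  obtain k' where k': "k' \<in> borel_measurable borel" "AE x in lebesgue. k x = k' x" "integrable lborel k'"
    using integrable_borel_representative[OF k] .
  note [measurable] = f'(1) k'(1)
  have Ff: "FT \<epsilon> f = FT \<epsilon> f'" using f f' by (intro FT_cong_AE) (auto intro: borel_measurable_imp_lebesgue)
  have Fk: "FT \<epsilon> k = FT \<epsilon> k'" using k k' by (intro FT_cong_AE) (auto intro: borel_measurable_imp_lebesgue)
  have mF [measurable]: "FT \<epsilon> f' \<in> borel_measurable borel" "FT \<epsilon> k' \<in> borel_measurable borel"
    using FT_borel_measurable f k Ff Fk by metis+
  define c where "c = complex_of_real ((2 * pi) powr (- real CARD('n) / 2))"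
  have int: "integrable (lborel \<Otimes>\<^sub>M lborel) (\<lambda>(x, \<xi>). cis (\<epsilon> * (x \<bullet> \<xi>)) * (f' x * k' \<xi>))"
  proof (rule Bochner_Integration.integrable_bound[OF integrable_pair_mult[OF f'(3) k'(3)]])
    show "(\<lambda>(x, \<xi>). cis (\<epsilon> * (x \<bullet> \<xi>)) * (f' x * k' \<xi>)) \<in> borel_measurable (lborel \<Otimes>\<^sub>M lborel)"
      by measurable
  qed (simp add: norm_mult split: prod.split)
  have "(\<integral>\<xi>. FT \<epsilon> f \<xi> * k \<xi> \<partial>lebesgue) = (\<integral>\<xi>. FT \<epsilon> f' \<xi> * k' \<xi> \<partial>lebesgue)"
    unfolding Ff using k' k borel_measurable_imp_lebesgue[OF mF(1)] borel_measurable_imp_lebesgue[OF k'(1)]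
    by (intro integral_cong_AE) auto
  also have "\<dots> = (\<integral>\<xi>. FT \<epsilon> f' \<xi> * k' \<xi> \<partial>lborel)" by (intro integral_lebesgue_eq_lborel) measurable
  also have "\<dots> = (\<integral>\<xi>. c * (\<integral>x. cis (\<epsilon> * (x \<bullet> \<xi>)) * (f' x * k' \<xi>) \<partial>lborel) \<partial>lborel)"
    by (simp add: FT_borel[OF f'(1)] c_def mult.assoc[symmetric])
  also have "\<dots> = c * (\<integral>\<xi>. (\<integral>x. cis (\<epsilon> * (x \<bullet> \<xi>)) * (f' x * k' \<xi>) \<partial>lborel) \<partial>lborel)"
    by simp
  also have "\<dots> = c * (\<integral>x. (\<integral>\<xi>. cis (\<epsilon> * (x \<bullet> \<xi>)) * (f' x * k' \<xi>) \<partial>lborel) \<partial>lborel)"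
    using lborel_pair.Fubini_integral[OF int] by simp
  also have "\<dots> = (\<integral>x. f' x * (c * (\<integral>\<xi>. cis (\<epsilon> * (\<xi> \<bullet> x)) * k' \<xi> \<partial>lborel)) \<partial>lborel)"
  proof -
    have "(\<integral>\<xi>. cis (\<epsilon> * (x \<bullet> \<xi>)) * (f' x * k' \<xi>) \<partial>lborel) = (\<integral>\<xi>. f' x * (cis (\<epsilon> * (\<xi> \<bullet> x)) * k' \<xi>) \<partial>lborel)" for x
      by (intro Bochner_Integration.integral_cong refl) (simp add: inner_commute mult_ac)
    then have "c * (\<integral>x. (\<integral>\<xi>. cis (\<epsilon> * (x \<bullet> \<xi>)) * (f' x * k' \<xi>) \<partial>lborel) \<partial>lborel)
      = (\<integral>x. c * (f' x * (\<integral>\<xi>. cis (\<epsilon> * (\<xi> \<bullet> x)) * k' \<xi> \<partial>lborel)) \<partial>lborel)"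
      by (simp only: integral_mult_right_zero)
    then show ?thesis by (simp only: mult.left_commute[of c])
  qed
  also have "\<dots> = (\<integral>x. f' x * FT \<epsilon> k' x \<partial>lborel)"
    by (simp add: FT_borel[OF k'(1)] c_def)
  also have "\<dots> = (\<integral>x. f' x * FT \<epsilon> k' x \<partial>lebesgue)" by (intro integral_lebesgue_eq_lborel[symmetric]) measurable
  also have "\<dots> = (\<integral>x. f x * FT \<epsilon> k x \<partial>lebesgue)"
    unfolding Fk using f' f borel_measurable_imp_lebesgue[OF mF(2)] borel_measurable_imp_lebesgue[OF f'(1)]
    by (intro integral_cong_AE) auto
  finally show ?thesis .
qed

lemma FT_cnj: "cnj (FT \<epsilon> f \<xi>) = FT (- \<epsilon>) (\<lambda>x. cnj (f x)) \<xi>"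
proof -
  have "cnj (\<integral> x. cis (\<epsilon> * (x \<bullet> \<xi>)) * f x \<partial>lebesgue) = (\<integral> x. cnj (cis (\<epsilon> * (x \<bullet> \<xi>)) * f x) \<partial>lebesgue)"
    by (rule Bochner_Integration.integral_cnj[symmetric])
  then show ?thesis by (simp add: FT_def cis_cnj)
qed

lemma FT_gaussian_modulated:
  fixes y x :: "real^'n"
  assumes c: "c > 0" and e: "\<epsilon> = 1 \<or> \<epsilon> = -1"
  shows "FT \<epsilon> (\<lambda>\<xi>. cis (- \<epsilon> * (\<xi> \<bullet> y)) * complex_of_real (gauss c \<xi>)) x
     = complex_of_real ((2 * c) powr (- real CARD('n) / 2) * exp (- (norm (x - y))\<^sup>2 / (4 * c)))"
proof -
  have "(\<integral>\<xi>. cis (\<epsilon> * (\<xi> \<bullet> x)) * (cis (- \<epsilon> * (\<xi> \<bullet> y)) * complex_of_real (gauss c \<xi>)) \<partial>lborel)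
      = (\<integral>\<xi>. cis (\<xi> \<bullet> (\<epsilon> *\<^sub>R (x - y))) * complex_of_real (gauss c \<xi>) \<partial>lborel)"
    by (intro Bochner_Integration.integral_cong refl)
       (simp add: mult.assoc[symmetric] cis_mult inner_diff_right algebra_simps)
  also have "\<dots> = complex_of_real ((pi / c) powr (real CARD('n) / 2) * exp (- (norm (\<epsilon> *\<^sub>R (x - y)))\<^sup>2 / (4 * c)))"
    using gaussian_fourier(2)[OF c, of "\<epsilon> *\<^sub>R (x - y)"] by simp
  also have "(norm (\<epsilon> *\<^sub>R (x - y)))\<^sup>2 = (norm (x - y))\<^sup>2" using e by auto
  finally have "FT \<epsilon> (\<lambda>\<xi>. cis (- \<epsilon> * (\<xi> \<bullet> y)) * complex_of_real (gauss c \<xi>)) x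
    = complex_of_real ((2 * pi) powr (- real CARD('n) / 2) * (pi / c) powr (real CARD('n) / 2) * exp (- (norm (x - y))\<^sup>2 / (4 * c)))"
    by (subst FT_borel) (auto simp: mult.assoc)
  also have "(2 * pi) powr (- real CARD('n) / 2) * (pi / c) powr (real CARD('n) / 2) = (2 * c) powr (- real CARD('n) / 2)"
    using c by (simp add: powr_mult powr_divide powr_minus field_simps)
  finally show ?thesis .
qed

lemma FT_gaussian:
  fixes x :: "real^'n"
  assumes c: "c > 0" and e: "\<epsilon> = 1 \<or> \<epsilon> = -1"
  shows "FT \<epsilon> (\<lambda>\<xi>. complex_of_real (gauss c \<xi>)) x
     = complex_of_real ((2 * c) powr (- real CARD('n) / 2) * exp (- (norm x)\<^sup>2 / (4 * c)))"
  using FT_gaussian_modulated[OF c e, of 0 x] by simp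

lemma FT_add_diff:
  assumes "integrable lebesgue f" "integrable lebesgue g"
  shows "FT \<epsilon> (\<lambda>x. f x - g x) \<xi> = FT \<epsilon> f \<xi> - FT \<epsilon> g \<xi>"
proof -
  have "integrable lebesgue (\<lambda>x. cis (\<epsilon> * (x \<bullet> \<xi>)) * f x)" "integrable lebesgue (\<lambda>x. cis (\<epsilon> * (x \<bullet> \<xi>)) * g x)"
    using assms by (auto intro!: integrable_cis_mult)
  then show ?thesis by (simp add: FT_def right_diff_distrib)
qed

lemma integrable_gaussian_lebesgue:
  assumes "c > 0"
  shows "integrable lebesgue (\<lambda>x::'a::euclidean_space. complex_of_real (gauss c x))"
  using gaussian_integral(1)[OF assms, where 'a='a]
  by (intro integrable_lborel_imp_lebesgue) (simp only: complex_of_real_integrable_eq)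

lemma integral_norm_bound_ennreal_any:
  fixes f :: "'a \<Rightarrow> 'b::{banach, second_countable_topology}"
  shows "ennreal (norm (\<integral>x. f x \<partial>M)) \<le> (\<integral>\<^sup>+x. ennreal (norm (f x)) \<partial>M)"
  by (cases "integrable M f") (auto simp: integral_norm_bound_ennreal not_integrable_integral_eq)

text \<open>
  Schur's test. By \<open>2 |f(x)| |f(y)| \<le> |f(x)|\<^sup>2 + |f(y)|\<^sup>2\<close> the double integral is controlled by the mass
  of the kernel in each variable, which is a Gaussian integral.
\<close>

lemma gaussian_kernel_bound:
  fixes f :: "'a::euclidean_space \<Rightarrow> complex"
  assumes c: "c > 0" and fm: "f \<in> borel_measurable borel" and f2: "integrable lborel (\<lambda>x. (cmod (f x))\<^sup>2)"
  shows "cmod (\<integral>x. f x * (\<integral>y. cnj (f y) * complex_of_real (gauss c (y - x)) \<partial>lborel) \<partial>lborel)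
    \<le> (pi / c) powr (DIM('a) / 2) * (\<integral>x. (cmod (f x))\<^sup>2 \<partial>lborel)"
proof -
  note [measurable] = fm
  define H where "H x y = gauss c (y - x)" for x y :: 'a
  have [measurable]: "(\<lambda>(x, y). H x y) \<in> borel_measurable (borel \<Otimes>\<^sub>M borel)" unfolding H_def by measurable
  have H0: "0 \<le> H x y" for x y by (simp add: H_def)
  let ?A = "(pi / c) powr (DIM('a) / 2)"
  let ?I = "\<integral>x. (cmod (f x))\<^sup>2 \<partial>lborel"
  have H: "(\<integral>\<^sup>+y. ennreal (H x y) \<partial>lborel) = ennreal ?A" for x
    using nn_integral_eq_integral[OF gaussian_translate_integral(1)[OF c, of x]] gaussian_translate_integral(2)[OF c, of x]
    by (simp add: H_def)
  have H': "(\<integral>\<^sup>+x. ennreal (H x y) \<partial>lborel) = ennreal ?A" for y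
    using H[of y] by (simp add: H_def norm_minus_commute)
  define w where "w x = ennreal (1/2 * (cmod (f x))\<^sup>2)" for x
  have [measurable]: "w \<in> borel_measurable borel" unfolding w_def by measurable
  have I: "(\<integral>\<^sup>+x. w x \<partial>lborel) = ennreal (1/2 * ?I)"
    unfolding w_def using f2 by (subst nn_integral_eq_integral) auto
  have "ennreal (cmod (\<integral>x. f x * (\<integral>y. cnj (f y) * complex_of_real (H x y) \<partial>lborel) \<partial>lborel))
    \<le> (\<integral>\<^sup>+x. ennreal (cmod (f x * (\<integral>y. cnj (f y) * complex_of_real (H x y) \<partial>lborel))) \<partial>lborel)"
    by (rule integral_norm_bound_ennreal_any)
  also have "\<dots> \<le> (\<integral>\<^sup>+x. (\<integral>\<^sup>+y. ennreal (cmod (f x) * cmod (f y) * H x y) \<partial>lborel) \<partial>lborel)"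
  proof (rule nn_integral_mono)
    fix x
    have "ennreal (cmod (f x * (\<integral>y. cnj (f y) * complex_of_real (H x y) \<partial>lborel)))
      = ennreal (cmod (\<integral>y. f x * (cnj (f y) * complex_of_real (H x y)) \<partial>lborel))"
      by simp
    also have "\<dots> \<le> (\<integral>\<^sup>+y. ennreal (cmod (f x * (cnj (f y) * complex_of_real (H x y)))) \<partial>lborel)"
      by (rule integral_norm_bound_ennreal_any)
    finally show "ennreal (cmod (f x * (\<integral>y. cnj (f y) * complex_of_real (H x y) \<partial>lborel)))
      \<le> (\<integral>\<^sup>+y. ennreal (cmod (f x) * cmod (f y) * H x y) \<partial>lborel)"
      by (simp add: norm_mult H0 mult.assoc)
  qed
  also have "\<dots> \<le> (\<integral>\<^sup>+x. (\<integral>\<^sup>+y. w x * ennreal (H x y) + w y * ennreal (H x y) \<partial>lborel) \<partial>lborel)"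
  proof (intro nn_integral_mono)
    fix x y
    have "cmod (f x) * cmod (f y) \<le> 1/2 * (cmod (f x))\<^sup>2 + 1/2 * (cmod (f y))\<^sup>2"
      using sum_squares_bound[of "cmod (f x)" "cmod (f y)"] by simp
    then have "cmod (f x) * cmod (f y) * H x y \<le> 1/2 * (cmod (f x))\<^sup>2 * H x y + 1/2 * (cmod (f y))\<^sup>2 * H x y"
      using mult_right_mono[OF _ H0] by (metis distrib_right)
    then have "ennreal (cmod (f x) * cmod (f y) * H x y) \<le> ennreal (1/2 * (cmod (f x))\<^sup>2 * H x y + 1/2 * (cmod (f y))\<^sup>2 * H x y)"
      by (rule ennreal_leI)
    also have "\<dots> = ennreal (1/2 * (cmod (f x))\<^sup>2 * H x y) + ennreal (1/2 * (cmod (f y))\<^sup>2 * H x y)"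
      by (intro ennreal_plus mult_nonneg_nonneg H0) auto
    also have "\<dots> = w x * ennreal (H x y) + w y * ennreal (H x y)"
      unfolding w_def by (subst (1 2) ennreal_mult) (auto simp: H0)
    finally show "ennreal (cmod (f x) * cmod (f y) * H x y) \<le> w x * ennreal (H x y) + w y * ennreal (H x y)" .
  qed
  also have "\<dots> = (\<integral>\<^sup>+x. (\<integral>\<^sup>+y. w x * ennreal (H x y) \<partial>lborel) \<partial>lborel)
                 + (\<integral>\<^sup>+x. (\<integral>\<^sup>+y. w y * ennreal (H x y) \<partial>lborel) \<partial>lborel)"
    by (subst nn_integral_add[symmetric]) (auto simp: nn_integral_add)
  also have "(\<integral>\<^sup>+x. (\<integral>\<^sup>+y. w y * ennreal (H x y) \<partial>lborel) \<partial>lborel)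
     = (\<integral>\<^sup>+y. (\<integral>\<^sup>+x. w y * ennreal (H x y) \<partial>lborel) \<partial>lborel)"
    by (rule lborel_pair.Fubini') measurable
  also have "(\<integral>\<^sup>+y. (\<integral>\<^sup>+x. w y * ennreal (H x y) \<partial>lborel) \<partial>lborel) = (\<integral>\<^sup>+y. w y * ennreal ?A \<partial>lborel)"
    using H' by (intro nn_integral_cong) (subst nn_integral_cmult, auto)
  also have "(\<integral>\<^sup>+x. (\<integral>\<^sup>+y. w x * ennreal (H x y) \<partial>lborel) \<partial>lborel) = (\<integral>\<^sup>+x. w x * ennreal ?A \<partial>lborel)"
    using H by (intro nn_integral_cong) (subst nn_integral_cmult, auto)
  also have "(\<integral>\<^sup>+x. w x * ennreal ?A \<partial>lborel) + (\<integral>\<^sup>+x. w x * ennreal ?A \<partial>lborel) = ennreal (1/2 * ?I * ?A) + ennreal (1/2 * ?I * ?A)"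
    by (subst (1 2) nn_integral_multc, simp_all only: I) (simp_all add: ennreal_mult[symmetric])
  also have "\<dots> = ennreal (1/2 * ?I * ?A + 1/2 * ?I * ?A)"
    by (intro ennreal_plus[symmetric] mult_nonneg_nonneg) auto
  also have "1/2 * ?I * ?A + 1/2 * ?I * ?A = ?A * ?I" by simp
  finally show ?thesis unfolding H_def by (subst (asm) ennreal_le_iff) auto
qed

section \<open>The Fourier transform on \<open>L\<^sup>2\<close>\<close>

lemma borel_measurable_cnj [measurable]: "f \<in> borel_measurable M \<Longrightarrow> (\<lambda>x. cnj (f x)) \<in> borel_measurable M"
  by (rule borel_measurable_continuous_on[where f = cnj]) (intro continuous_intros)

text \<open>
  The Gaussian weight makes \<open>|FT f|\<^sup>2\<close> integrable, so the multiplication formula applies. Used for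
  \<open>f\<close>, and a second time for the conjugate of \<open>f\<close>, it rewrites the weighted norm as a quadratic form in
  \<open>f\<close> whose kernel is a Gaussian of total mass one, and Schur's test gives the bound.
\<close>

lemma FT_smoothed_norm_le:
  fixes f :: "real^'n \<Rightarrow> complex"
  assumes fm: "f \<in> borel_measurable borel" and f1: "integrable lborel f"
    and f2: "integrable lborel (\<lambda>x. (cmod (f x))\<^sup>2)"
    and e: "\<epsilon> = 1 \<or> \<epsilon> = -1" and d: "\<delta> > 0"
  shows "(\<integral>\<xi>. (cmod (FT \<epsilon> f \<xi>))\<^sup>2 * gauss \<delta> \<xi> \<partial>lborel) \<le> (\<integral>x. (cmod (f x))\<^sup>2 \<partial>lborel)"
    and "integrable lborel (\<lambda>\<xi>. (cmod (FT \<epsilon> f \<xi>))\<^sup>2 * gauss \<delta> \<xi>)"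
proof -
  note [measurable] = fm
  define g where "g = FT \<epsilon> f"
  define \<gamma> where "\<gamma> \<xi> = complex_of_real (gauss \<delta> \<xi>)" for \<xi> :: "real^'n"
  define A where "A = (2 * pi) powr (- real CARD('n) / 2) * (\<integral> x. cmod (f x) \<partial>lebesgue)"
  have f1': "integrable lebesgue f" using f1 by (rule integrable_lborel_imp_lebesgue)
  have cf1: "integrable lebesgue (\<lambda>x. cnj (f x))" using f1' by simp
  have gm [measurable]: "g \<in> borel_measurable borel" unfolding g_def by (rule FT_borel_measurable[OF f1'])
  have gm': "g \<in> borel_measurable lebesgue" by (rule borel_measurable_imp_lebesgue[OF gm])
  have gA: "cmod (g \<xi>) \<le> A" for \<xi> unfolding g_def A_def by (rule FT_bounded)
  have \<gamma>i: "integrable lebesgue \<gamma>" unfolding \<gamma>_def using d by (rule integrable_gaussian_lebesgue)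
  have \<gamma>m [measurable]: "\<gamma> \<in> borel_measurable borel" unfolding \<gamma>_def by measurable
  have \<gamma>m': "\<gamma> \<in> borel_measurable lebesgue" by (rule borel_measurable_imp_lebesgue[OF \<gamma>m])
  have ki: "integrable lebesgue (\<lambda>\<xi>. cnj (g \<xi>) * \<gamma> \<xi>)"
  proof (rule Bochner_Integration.integrable_bound)
    show "integrable lebesgue (\<lambda>\<xi>. A * \<gamma> \<xi>)" using \<gamma>i by simp
    show "(\<lambda>\<xi>. cnj (g \<xi>) * \<gamma> \<xi>) \<in> borel_measurable lebesgue"
      by (rule borel_measurable_imp_lebesgue) measurable
    have "cmod (g \<xi>) \<le> \<bar>A\<bar>" for \<xi> using gA[of \<xi>] by linarith
    then show "AE \<xi> in lebesgue. norm (cnj (g \<xi>) * \<gamma> \<xi>) \<le> norm (A * \<gamma> \<xi>)"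
      by (intro AE_I2) (simp add: norm_mult mult_right_mono)
  qed
  have inner: "FT \<epsilon> (\<lambda>\<xi>. cnj (g \<xi>) * \<gamma> \<xi>) x =
     complex_of_real ((2 * pi) powr (- real CARD('n) / 2) * (2 * \<delta>) powr (- real CARD('n) / 2)) *
     (\<integral>y. cnj (f y) * complex_of_real (gauss (1 / (4 * \<delta>)) (y - x)) \<partial>lborel)" for x
  proof -
    have "- \<epsilon> = 1 \<or> - \<epsilon> = -1" using e by auto
    from FT_gaussian_modulated[OF d this, of x]
    have mod: "FT (- \<epsilon>) (\<lambda>\<xi>. cis (\<epsilon> * (\<xi> \<bullet> x)) * \<gamma> \<xi>) y
      = complex_of_real ((2 * \<delta>) powr (- real CARD('n) / 2) * exp (- (norm (y - x))\<^sup>2 / (4 * \<delta>)))" for y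
      unfolding \<gamma>_def by (simp only: minus_minus)
    have mi: "integrable lebesgue (\<lambda>\<xi>. cis (\<epsilon> * (\<xi> \<bullet> x)) * \<gamma> \<xi>)"
      by (intro integrable_cis_mult \<gamma>i) measurable
    have "(\<integral>\<xi>. cis (\<epsilon> * (\<xi> \<bullet> x)) * (cnj (g \<xi>) * \<gamma> \<xi>) \<partial>lebesgue)
        = (\<integral>\<xi>. FT (-\<epsilon>) (\<lambda>y. cnj (f y)) \<xi> * (cis (\<epsilon> * (\<xi> \<bullet> x)) * \<gamma> \<xi>) \<partial>lebesgue)"
      by (simp add: g_def FT_cnj mult_ac)
    also have "\<dots> = (\<integral>y. cnj (f y) * FT (-\<epsilon>) (\<lambda>\<xi>. cis (\<epsilon> * (\<xi> \<bullet> x)) * \<gamma> \<xi>) y \<partial>lebesgue)"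
      by (rule FT_multiplication[OF cf1 mi])
    also have "\<dots> = (\<integral>y. cnj (f y) * complex_of_real ((2 * \<delta>) powr (- real CARD('n) / 2) * exp (- (norm (y - x))\<^sup>2 / (4 * \<delta>))) \<partial>lebesgue)"
      by (simp only: mod)
    also have "\<dots> = (\<integral>y. cnj (f y) * complex_of_real ((2 * \<delta>) powr (- real CARD('n) / 2) * exp (- (norm (y - x))\<^sup>2 / (4 * \<delta>))) \<partial>lborel)"
      by (intro integral_lebesgue_eq_lborel borel_measurable_times borel_measurable_cnj fm borel_measurable_continuous_onI continuous_intros) (use d in auto)
    also have "\<dots> = (\<integral>y. complex_of_real ((2 * \<delta>) powr (- real CARD('n) / 2)) * (cnj (f y) * complex_of_real (gauss (1 / (4 * \<delta>)) (y - x))) \<partial>lborel)"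
      by (intro Bochner_Integration.integral_cong refl) simp
    finally show ?thesis unfolding FT_def by (simp add: mult.assoc)
  qed
  have eq: "complex_of_real ((cmod (g \<xi>))\<^sup>2 * gauss \<delta> \<xi>) = g \<xi> * (cnj (g \<xi>) * \<gamma> \<xi>)" for \<xi>
    by (simp only: mult.assoc[symmetric] complex_norm_square[symmetric] \<gamma>_def of_real_mult of_real_power)
  have "integrable lebesgue (\<lambda>\<xi>. g \<xi> * (cnj (g \<xi>) * \<gamma> \<xi>))"
  proof (rule Bochner_Integration.integrable_bound)
    show "integrable lebesgue (\<lambda>\<xi>. A * (cnj (g \<xi>) * \<gamma> \<xi>))" using ki by simp
    show "(\<lambda>\<xi>. g \<xi> * (cnj (g \<xi>) * \<gamma> \<xi>)) \<in> borel_measurable lebesgue"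
      by (rule borel_measurable_imp_lebesgue) measurable
    have "cmod (g \<xi>) \<le> \<bar>A\<bar>" for \<xi> using gA[of \<xi>] by linarith
    then show "AE \<xi> in lebesgue. norm (g \<xi> * (cnj (g \<xi>) * \<gamma> \<xi>)) \<le> norm (A * (cnj (g \<xi>) * \<gamma> \<xi>))"
      by (intro AE_I2) (simp add: norm_mult mult_right_mono)
  qed
  then have "integrable lborel (\<lambda>\<xi>. g \<xi> * (cnj (g \<xi>) * \<gamma> \<xi>))"
    by (subst (asm) integrable_completion) simp_all
  then have "integrable lborel (\<lambda>\<xi>. (cmod (g \<xi>))\<^sup>2 * gauss \<delta> \<xi>)"
    unfolding eq[symmetric] complex_of_real_integrable_eq .
  then show "integrable lborel (\<lambda>\<xi>. (cmod (FT \<epsilon> f \<xi>))\<^sup>2 * gauss \<delta> \<xi>)"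
    unfolding g_def .
  have "complex_of_real (\<integral>\<xi>. (cmod (g \<xi>))\<^sup>2 * gauss \<delta> \<xi> \<partial>lborel)
     = (\<integral>\<xi>. g \<xi> * (cnj (g \<xi>) * \<gamma> \<xi>) \<partial>lborel)"
    unfolding eq[symmetric] by (rule integral_complex_of_real[symmetric])
  also have "\<dots> = (\<integral>\<xi>. g \<xi> * (cnj (g \<xi>) * \<gamma> \<xi>) \<partial>lebesgue)"
    by (intro integral_lebesgue_eq_lborel[symmetric]) measurable
  also have "\<dots> = (\<integral>x. f x * FT \<epsilon> (\<lambda>\<xi>. cnj (g \<xi>) * \<gamma> \<xi>) x \<partial>lebesgue)"
    using FT_multiplication[OF f1' ki] by (simp add: g_def)
  also have "\<dots> = (\<integral>x. f x * FT \<epsilon> (\<lambda>\<xi>. cnj (g \<xi>) * \<gamma> \<xi>) x \<partial>lborel)"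
    using fm FT_borel_measurable[OF ki] by (intro integral_lebesgue_eq_lborel) measurable
  also have "\<dots> = (\<integral>x. complex_of_real ((2 * pi) powr (- real CARD('n) / 2) * (2 * \<delta>) powr (- real CARD('n) / 2)) *
     (f x * (\<integral>y. cnj (f y) * complex_of_real (gauss (1 / (4 * \<delta>)) (y - x)) \<partial>lborel)) \<partial>lborel)"
    unfolding inner by (intro Bochner_Integration.integral_cong refl) (simp only: mult.left_commute)
  also have "\<dots> = complex_of_real ((2 * pi) powr (- real CARD('n) / 2) * (2 * \<delta>) powr (- real CARD('n) / 2)) *
     (\<integral>x. f x * (\<integral>y. cnj (f y) * complex_of_real (gauss (1 / (4 * \<delta>)) (y - x)) \<partial>lborel) \<partial>lborel)"
    by (rule integral_mult_right_zero)
  finally have *: "complex_of_real (\<integral>\<xi>. (cmod (g \<xi>))\<^sup>2 * gauss \<delta> \<xi> \<partial>lborel) = \<dots>" .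
  have "(\<integral>\<xi>. (cmod (g \<xi>))\<^sup>2 * gauss \<delta> \<xi> \<partial>lborel)
      \<le> cmod (complex_of_real (\<integral>\<xi>. (cmod (g \<xi>))\<^sup>2 * gauss \<delta> \<xi> \<partial>lborel))"
    by (simp only: norm_of_real abs_ge_self)
  also have "\<dots> = (2 * pi) powr (- real CARD('n) / 2) * (2 * \<delta>) powr (- real CARD('n) / 2) *
     cmod (\<integral>x. f x * (\<integral>y. cnj (f y) * complex_of_real (gauss (1 / (4 * \<delta>)) (y - x)) \<partial>lborel) \<partial>lborel)"
    unfolding * by (simp only: norm_mult norm_of_real) simp
  also have "\<dots> \<le> (2 * pi) powr (- real CARD('n) / 2) * (2 * \<delta>) powr (- real CARD('n) / 2) *
     ((pi / (1 / (4 * \<delta>))) powr (real CARD('n) / 2) * (\<integral>x. (cmod (f x))\<^sup>2 \<partial>lborel))"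
    using gaussian_kernel_bound[OF _ fm f2, of "1 / (4 * \<delta>)"] d by (intro mult_left_mono) auto
  also have "\<dots> = (\<integral>x. (cmod (f x))\<^sup>2 \<partial>lborel)"
  proof -
    have "(2 * pi) powr (- real CARD('n) / 2) * (2 * \<delta>) powr (- real CARD('n) / 2) * (pi / (1 / (4 * \<delta>))) powr (real CARD('n) / 2)
      = (4 * pi * \<delta>) powr (- real CARD('n) / 2) * (4 * pi * \<delta>) powr (real CARD('n) / 2)"
      using d by (simp add: powr_mult[symmetric] mult_ac)
    also have "\<dots> = 1" using d by (simp add: powr_add[symmetric])
    finally show ?thesis by (simp add: mult.assoc[symmetric])
  qed
  finally show "(\<integral>\<xi>. (cmod (FT \<epsilon> f \<xi>))\<^sup>2 * gauss \<delta> \<xi> \<partial>lborel) \<le> (\<integral>x. (cmod (f x))\<^sup>2 \<partial>lborel)"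
    by (simp add: g_def)
qed

text \<open>
  Half of Plancherel's theorem: Fatou's lemma removes the Gaussian weight of the smoothed bound.
\<close>

lemma FT_contraction:
  fixes f :: "real^'n \<Rightarrow> complex"
  assumes f: "f \<in> L2" and f1: "integrable lebesgue f" and e: "\<epsilon> = 1 \<or> \<epsilon> = -1"
  shows "FT \<epsilon> f \<in> L2" "l2 (FT \<epsilon> f) \<le> l2 f"
proof -
  obtain f' where f': "f' \<in> borel_measurable borel" "AE x in lebesgue. f x = f' x" "integrable lborel f'"
    using integrable_borel_representative[OF f1] .
  have f'm: "f' \<in> borel_measurable lebesgue" by (rule borel_measurable_imp_lebesgue[OF f'(1)])
  have fm: "f \<in> borel_measurable lebesgue" by (rule L2_measurable[OF f])
  have f'L2: "f' \<in> L2" by (rule L2_cong_AE[OF f'(2) f])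
  have sq: "(\<lambda>x. (cmod (f' x))\<^sup>2) \<in> borel_measurable borel" using f'(1) by measurable
  have "integrable lebesgue (\<lambda>x. (cmod (f' x))\<^sup>2)" using f'L2 by (simp add: L2_iff)
  then have f'2: "integrable lborel (\<lambda>x. (cmod (f' x))\<^sup>2)"
    using sq by (subst (asm) integrable_completion) simp_all
  have l2f: "l2 f = sqrt (\<integral>x. (cmod (f' x))\<^sup>2 \<partial>lborel)"
    using l2_cong_AE[OF f'(2) fm f'm] integral_lebesgue_eq_lborel[OF sq] by (simp add: l2_def)
  define g where "g = FT \<epsilon> f'"
  have Fg: "FT \<epsilon> f = g" unfolding g_def by (rule FT_cong_AE[OF f'(2) fm f'm])
  have gm [measurable]: "g \<in> borel_measurable borel"
    unfolding g_def by (rule FT_borel_measurable[OF integrable_lborel_imp_lebesgue[OF f'(3)]])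
  define h where "h k \<xi> = g \<xi> * complex_of_real (gauss (1 / real (Suc k)) \<xi>)" for k and \<xi> :: "real^'n"
  have hm [measurable]: "h k \<in> borel_measurable borel" for k unfolding h_def by measurable
  have hsq: "(cmod (h k \<xi>))\<^sup>2 = (cmod (g \<xi>))\<^sup>2 * gauss (2 / real (Suc k)) \<xi>" for k \<xi>
    by (simp add: h_def norm_mult power_mult_distrib exp_double[symmetric] del: of_nat_Suc)
  have hi: "integrable lborel (\<lambda>\<xi>. (cmod (h k \<xi>))\<^sup>2)" for k
    unfolding hsq g_def using FT_smoothed_norm_le(2)[OF f'(1,3) f'2 e, of "2 / real (Suc k)"] by simp
  have hL2: "h k \<in> L2" for k
    using integrable_lborel_imp_lebesgue[OF hi[of k]] borel_measurable_imp_lebesgue[OF hm[of k]] by (simp add: L2_iff)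
  have hle: "l2 (h k) \<le> l2 f" for k
  proof -
    have "(\<integral>\<xi>. (cmod (h k \<xi>))\<^sup>2 \<partial>lebesgue) = (\<integral>\<xi>. (cmod (h k \<xi>))\<^sup>2 \<partial>lborel)"
      by (intro integral_lebesgue_eq_lborel) measurable
    also have "\<dots> \<le> (\<integral>x. (cmod (f' x))\<^sup>2 \<partial>lborel)"
      unfolding hsq g_def using FT_smoothed_norm_le(1)[OF f'(1,3) f'2 e, of "2 / real (Suc k)"] by simp
    finally show ?thesis unfolding l2f by (simp add: l2_def)
  qed
  have lim: "(\<lambda>k. h k \<xi>) \<longlonglongrightarrow> g \<xi>" for \<xi>
  proof -
    have "(\<lambda>k. 1 / real (Suc k)) \<longlonglongrightarrow> 0"
      using LIMSEQ_inverse_real_of_nat by (simp add: inverse_eq_divide)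
    then have "(\<lambda>k. g \<xi> * complex_of_real (gauss (1 / real (Suc k)) \<xi>)) \<longlonglongrightarrow> g \<xi> * complex_of_real (exp (- 0 * (norm \<xi>)\<^sup>2))"
      by (intro tendsto_intros)
    then show ?thesis by (simp add: h_def)
  qed
  show "FT \<epsilon> f \<in> L2" "l2 (FT \<epsilon> f) \<le> l2 f"
    using l2_Fatou[where f = h and g = g and K = 0 and B = "l2 f"] hL2 hle lim borel_measurable_imp_lebesgue[OF gm]
    unfolding Fg by auto
qed

definition trunc :: "real \<Rightarrow> (real^'n \<Rightarrow> complex) \<Rightarrow> real^'n \<Rightarrow> complex" where
  "trunc R f x = indicator (cball 0 R) x * f x"

lemma truncated_fourier_eq_FT: "truncated_fourier \<epsilon> R f = FT \<epsilon> (trunc R f)"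
proof
  fix \<xi>
  have "(\<integral> x. cis (\<epsilon> * (x \<bullet> \<xi>)) * f x \<partial>(lebesgue_on (cball 0 R)))
     = (\<integral> x. indicator (cball 0 R) x *\<^sub>R (cis (\<epsilon> * (x \<bullet> \<xi>)) * f x) \<partial>lebesgue)"
    by (rule integral_restrict_space) simp
  also have "\<dots> = (\<integral> x. cis (\<epsilon> * (x \<bullet> \<xi>)) * trunc R f x \<partial>lebesgue)"
    by (intro Bochner_Integration.integral_cong refl) (simp add: trunc_def indicator_def)
  finally show "truncated_fourier \<epsilon> R f \<xi> = FT \<epsilon> (trunc R f) \<xi>"
    by (simp add: truncated_fourier_def FT_def)
qed

lemma trunc_L2:
  assumes "f \<in> L2" shows "trunc R f \<in> L2"
proof -
  have "trunc R f \<in> borel_measurable lebesgue"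
    unfolding trunc_def by (intro borel_measurable_times borel_measurable_indicator L2_measurable[OF assms]) simp
  then show ?thesis
    by (rule L2_dominated[OF assms, of _ 1]) (auto simp: trunc_def indicator_def)
qed

lemma indicator_L2:
  fixes S :: "'a::euclidean_space set"
  assumes "S \<in> lmeasurable"
  shows "(\<lambda>x. indicator S x :: complex) \<in> L2"
  unfolding L2_iff
proof
  show "(\<lambda>x. indicator S x :: complex) \<in> borel_measurable lebesgue"
    using assms by (intro borel_measurable_indicator) (auto simp: fmeasurable_def)
  have "integrable lebesgue (indicat_real S)"
    using assms by (intro integrable_real_indicator) (auto simp: fmeasurable_def)
  moreover have "(\<lambda>x. (cmod (indicator S x))\<^sup>2) = indicat_real S"
    by (auto simp: indicator_def)
  ultimately show "integrable lebesgue (\<lambda>x. (cmod (indicator S x))\<^sup>2)" by (simp only:)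
qed

lemma trunc_integrable:
  fixes f :: "real^'n \<Rightarrow> complex"
  assumes "f \<in> L2" shows "integrable lebesgue (trunc R f)"
  using L2_product_integrable[OF indicator_L2[OF lmeasurable_cball[of 0 R]] assms]
  unfolding trunc_def[abs_def] .

lemma trunc_tendsto:
  fixes f :: "real^'n \<Rightarrow> complex"
  assumes f: "f \<in> L2"
  shows "((\<lambda>R. l2 (\<lambda>x. trunc R f x - f x)) \<longlongrightarrow> 0) at_top"
proof -
  have fm [measurable]: "f \<in> borel_measurable lebesgue" by (rule L2_measurable[OF f])
  have "((\<lambda>R. \<integral>x. (cmod (trunc R f x - f x))\<^sup>2 \<partial>lebesgue) \<longlongrightarrow> (\<integral>x. 0 \<partial>(lebesgue::(real^'n) measure))) at_top"
  proof (rule integral_dominated_convergence_at_top)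
    show "integrable lebesgue (\<lambda>x. (cmod (f x))\<^sup>2)" using f by (simp add: L2_iff)
    show "(\<lambda>x. (cmod (trunc R f x - f x))\<^sup>2) \<in> borel_measurable lebesgue" for R
      using L2_measurable[OF trunc_L2[OF f, of R]] by measurable
    show "\<forall>\<^sub>F R in at_top. AE x in lebesgue. norm ((cmod (trunc R f x - f x))\<^sup>2) \<le> (cmod (f x))\<^sup>2"
      by (intro always_eventually allI AE_I2) (auto simp: trunc_def indicator_def)
    have "((\<lambda>R. (cmod (trunc R f x - f x))\<^sup>2) \<longlongrightarrow> 0) at_top" for x
    proof (rule tendsto_eventually)
      show "\<forall>\<^sub>F R in at_top. (cmod (trunc R f x - f x))\<^sup>2 = 0"
        using eventually_ge_at_top[of "norm x"] by eventually_elim (simp add: trunc_def)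
    qed
    then show "AE x in lebesgue. ((\<lambda>R. (cmod (trunc R f x - f x))\<^sup>2) \<longlongrightarrow> 0) at_top" by simp
  qed auto
  then have "((\<lambda>R. sqrt (\<integral>x. (cmod (trunc R f x - f x))\<^sup>2 \<partial>lebesgue)) \<longlongrightarrow> sqrt 0) at_top"
    by (intro tendsto_real_sqrt) simp
  then show ?thesis by (simp add: l2_def)
qed

lemma truncated_fourier_diff_le:
  assumes f: "f \<in> L2" and e: "\<epsilon> = 1 \<or> \<epsilon> = -1"
  shows "l2 (\<lambda>\<xi>. truncated_fourier \<epsilon> R f \<xi> - truncated_fourier \<epsilon> S f \<xi>)
     \<le> l2 (\<lambda>x. trunc R f x - f x) + l2 (\<lambda>x. trunc S f x - f x)"
proof -
  have "l2 (\<lambda>\<xi>. truncated_fourier \<epsilon> R f \<xi> - truncated_fourier \<epsilon> S f \<xi>) = l2 (FT \<epsilon> (\<lambda>x. trunc R f x - trunc S f x))"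
    unfolding truncated_fourier_eq_FT
    by (rule arg_cong[where f = l2], rule ext) (simp add: FT_add_diff trunc_integrable f)
  also have "\<dots> \<le> l2 (\<lambda>x. trunc R f x - trunc S f x)"
    by (intro FT_contraction L2_diff trunc_L2 f e Bochner_Integration.integrable_diff trunc_integrable)
  also have "\<dots> \<le> l2 (\<lambda>x. trunc R f x - f x) + l2 (\<lambda>x. f x - trunc S f x)"
    by (intro l2_triangle_diff trunc_L2 f)
  also have "l2 (\<lambda>x. f x - trunc S f x) = l2 (\<lambda>x. trunc S f x - f x)" by (rule l2_minus_commute)
  finally show ?thesis .
qed

lemma truncated_fourier_L2:
  assumes "f \<in> L2" "\<epsilon> = 1 \<or> \<epsilon> = -1"
  shows "truncated_fourier \<epsilon> R f \<in> L2"
  unfolding truncated_fourier_eq_FT by (intro FT_contraction trunc_L2 trunc_integrable assms)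

text \<open>
  The contraction property makes the transforms of the truncations a Cauchy family in \<open>L\<^sup>2\<close>, so the
  limit chosen in the definition exists by completeness.
\<close>

lemma fourier_limit:
  fixes f :: "real^'n \<Rightarrow> complex"
  assumes f: "f \<in> L2" and e: "\<epsilon> = 1 \<or> \<epsilon> = -1"
  shows fourier_limit_L2: "fourier_limit \<epsilon> f \<in> L2"
    and fourier_limit_tendsto: "((\<lambda>R. l2 (\<lambda>\<xi>. truncated_fourier \<epsilon> R f \<xi> - fourier_limit \<epsilon> f \<xi>)) \<longlongrightarrow> 0) at_top"
proof -
  let ?T = "\<lambda>R. truncated_fourier \<epsilon> R f"
  have TL2: "?T R \<in> L2" for R by (rule truncated_fourier_L2[OF f e])
  let ?b = "\<lambda>R. l2 (\<lambda>x. trunc R f x - f x)"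
  note diff = truncated_fourier_diff_le[OF f e]
  have small: "\<exists>M. \<forall>R\<ge>M. ?b R < d" if "d > 0" for d
    using order_tendstoD(2)[OF trunc_tendsto[OF f] that] by (auto simp: eventually_at_top_linorder)
  have "\<exists>h\<in>L2. (\<lambda>k. l2 (\<lambda>\<xi>. ?T (real k) \<xi> - h \<xi>)) \<longlonglongrightarrow> 0"
  proof (rule L2_complete[OF TL2])
    fix d :: real assume "d > 0"
    then obtain M where M: "\<forall>R\<ge>M. ?b R < d/2" using small[of "d/2"] by auto
    have "l2 (\<lambda>\<xi>. ?T (real m) \<xi> - ?T (real n) \<xi>) < d" if "m \<ge> nat \<lceil>M\<rceil>" "n \<ge> nat \<lceil>M\<rceil>" for m n
    proof -
      have "real m \<ge> M" "real n \<ge> M" using that by linarith+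
      then have "?b (real m) < d/2" "?b (real n) < d/2" using M by auto
      then show ?thesis using diff[of "real m" "real n"] by linarith
    qed
    then show "\<exists>N. \<forall>m\<ge>N. \<forall>n\<ge>N. l2 (\<lambda>\<xi>. ?T (real m) \<xi> - ?T (real n) \<xi>) < d" by blast
  qed
  then obtain h where h: "h \<in> L2" "(\<lambda>k. l2 (\<lambda>\<xi>. ?T (real k) \<xi> - h \<xi>)) \<longlonglongrightarrow> 0" by blast
  have "((\<lambda>R. l2 (\<lambda>\<xi>. ?T R \<xi> - h \<xi>)) \<longlongrightarrow> 0) at_top"
  proof (rule order_tendstoI)
    fix d :: real assume "d < 0"
    then show "\<forall>\<^sub>F R in at_top. d < l2 (\<lambda>\<xi>. ?T R \<xi> - h \<xi>)"
      by (intro always_eventually allI) (rule less_le_trans[OF _ l2_nonneg])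
  next
    fix d :: real assume d: "0 < d"
    then obtain M where M: "\<forall>R\<ge>M. ?b R < d/3" using small[of "d/3"] by auto
    have "\<forall>\<^sub>F k in sequentially. l2 (\<lambda>\<xi>. ?T (real k) \<xi> - h \<xi>) < d/3"
      using order_tendstoD(2)[OF h(2), of "d/3"] d by simp
    then obtain N where N: "\<And>k. k \<ge> N \<Longrightarrow> l2 (\<lambda>\<xi>. ?T (real k) \<xi> - h \<xi>) < d/3"
      by (auto simp: eventually_sequentially)
    define k where "k = max N (nat \<lceil>M\<rceil>)"
    have k: "k \<ge> N" "real k \<ge> M" unfolding k_def by linarith+
    show "\<forall>\<^sub>F R in at_top. l2 (\<lambda>\<xi>. ?T R \<xi> - h \<xi>) < d"
      using eventually_ge_at_top[of M]
    proof eventually_elim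
      case (elim R)
      have "l2 (\<lambda>\<xi>. ?T R \<xi> - h \<xi>) \<le> l2 (\<lambda>\<xi>. ?T R \<xi> - ?T (real k) \<xi>) + l2 (\<lambda>\<xi>. ?T (real k) \<xi> - h \<xi>)"
        by (intro l2_triangle_diff TL2 h)
      moreover have "?b R < d/3" "?b (real k) < d/3" using M elim k by auto
      ultimately show ?case using diff[of R "real k"] N[OF k(1)] by linarith
    qed
  qed
  then have "((\<lambda>R. L2_norm (\<lambda>\<xi>. ?T R \<xi> - h \<xi>)) \<longlongrightarrow> 0) at_top"
    by (subst L2_norm_tendsto_0_iff) (auto intro!: always_eventually L2_diff TL2 h)
  with h(1) have ex: "\<exists>h. h \<in> L2 \<and> ((\<lambda>R. L2_norm (\<lambda>\<xi>. ?T R \<xi> - h \<xi>)) \<longlongrightarrow> 0) at_top" by blast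
  have spec: "fourier_limit \<epsilon> f \<in> L2 \<and> ((\<lambda>R. L2_norm (\<lambda>\<xi>. ?T R \<xi> - fourier_limit \<epsilon> f \<xi>)) \<longlongrightarrow> 0) at_top"
    unfolding fourier_limit_def by (rule someI_ex[OF ex])
  then show 1: "fourier_limit \<epsilon> f \<in> L2" by blast
  show "((\<lambda>R. l2 (\<lambda>\<xi>. ?T R \<xi> - fourier_limit \<epsilon> f \<xi>)) \<longlongrightarrow> 0) at_top"
    using spec by (subst L2_norm_tendsto_0_iff[symmetric]) (auto intro!: always_eventually L2_diff TL2 1)
qed

lemma fourier_limit_contraction:
  assumes f: "f \<in> L2" and e: "\<epsilon> = 1 \<or> \<epsilon> = -1"
  shows "l2 (fourier_limit \<epsilon> f) \<le> l2 f"
proof -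
  let ?T = "\<lambda>R. truncated_fourier \<epsilon> R f"
  let ?h = "fourier_limit \<epsilon> f"
  have TL2: "?T R \<in> L2" for R by (rule truncated_fourier_L2[OF f e])
  have "((\<lambda>R. l2 (\<lambda>\<xi>. ?T R \<xi> - ?h \<xi>) + (l2 (\<lambda>x. trunc R f x - f x) + l2 f)) \<longlongrightarrow> 0 + (0 + l2 f)) at_top"
    by (intro tendsto_intros fourier_limit_tendsto[OF f e] trunc_tendsto[OF f])
  moreover have "l2 ?h \<le> l2 (\<lambda>\<xi>. ?T R \<xi> - ?h \<xi>) + (l2 (\<lambda>x. trunc R f x - f x) + l2 f)" for R
  proof -
    have "l2 ?h \<le> l2 (\<lambda>\<xi>. ?h \<xi> - ?T R \<xi>) + l2 (?T R)"
      by (rule l2_le_diff_add[OF fourier_limit_L2[OF f e] TL2])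
    moreover have "l2 (?T R) \<le> l2 (trunc R f)"
      unfolding truncated_fourier_eq_FT by (intro FT_contraction trunc_L2 trunc_integrable f e)
    moreover have "l2 (trunc R f) \<le> l2 (\<lambda>x. trunc R f x - f x) + l2 f"
      by (intro l2_le_diff_add trunc_L2 f)
    ultimately show ?thesis using l2_minus_commute[of ?h "?T R"] by linarith
  qed
  ultimately show ?thesis
    by (intro tendsto_lowerbound[where F = at_top]) (auto intro!: always_eventually)
qed

text \<open>
  Both sides are continuous in \<open>f\<close> with respect to the \<open>L\<^sup>2\<close> norm, so the multiplication formula passes
  from the truncations to \<open>f\<close>.
\<close>

lemma fourier_limit_pairing:
  fixes f k :: "real^'n \<Rightarrow> complex"
  assumes f: "f \<in> L2" and e: "\<epsilon> = 1 \<or> \<epsilon> = -1" and k: "k \<in> L2" and k1: "integrable lebesgue k"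
  shows "(\<integral>\<xi>. fourier_limit \<epsilon> f \<xi> * k \<xi> \<partial>lebesgue) = (\<integral>x. f x * FT \<epsilon> k x \<partial>lebesgue)"
proof (rule tendsto_unique[where F = at_top])
  show "((\<lambda>R. \<integral>\<xi>. truncated_fourier \<epsilon> R f \<xi> * k \<xi> \<partial>lebesgue) \<longlongrightarrow> (\<integral>\<xi>. fourier_limit \<epsilon> f \<xi> * k \<xi> \<partial>lebesgue)) at_top"
    by (intro L2_pairing_tendsto always_eventually allI truncated_fourier_L2 fourier_limit_L2 fourier_limit_tendsto f e k)
  have "((\<lambda>R. \<integral>x. trunc R f x * FT \<epsilon> k x \<partial>lebesgue) \<longlongrightarrow> (\<integral>x. f x * FT \<epsilon> k x \<partial>lebesgue)) at_top"
    by (intro L2_pairing_tendsto always_eventually allI trunc_L2 trunc_tendsto f FT_contraction k k1 e)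
  then show "((\<lambda>R. \<integral>\<xi>. truncated_fourier \<epsilon> R f \<xi> * k \<xi> \<partial>lebesgue) \<longlongrightarrow> (\<integral>x. f x * FT \<epsilon> k x \<partial>lebesgue)) at_top"
    unfolding truncated_fourier_eq_FT by (simp add: FT_multiplication[OF trunc_integrable[OF f] k1])
qed simp

section \<open>Injectivity of the Fourier transform\<close>

lemma ex_borel_L2:
  assumes "f \<in> L2"
  obtains g where "g \<in> borel_measurable borel" "AE x in lebesgue. f x = g x" "g \<in> L2"
proof -
  obtain g where g: "g \<in> borel_measurable borel" "AE x in lborel. f x = g x"
    using lebesgue_borel_representative[OF L2_measurable[OF assms]] by auto
  have ae: "AE x in lebesgue. f x = g x" using g(2) by (rule AE_completion)
  show ?thesis by (rule that[OF g(1) ae L2_cong_AE[OF ae assms]])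
qed

lemma box_indicator_L2: "(\<lambda>x. indicator (box a b) x :: complex) \<in> L2"
  by (intro indicator_L2 lmeasurable_box)

lemma enn2real_inject:
  assumes "a \<noteq> \<infinity>" "b \<noteq> \<infinity>" "enn2real a = enn2real b"
  shows "a = b"
  using assms by (cases a; cases b) auto

text \<open>
  The positive and negative part of \<open>f\<close> define measures that agree on boxes, which form an
  intersection-stable generator. The measures therefore coincide, and so do their densities.
\<close>

lemma AE_zero_of_box_integrals_real:
  fixes f :: "'a::euclidean_space \<Rightarrow> real"
  assumes fm: "f \<in> borel_measurable borel"
    and i: "\<And>a b. integrable lborel (\<lambda>x. indicator (box a b) x * f x)"
    and z: "\<And>a b. (\<integral>x. indicator (box a b) x * f x \<partial>lborel) = 0"
  shows "AE x in lborel. f x = 0"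
proof -
  note [measurable] = fm
  let ?p = "\<lambda>x. ennreal (f x)" and ?n = "\<lambda>x. ennreal (- f x)"
  have em1: "emeasure (density lborel ?p) (box a b) = (\<integral>\<^sup>+x. ennreal (indicator (box a b) x * f x) \<partial>lborel)" for a b :: 'a
    by (subst emeasure_density, simp, simp) (rule nn_integral_cong, simp add: indicator_def)
  have em2: "emeasure (density lborel ?n) (box a b) = (\<integral>\<^sup>+x. ennreal (- (indicator (box a b) x * f x)) \<partial>lborel)" for a b :: 'a
    by (subst emeasure_density, simp, simp) (rule nn_integral_cong, simp add: indicator_def)
  have fin1: "(\<integral>\<^sup>+x. ennreal (indicator (box a b) x * f x) \<partial>lborel) \<noteq> \<infinity>" for a b :: 'a
    using i[of a b] unfolding real_integrable_def by blast
  have fin2: "(\<integral>\<^sup>+x. ennreal (- (indicator (box a b) x * f x)) \<partial>lborel) \<noteq> \<infinity>" for a b :: 'a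
    using i[of a b] unfolding real_integrable_def by blast
  have eq: "emeasure (density lborel ?p) (box a b) = emeasure (density lborel ?n) (box a b)" for a b
  proof -
    have "enn2real (\<integral>\<^sup>+x. ennreal (indicator (box a b) x * f x) \<partial>lborel)
       = enn2real (\<integral>\<^sup>+x. ennreal (- (indicator (box a b) x * f x)) \<partial>lborel)"
      using real_lebesgue_integral_def[OF i[of a b]] z[of a b] by linarith
    then show ?thesis unfolding em1 em2 by (rule enn2real_inject[OF fin1[of a b] fin2[of a b]])
  qed
  have "density lborel ?p = density lborel ?n"
  proof (rule measure_eqI_generator_eq)
    let ?E = "range (\<lambda>(a, b). box a b :: 'a set)"
    show "Int_stable ?E"
      by (auto simp: Int_stable_def box_Int_box)
    show "sets (density lborel ?p) = sigma_sets UNIV ?E" "sets (density lborel ?n) = sigma_sets UNIV ?E"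
      by (simp_all add: borel_eq_box)
    show "range (\<lambda>n::nat. box (- (real n *\<^sub>R One)) (real n *\<^sub>R One) :: 'a set) \<subseteq> ?E" by auto
    show "(\<Union>n::nat. box (- (real n *\<^sub>R One)) (real n *\<^sub>R One) :: 'a set) = UNIV"
      by (rule UN_box_eq_UNIV)
    show "emeasure (density lborel ?p) (box (- (real n *\<^sub>R One)) (real n *\<^sub>R One)) \<noteq> \<infinity>" for n :: nat
      unfolding em1 by (rule fin1)
  qed (use eq in auto)
  then have "AE x in lborel. ?p x = ?n x"
    by (intro sigma_finite_measure.density_unique[OF sigma_finite_lborel]) auto
  then show ?thesis
  proof eventually_elim
    case (elim x)
    show ?case
    proof (cases "f x \<ge> 0")
      case True
      then show ?thesis using elim by (simp add: ennreal_neg)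
    next
      case False
      then show ?thesis using elim by (simp add: ennreal_neg)
    qed
  qed
qed

lemma AE_zero_of_box_integrals:
  fixes f :: "'a::euclidean_space \<Rightarrow> complex"
  assumes f: "f \<in> L2"
    and z: "\<And>a b. (\<integral>x. f x * indicator (box a b) x \<partial>lebesgue) = 0"
  shows "AE x in lebesgue. f x = 0"
proof -
  obtain g where g: "g \<in> borel_measurable borel" "AE x in lebesgue. f x = g x" "g \<in> L2"
    using ex_borel_L2[OF f] .
  note [measurable] = g(1)
  have gi: "integrable lborel (\<lambda>x. g x * indicator (box a b) x)" for a b
    using L2_product_integrable[OF g(3) box_indicator_L2[of a b]]
    by (subst (asm) integrable_completion) simp_all
  have gz: "(\<integral>x. g x * indicator (box a b) x \<partial>lborel) = 0" for a b
  proof -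
    have "(\<integral>x. f x * indicator (box a b) x \<partial>lebesgue) = (\<integral>x. g x * indicator (box a b) x \<partial>lebesgue)"
      using g L2_product_integrable[OF g(3) box_indicator_L2[of a b]] L2_product_integrable[OF f box_indicator_L2[of a b]]
      by (intro integral_cong_AE) auto
    also have "\<dots> = (\<integral>x. g x * indicator (box a b) x \<partial>lborel)"
      by (intro integral_lebesgue_eq_lborel) measurable
    finally show ?thesis using z[of a b] by simp
  qed
  have re: "Re (g x * indicator (box a b) x) = indicator (box a b) x * Re (g x)"
    and im: "Im (g x * indicator (box a b) x) = indicator (box a b) x * Im (g x)" for a b x
    by (auto simp: indicator_def)
  have "AE x in lborel. Re (g x) = 0"
  proof (rule AE_zero_of_box_integrals_real)
    show "integrable lborel (\<lambda>x. indicator (box a b) x * Re (g x))" for a b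
      using integrable_Re[OF gi[of a b]] unfolding re .
    show "(\<integral>x. indicator (box a b) x * Re (g x) \<partial>lborel) = 0" for a b
      using integral_Re[OF gi[of a b]] gz[of a b] unfolding re by simp
  qed measurable
  moreover have "AE x in lborel. Im (g x) = 0"
  proof (rule AE_zero_of_box_integrals_real)
    show "integrable lborel (\<lambda>x. indicator (box a b) x * Im (g x))" for a b
      using integrable_Im[OF gi[of a b]] unfolding im .
    show "(\<integral>x. indicator (box a b) x * Im (g x) \<partial>lborel) = 0" for a b
      using integral_Im[OF gi[of a b]] gz[of a b] unfolding im by simp
  qed measurable
  ultimately have "AE x in lborel. g x = 0" by eventually_elim (simp add: complex_eq_iff)
  from AE_completion[OF this] g(2) show ?thesis by eventually_elim simp
qed

text \<open>
  After this substitution the Gaussian average of the indicator is an integral against a fixed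
  Gaussian, in which the limit \<open>r \<rightarrow> 0\<close> can be taken pointwise.
\<close>

lemma gaussian_mollifier:
  fixes a b x :: "'a::euclidean_space"
  assumes r: "r > 0"
  shows "(\<integral>y. indicator (box a b) y * gauss (1 / r\<^sup>2) (x - y) \<partial>lborel)
    = r ^ DIM('a) * (\<integral>z. indicator (box a b) (x + r *\<^sub>R z) * gauss 1 z \<partial>lborel)"
proof -
  have eq: "lborel = density (distr lborel borel (\<lambda>z::'a. x + r *\<^sub>R z)) (\<lambda>_. ennreal (r ^ DIM('a)))"
    using lborel_affine[of r x] r by simp
  have "(\<integral>y. indicator (box a b) y * gauss (1 / r\<^sup>2) (x - y) \<partial>lborel)
     = (\<integral>z. r ^ DIM('a) * (indicator (box a b) (x + r *\<^sub>R z) * gauss (1 / r\<^sup>2) (x - (x + r *\<^sub>R z))) \<partial>lborel)"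
    using r by (subst eq, subst integral_density) (auto simp: integral_distr)
  also have "\<dots> = r ^ DIM('a) * (\<integral>z. indicator (box a b) (x + r *\<^sub>R z) * gauss 1 z \<partial>lborel)"
    using r by (simp add: power_mult_distrib)
  finally show ?thesis .
qed

text \<open>
  Integrating the hypothesis over \<open>y\<close> in a box shows that \<open>f\<close> is orthogonal to the Gaussian
  mollifications of the indicator of the box. As the width tends to zero these converge to a multiple
  of the indicator away from the frontier, under a common Gaussian bound.
\<close>

lemma AE_zero_of_gaussian_averages:
  fixes f :: "'a::euclidean_space \<Rightarrow> complex"
  assumes f: "f \<in> L2"
    and z: "\<And>y r. r > 0 \<Longrightarrow> (\<integral>x. f x * complex_of_real (gauss (1 / r\<^sup>2) (x - y)) \<partial>lebesgue) = 0"
  shows "AE x in lebesgue. f x = 0"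
proof (rule AE_zero_of_box_integrals[OF f])
  fix a b :: 'a
  obtain g where g: "g \<in> borel_measurable borel" "AE x in lebesgue. f x = g x" "g \<in> L2"
    using ex_borel_L2[OF f] .
  note [measurable] = g(1)
  let ?e = "\<lambda>r x y::'a. gauss (1 / r\<^sup>2) (x - y)"
  have gz: "(\<integral>x. g x * complex_of_real (?e r x y) \<partial>lborel) = 0" if "r > 0" for r y
  proof -
    have "(\<integral>x. f x * complex_of_real (?e r x y) \<partial>lebesgue) = (\<integral>x. g x * complex_of_real (?e r x y) \<partial>lebesgue)"
      using g L2_product_integrable[OF g(3) gaussian_translate_L2[of "1/r\<^sup>2" y]] L2_product_integrable[OF f gaussian_translate_L2[of "1/r\<^sup>2" y]] that
      by (intro integral_cong_AE) auto
    also have "\<dots> = (\<integral>x. g x * complex_of_real (?e r x y) \<partial>lborel)"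
      by (intro integral_lebesgue_eq_lborel) measurable
    finally show ?thesis using z[OF that, of y] by simp
  qed
  obtain R where R: "\<And>x. x \<in> box a b \<Longrightarrow> norm x \<le> R"
    using bounded_box[of a b] unfolding bounded_iff by blast
  define C where "C = (\<integral>z. gauss (1/2) z \<partial>(lborel :: 'a measure))"
  define P where "P r x = (\<integral>z. indicator (box a b) (x + r *\<^sub>R z) * gauss 1 z \<partial>(lborel :: 'a measure))" for r x
  define P0 where "P0 = (\<integral>z. gauss 1 z \<partial>(lborel :: 'a measure))"
  have P0: "P0 > 0" unfolding P0_def using gaussian_integral(2)[of 1, where 'a='a] by simp
  have gL: "integrable lborel (\<lambda>x. cmod (g x) * gauss c x)" if "c > 0" for c
  proof -
    have "integrable lebesgue (\<lambda>x. cmod (g x * complex_of_real (gauss c x)))"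
      by (intro integrable_norm L2_product_integrable g gaussian_L2 that)
    then have "integrable lebesgue (\<lambda>x. cmod (g x) * gauss c x)"
      by (simp only: norm_mult norm_of_real abs_exp_cancel)
    then show ?thesis by (subst (asm) integrable_completion) simp_all
  qed
  \<comment> \<open>Away from the box the distance to its points is comparable to the norm. This provides the
    dominating Gaussians in \<open>x\<close>, both for Fubini and for the limit \<open>r \<rightarrow> 0\<close>.\<close>
  have nb: "(norm x)\<^sup>2 / 2 \<le> R\<^sup>2 + (norm (x - y))\<^sup>2" if "y \<in> box a b" for x y
  proof -
    have "norm x \<le> norm y + norm (x - y)" using norm_triangle_sub[of x y] by simp
    also have "\<dots> \<le> R + norm (x - y)" using R[OF that] by simp
    finally have "(norm x)\<^sup>2 \<le> (R + norm (x - y))\<^sup>2" by (intro power_mono) auto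
    also have "\<dots> \<le> 2 * R\<^sup>2 + 2 * (norm (x - y))\<^sup>2"
      using sum_squares_bound[of R "norm (x - y)"] by (simp add: power2_sum)
    finally show ?thesis by simp
  qed
  have Pz: "(\<integral>x. g x * complex_of_real (P r x) \<partial>lborel) = 0" if r: "r > 0" for r
  proof -
    define B where "B = exp (R\<^sup>2 / r\<^sup>2)"
    have le: "indicator (box a b) y * ?e r x y \<le> indicator (box a b) y * (B * gauss (1 / (2 * r\<^sup>2)) x)" for x y
    proof (cases "y \<in> box a b")
      case True
      have "((norm x)\<^sup>2 / 2 - R\<^sup>2) / r\<^sup>2 \<le> (norm (x - y))\<^sup>2 / r\<^sup>2"
        using nb[OF True, of x] by (intro divide_right_mono) auto
      then have "- (1 / r\<^sup>2) * (norm (x - y))\<^sup>2 \<le> R\<^sup>2 / r\<^sup>2 + - (1 / (2 * r\<^sup>2)) * (norm x)\<^sup>2"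
        by (simp add: diff_divide_distrib mult.commute)
      then have "?e r x y \<le> exp (R\<^sup>2 / r\<^sup>2 + - (1 / (2 * r\<^sup>2)) * (norm x)\<^sup>2)" by simp
      also have "\<dots> = B * gauss (1 / (2 * r\<^sup>2)) x" unfolding B_def by (rule exp_add)
      finally show ?thesis using True by simp
    qed simp
    let ?F = "\<lambda>(x, y). g x * complex_of_real (indicator (box a b) y * ?e r x y)"
    have ib: "integrable lborel (\<lambda>y::'a. complex_of_real (indicator (box a b) y))"
      unfolding complex_of_real_integrable_eq
      by (rule integrable_real_indicator) (use emeasure_bounded_finite[OF bounded_box[of a b]] in simp_all)
    have ig: "integrable lborel (\<lambda>x. complex_of_real (B * (cmod (g x) * gauss (1 / (2 * r\<^sup>2)) x)))"
      unfolding complex_of_real_integrable_eq using gL[of "1 / (2 * r\<^sup>2)"] r by (intro integrable_mult_right) simp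
    have F: "integrable (lborel \<Otimes>\<^sub>M lborel) ?F"
    proof (rule Bochner_Integration.integrable_bound[OF integrable_pair_mult[OF ig ib]])
      show "?F \<in> borel_measurable (lborel \<Otimes>\<^sub>M lborel)" by measurable
      have "cmod (g x) * (indicator (box a b) y * ?e r x y) \<le> B * (cmod (g x) * gauss (1 / (2 * r\<^sup>2)) x) * indicator (box a b) y" for x y
        using mult_left_mono[OF le[of y x], of "cmod (g x)"] by (simp add: mult_ac)
      then show "AE p in lborel \<Otimes>\<^sub>M lborel. norm (?F p) \<le> norm (case p of (x, y) \<Rightarrow>
         complex_of_real (B * (cmod (g x) * gauss (1 / (2 * r\<^sup>2)) x)) * complex_of_real (indicator (box a b) y))"
        by (intro AE_I2) (auto simp: norm_mult B_def abs_mult split: prod.split simp del: of_real_mult)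
    qed
    have "(\<integral>x. g x * complex_of_real (r ^ DIM('a) * P r x) \<partial>lborel)
       = (\<integral>x. (\<integral>y. g x * complex_of_real (indicator (box a b) y * ?e r x y) \<partial>lborel) \<partial>lborel)"
      unfolding P_def gaussian_mollifier[OF r, symmetric]
      by (simp only: integral_mult_right_zero integral_complex_of_real)
    also have "\<dots> = (\<integral>y. (\<integral>x. g x * complex_of_real (indicator (box a b) y * ?e r x y) \<partial>lborel) \<partial>lborel)"
      using lborel_pair.Fubini_integral[OF F] by simp
    also have "\<dots> = (\<integral>y. complex_of_real (indicator (box a b) y) * (\<integral>x. g x * complex_of_real (?e r x y) \<partial>lborel) \<partial>lborel)"
      by (simp only: integral_mult_right_zero[symmetric] of_real_mult mult.left_commute)
    also have "\<dots> = 0" using gz[OF r] by simp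
    finally have "complex_of_real (r ^ DIM('a)) * (\<integral>x. g x * complex_of_real (P r x) \<partial>lborel) = 0"
      by (simp only: integral_mult_right_zero[symmetric] of_real_mult mult.left_commute)
    then show ?thesis using r by simp
  qed
  \<comment> \<open>Widths at most one make the dominating Gaussian independent of \<open>k\<close>.\<close>
  define rr where "rr k = 1 / real (Suc k)" for k
  have rr: "0 < rr k" "rr k \<le> 1" for k by (auto simp: rr_def)
  have rr0: "rr \<longlonglongrightarrow> 0"
    using LIMSEQ_inverse_real_of_nat by (simp add: rr_def[abs_def] inverse_eq_divide)
  have gi1: "integrable lborel (\<lambda>z::'a. gauss 1 z)" using gaussian_integral(1)[of 1] by simp
  have gi2: "integrable lborel (\<lambda>z::'a. gauss (1/2) z)" using gaussian_integral(1)[of "1/2"] by simp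
  have bm [measurable]: "box a b \<in> sets borel" by simp
  have Pm [measurable]: "P r \<in> borel_measurable borel" for r
    unfolding P_def by measurable
  have Pnn: "0 \<le> P r x" for r x unfolding P_def by (intro integral_nonneg_AE) simp
  have Pi: "integrable lborel (\<lambda>z::'a. indicator (box a b) (x + r *\<^sub>R z) * gauss 1 z)" for x r
    by (rule Bochner_Integration.integrable_bound[OF gi1]) (auto simp: indicator_def)
  have Ple: "P (rr k) x \<le> (exp (R\<^sup>2 / 2) * C) * gauss (1/4) x" for k x
  proof -
    have "P (rr k) x \<le> (\<integral>z. exp (R\<^sup>2 / 2) * gauss (1/4) x * gauss (1/2) z \<partial>(lborel :: 'a measure))"
      unfolding P_def
    proof (rule integral_mono[OF Pi])
      show "integrable lborel (\<lambda>z::'a. exp (R\<^sup>2 / 2) * gauss (1/4) x * gauss (1/2) z)"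
        by (intro integrable_mult_right gi2)
      fix z :: 'a
      show "indicator (box a b) (x + rr k *\<^sub>R z) * gauss 1 z \<le> exp (R\<^sup>2 / 2) * gauss (1/4) x * gauss (1/2) z"
      proof (cases "x + rr k *\<^sub>R z \<in> box a b")
        case True
        have "(norm (rr k *\<^sub>R z))\<^sup>2 \<le> (norm z)\<^sup>2"
          using rr[of k] by (intro power_mono) (auto simp: mult_left_le_one_le)
        moreover have "(norm x)\<^sup>2 / 2 \<le> R\<^sup>2 + (norm (rr k *\<^sub>R z))\<^sup>2"
          using nb[OF True, of x] by simp
        ultimately have "- 1 * (norm z)\<^sup>2 \<le> R\<^sup>2 / 2 + - (1/4) * (norm x)\<^sup>2 + - (1/2) * (norm z)\<^sup>2"
          by linarith
        then have "gauss 1 z \<le> exp (R\<^sup>2 / 2 + - (1/4) * (norm x)\<^sup>2 + - (1/2) * (norm z)\<^sup>2)"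
          by (simp only: exp_le_cancel_iff)
        then show ?thesis by (simp only: exp_add indicator_simps(1)[OF True] mult_1)
      qed simp
    qed
    also have "\<dots> = (exp (R\<^sup>2 / 2) * C) * gauss (1/4) x" by (simp add: C_def)
    finally show ?thesis .
  qed
  have fr: "AE x in lborel. x \<notin> frontier (box a b)"
  proof -
    have "negligible (frontier (box a b))" by (rule negligible_convex_frontier) simp
    then have "frontier (box a b) \<in> null_sets lborel"
      by (simp add: negligible_iff_null_sets null_sets_completion_iff)
    then show ?thesis by (rule AE_not_in)
  qed
  have Plim: "AE x in lborel. (\<lambda>k. P (rr k) x) \<longlonglongrightarrow> indicator (box a b) x * P0"
    using fr
  proof eventually_elim
    case (elim x)
    have "(\<lambda>k. \<integral>z. indicator (box a b) (x + rr k *\<^sub>R z) * gauss 1 z \<partial>(lborel :: 'a measure))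
       \<longlonglongrightarrow> (\<integral>z. indicator (box a b) x * gauss 1 z \<partial>(lborel :: 'a measure))"
    proof (rule integral_dominated_convergence[where w = "\<lambda>z. gauss 1 z"])
      show "AE z in (lborel :: 'a measure). (\<lambda>k. indicator (box a b) (x + rr k *\<^sub>R z) * gauss 1 z)
          \<longlonglongrightarrow> indicator (box a b) x * gauss 1 z"
      proof (rule AE_I2)
        fix z :: 'a
        have "(\<lambda>k. x + rr k *\<^sub>R z) \<longlonglongrightarrow> x + 0 *\<^sub>R z" by (intro tendsto_intros rr0)
        then have "(\<lambda>k. indicat_real (box a b) (x + rr k *\<^sub>R z)) \<longlonglongrightarrow> indicator (box a b) x"
          using isCont_indicator[of x "box a b"] elim by (auto intro: isCont_tendsto_compose)
        then show "(\<lambda>k. indicator (box a b) (x + rr k *\<^sub>R z) * gauss 1 z)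
          \<longlonglongrightarrow> indicator (box a b) x * gauss 1 z" by (intro tendsto_intros)
      qed
    qed (use gi1 in \<open>auto simp: indicator_def\<close>)
    then show ?case by (simp add: P_def P0_def)
  qed
  have "(\<lambda>k. \<integral>x. g x * complex_of_real (P (rr k) x) \<partial>lborel) \<longlonglongrightarrow> (\<integral>x. g x * complex_of_real (indicator (box a b) x * P0) \<partial>lborel)"
  proof (rule integral_dominated_convergence[where w = "\<lambda>x. (exp (R\<^sup>2 / 2) * C) * (cmod (g x) * gauss (1/4) x)"])
    show "integrable lborel (\<lambda>x. (exp (R\<^sup>2 / 2) * C) * (cmod (g x) * gauss (1/4) x))"
      by (intro integrable_mult_right gL) simp
    show "AE x in lborel. (\<lambda>k. g x * complex_of_real (P (rr k) x)) \<longlonglongrightarrow> g x * complex_of_real (indicator (box a b) x * P0)"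
      using Plim by eventually_elim (intro tendsto_intros)
    show "AE x in lborel. norm (g x * complex_of_real (P (rr k) x)) \<le> (exp (R\<^sup>2 / 2) * C) * (cmod (g x) * gauss (1/4) x)" for k
    proof (rule AE_I2)
      fix x
      show "norm (g x * complex_of_real (P (rr k) x)) \<le> (exp (R\<^sup>2 / 2) * C) * (cmod (g x) * gauss (1/4) x)"
        using mult_left_mono[OF Ple[of k x], of "cmod (g x)"] Pnn[of "rr k" x] by (simp add: norm_mult mult_ac)
    qed
  qed measurable
  then have "(\<integral>x. g x * complex_of_real (indicator (box a b) x * P0) \<partial>lborel) = 0"
    using Pz[OF rr(1)] by (simp add: LIMSEQ_const_iff)
  then have "complex_of_real P0 * (\<integral>x. g x * indicator (box a b) x \<partial>lborel) = 0"
    by (simp only: integral_mult_right_zero[symmetric] of_real_mult of_real_indicator mult_ac)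
  then have "(\<integral>x. g x * indicator (box a b) x \<partial>lborel) = 0" using P0 by simp
  moreover have "(\<integral>x. f x * indicator (box a b) x \<partial>lebesgue) = (\<integral>x. g x * indicator (box a b) x \<partial>lebesgue)"
    using g L2_product_integrable[OF g(3) box_indicator_L2[of a b]] L2_product_integrable[OF f box_indicator_L2[of a b]]
    by (intro integral_cong_AE) auto
  moreover have "(\<integral>x. g x * indicator (box a b) x \<partial>lebesgue) = (\<integral>x. g x * indicator (box a b) x \<partial>lborel)"
    by (intro integral_lebesgue_eq_lborel) measurable
  ultimately show "(\<integral>x. f x * indicator (box a b) x \<partial>lebesgue) = 0" by simp
qed

text \<open>
  Pairing the vanishing transform with a modulated Gaussian and moving the transform to the other
  side yields the Gaussian averages of \<open>f\<close> around an arbitrary point.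
\<close>

lemma fourier_limit_injective:
  fixes f :: "real^'n \<Rightarrow> complex"
  assumes f: "f \<in> L2" and e: "\<epsilon> = 1 \<or> \<epsilon> = -1" and z: "AE x in lebesgue. fourier_limit \<epsilon> f x = 0"
  shows "AE x in lebesgue. f x = 0"
proof (rule AE_zero_of_gaussian_averages[OF f])
  fix y :: "real^'n" and r :: real assume r: "r > 0"
  \<comment> \<open>With this choice the transformed Gaussian has width \<open>r\<close>.\<close>
  define c where "c = r\<^sup>2 / 4"
  have c: "c > 0" using r by (simp add: c_def)
  let ?k = "\<lambda>\<xi>. cis (- \<epsilon> * (\<xi> \<bullet> y)) * complex_of_real (gauss c \<xi>)"
  have k1: "integrable lebesgue ?k"
    by (intro integrable_cis_mult integrable_gaussian_lebesgue c) measurable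
  have kL2: "?k \<in> L2"
    by (rule L2_dominated[OF gaussian_L2[OF c], of _ 1]) (use k1 in \<open>auto simp: norm_mult\<close>)
  have "0 = (\<integral>\<xi>. fourier_limit \<epsilon> f \<xi> * ?k \<xi> \<partial>lebesgue)"
    by (rule integral_eq_zero_AE[symmetric]) (use z in eventually_elim, simp)
  also have "\<dots> = (\<integral>x. f x * FT \<epsilon> ?k x \<partial>lebesgue)" by (rule fourier_limit_pairing[OF f e kL2 k1])
  also have "\<dots> = (\<integral>x. complex_of_real ((2 * c) powr (- real CARD('n) / 2)) * (f x * complex_of_real (gauss (1 / r\<^sup>2) (x - y))) \<partial>lebesgue)"
    unfolding FT_gaussian_modulated[OF c e] by (intro Bochner_Integration.integral_cong refl) (simp add: c_def)
  also have "\<dots> = complex_of_real ((2 * c) powr (- real CARD('n) / 2)) * (\<integral>x. f x * complex_of_real (gauss (1 / r\<^sup>2) (x - y)) \<partial>lebesgue)"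
    by (rule integral_mult_right_zero)
  finally show "(\<integral>x. f x * complex_of_real (gauss (1 / r\<^sup>2) (x - y)) \<partial>lebesgue) = 0"
    using c by simp
qed

section \<open>Slowly varying test functions\<close>

text \<open>
  The normalisation makes the \<open>L\<^sup>2\<close> norm independent of \<open>t\<close>, while the functions spread out over the
  scale \<open>t\<close> and their transforms concentrate at frequencies of size \<open>1/t\<close>.
\<close>

definition test_fun :: "real \<Rightarrow> real^'n \<Rightarrow> real" where
  "test_fun t x = t powr (- real CARD('n) / 2) * gauss (1 / (2 * t\<^sup>2)) x"

text \<open>
  On the Fourier side the multiplier differs from one by at most \<open>|\<tau>| |\<xi>|\<^sup>2\<close>, which has size
  \<open>|\<tau>| / t\<^sup>2\<close> where the transform of the test function lives.
\<close>

lemma schroedinger_group_test_fun: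
  fixes f :: "real^'n \<Rightarrow> complex"
  assumes f: "f \<in> L2" and t: "t > 0"
  shows "schroedinger_group \<tau> f \<in> L2"
    and "cmod ((\<integral>x. schroedinger_group \<tau> f x * complex_of_real (test_fun t x) \<partial>lebesgue) - (\<integral>x. f x * complex_of_real (test_fun t x) \<partial>lebesgue))
      \<le> sqrt (8 * (2 * pi) powr (real CARD('n) / 2)) * l2 f * \<bar>\<tau>\<bar> / t\<^sup>2"
proof -
  let ?f = "fourier_limit (-1) f"
  let ?m = "\<lambda>\<xi>::real^'n. cis (- \<tau> * (norm \<xi>)\<^sup>2)"
  define h where "h = (\<lambda>x::real^'n. complex_of_real (test_fun t x))"
  define k where "k = (\<lambda>\<xi>::real^'n. complex_of_real (t powr (real CARD('n) / 2) * gauss (t\<^sup>2 / 2) \<xi>))"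
  have fL2: "?f \<in> L2" by (rule fourier_limit_L2[OF f]) simp
  have mm: "?m \<in> borel_measurable lebesgue"
    by (rule borel_measurable_imp_lebesgue) measurable
  have mfL2: "(\<lambda>\<xi>. ?m \<xi> * ?f \<xi>) \<in> L2"
    by (rule L2_dominated[OF fL2, of _ 1])
       (use mm L2_measurable[OF fL2] in \<open>auto simp: norm_mult intro!: borel_measurable_times\<close>)
  show "schroedinger_group \<tau> f \<in> L2"
    unfolding schroedinger_group_def inverse_fourier_def fourier_def by (rule fourier_limit_L2[OF mfL2]) simp
  have h_eq: "h = (\<lambda>x. complex_of_real (t powr (- real CARD('n) / 2)) * complex_of_real (gauss (1 / (2 * t\<^sup>2)) x))"
    by (simp add: h_def test_fun_def)
  have k_eq: "k = (\<lambda>x. complex_of_real (t powr (real CARD('n) / 2)) * complex_of_real (gauss (t\<^sup>2 / 2) x))"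
    by (simp add: k_def)
  have hL2: "h \<in> L2" unfolding h_eq using t by (intro L2_mult_left gaussian_L2) simp
  have h1: "integrable lebesgue h" unfolding h_eq using t by (intro integrable_mult_right integrable_gaussian_lebesgue) simp
  have kL2: "k \<in> L2" unfolding k_eq using t by (intro L2_mult_left gaussian_L2) simp
  have k1: "integrable lebesgue k" unfolding k_eq using t by (intro integrable_mult_right integrable_gaussian_lebesgue) simp
  have FTmult: "FT \<epsilon> (\<lambda>x. c * g x) \<xi> = c * FT \<epsilon> g \<xi>" for \<epsilon> c and g :: "real^'n \<Rightarrow> complex" and \<xi>
    unfolding FT_def by (simp only: mult.left_commute[of _ c] integral_mult_right_zero)
  have t2: "2 * (1 / (2 * t\<^sup>2)) = t powr (-2)"
  proof -
    have "t powr (-2) = 1 / t\<^sup>2" using t by (subst powr_minus_divide) simp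
    then show ?thesis by simp
  qed
  have Fh: "FT 1 h = k"
  proof
    fix \<xi>
    have "FT 1 h \<xi> = complex_of_real (t powr (- real CARD('n) / 2) * ((2 * (1 / (2 * t\<^sup>2))) powr (- real CARD('n) / 2) * exp (- (norm \<xi>)\<^sup>2 / (4 * (1 / (2 * t\<^sup>2))))))"
      unfolding h_eq FTmult using t by (subst FT_gaussian) auto
    also have "(2 * (1 / (2 * t\<^sup>2))) powr (- real CARD('n) / 2) = (t powr (-2)) powr (- real CARD('n) / 2)"
      by (simp only: t2)
    also have "\<dots> = t powr (real CARD('n))" by (simp add: powr_powr)
    also have "- (norm \<xi>)\<^sup>2 / (4 * (1 / (2 * t\<^sup>2))) = - (t\<^sup>2 / 2) * (norm \<xi>)\<^sup>2" by simp
    also have "t powr (- real CARD('n) / 2) * (t powr (real CARD('n)) * gauss (t\<^sup>2 / 2) \<xi>) = t powr (real CARD('n) / 2) * gauss (t\<^sup>2 / 2) \<xi>"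
      by (simp add: mult.assoc[symmetric] powr_add[symmetric])
    finally show "FT 1 h \<xi> = k \<xi>" by (simp add: k_def)
  qed
  have Fk: "FT (-1) k = h"
  proof
    fix \<xi>
    have "FT (-1) k \<xi> = complex_of_real (t powr (real CARD('n) / 2) * ((2 * (t\<^sup>2 / 2)) powr (- real CARD('n) / 2) * exp (- (norm \<xi>)\<^sup>2 / (4 * (t\<^sup>2 / 2)))))"
      unfolding k_eq FTmult using t by (subst FT_gaussian) auto
    also have "(2 * (t\<^sup>2 / 2)) powr (- real CARD('n) / 2) = (t powr 2) powr (- real CARD('n) / 2)"
    proof -
      have "2 * (t\<^sup>2 / 2) = t powr 2" using t by simp
      then show ?thesis by (simp only:)
    qed
    also have "\<dots> = t powr (- real CARD('n))" by (simp add: powr_powr)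
    also have "- (norm \<xi>)\<^sup>2 / (4 * (t\<^sup>2 / 2)) = - (1 / (2 * t\<^sup>2)) * (norm \<xi>)\<^sup>2" by simp
    also have "t powr (real CARD('n) / 2) * (t powr (- real CARD('n)) * gauss (1 / (2 * t\<^sup>2)) \<xi>) = t powr (- real CARD('n) / 2) * gauss (1 / (2 * t\<^sup>2)) \<xi>"
      by (simp add: mult.assoc[symmetric] powr_add[symmetric])
    finally show "FT (-1) k \<xi> = h \<xi>" by (simp add: h_def test_fun_def)
  qed
  have 1: "(\<integral>x. schroedinger_group \<tau> f x * h x \<partial>lebesgue) = (\<integral>\<xi>. (?m \<xi> * ?f \<xi>) * k \<xi> \<partial>lebesgue)"
    unfolding schroedinger_group_def inverse_fourier_def fourier_def Fh[symmetric]
    by (rule fourier_limit_pairing[OF mfL2 _ hL2 h1]) simp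
  have 2: "(\<integral>x. f x * h x \<partial>lebesgue) = (\<integral>\<xi>. ?f \<xi> * k \<xi> \<partial>lebesgue)"
    unfolding Fk[symmetric] by (rule fourier_limit_pairing[OF f _ kL2 k1, symmetric]) simp
  define w where "w \<xi> = (?m \<xi> - 1) * k \<xi>" for \<xi>
  define A where "A = \<bar>\<tau>\<bar>\<^sup>2 / t^4 * 8 * t powr (real CARD('n))"
  have tk: "(t powr (real CARD('n) / 2))\<^sup>2 = t powr (real CARD('n))"
    by (simp add: power2_eq_square powr_add[symmetric])
  have wle: "(cmod (w \<xi>))\<^sup>2 \<le> A * gauss (t\<^sup>2 / 2) \<xi>" for \<xi>
  proof -
    let ?r = "t\<^sup>2 * (norm \<xi>)\<^sup>2"
    have "cmod (?m \<xi> - 1) \<le> \<bar>\<tau>\<bar> * (norm \<xi>)\<^sup>2"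
    proof -
      have "cmod (iexp (- \<tau> * (norm \<xi>)\<^sup>2) - (\<Sum>k \<le> 0. (\<i> * complex_of_real (- \<tau> * (norm \<xi>)\<^sup>2))^k / fact k)) \<le> \<bar>- \<tau> * (norm \<xi>)\<^sup>2\<bar>^(Suc 0) / fact (Suc 0)"
        by (rule iexp_approx1)
      then show ?thesis by (simp add: cis_conv_exp abs_mult)
    qed
    also have "\<dots> = \<bar>\<tau>\<bar> / t\<^sup>2 * ?r" using t by simp
    finally have m1: "(cmod (?m \<xi> - 1))\<^sup>2 \<le> (\<bar>\<tau>\<bar> / t\<^sup>2 * ?r)\<^sup>2" by (rule power_mono) simp
    \<comment> \<open>Half of the Gaussian decay of \<open>|k|\<^sup>2\<close> absorbs the factor \<open>t\<^sup>4|\<xi>|\<^sup>4\<close>; the constant \<open>8\<close> comes from the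
      quadratic term of the exponential series.\<close>
    have "?r\<^sup>2 \<le> 8 * exp (?r / 2)"
    proof -
      have r0: "0 \<le> ?r" by simp
      then have "1 + ?r / 2 + (?r / 2)\<^sup>2 / 2 \<le> exp (?r / 2)"
        by (intro exp_lower_Taylor_quadratic) simp
      moreover have "(?r / 2)\<^sup>2 / 2 = ?r\<^sup>2 / 8" by (simp add: power_divide)
      ultimately show ?thesis using r0 by linarith
    qed
    then have m2: "(\<bar>\<tau>\<bar> / t\<^sup>2 * ?r)\<^sup>2 \<le> (\<bar>\<tau>\<bar> / t\<^sup>2)\<^sup>2 * (8 * exp (?r / 2))"
      unfolding power_mult_distrib by (intro mult_left_mono) auto
    have "(cmod (w \<xi>))\<^sup>2 = (cmod (?m \<xi> - 1))\<^sup>2 * (t powr (real CARD('n)) * exp (- ?r))"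
    proof -
      have "(cmod (k \<xi>))\<^sup>2 = t powr (real CARD('n)) * exp (- ?r)"
        by (simp add: k_def norm_mult power_mult_distrib tk exp_double[symmetric])
      then show ?thesis by (simp add: w_def norm_mult power_mult_distrib)
    qed
    also have "\<dots> \<le> (\<bar>\<tau>\<bar> / t\<^sup>2)\<^sup>2 * (8 * exp (?r / 2)) * (t powr (real CARD('n)) * exp (- ?r))"
      by (rule mult_right_mono[OF order_trans[OF m1 m2]]) simp
    also have "\<dots> = A * (exp (?r / 2) * exp (- ?r))"
    proof -
      have "(\<bar>\<tau>\<bar> / t\<^sup>2)\<^sup>2 = \<bar>\<tau>\<bar>\<^sup>2 / t^4" by (simp add: power_divide)
      then show ?thesis by (simp add: A_def)
    qed
    also have "exp (?r / 2) * exp (- ?r) = gauss (t\<^sup>2 / 2) \<xi>"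
      unfolding exp_add[symmetric] by simp
    finally show ?thesis .
  qed
  have wm: "w \<in> borel_measurable lebesgue"
    unfolding w_def k_def by (rule borel_measurable_imp_lebesgue) measurable
  have gi: "integrable lebesgue (\<lambda>\<xi>::real^'n. A * gauss (t\<^sup>2 / 2) \<xi>)"
    using t by (intro integrable_mult_right integrable_lborel_imp_lebesgue gaussian_integral) simp
  have wi: "integrable lebesgue (\<lambda>\<xi>. (cmod (w \<xi>))\<^sup>2)"
  proof (rule Bochner_Integration.integrable_bound[OF gi])
    show "(\<lambda>\<xi>. (cmod (w \<xi>))\<^sup>2) \<in> borel_measurable lebesgue" using wm by measurable
    show "AE \<xi> in lebesgue. norm ((cmod (w \<xi>))\<^sup>2) \<le> norm (A * gauss (t\<^sup>2 / 2) \<xi>)"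
      using wle by (intro AE_I2) (simp add: order_trans[OF _ abs_ge_self])
  qed
  have wL2: "w \<in> L2" using wm wi by (simp add: L2_iff)
  have "(l2 w)\<^sup>2 \<le> (\<integral>\<xi>. A * gauss (t\<^sup>2 / 2) \<xi> \<partial>(lebesgue :: (real^'n) measure))"
    unfolding l2_power2 by (rule integral_mono[OF wi gi wle])
  also have "\<dots> = A * (pi / (t\<^sup>2 / 2)) powr (real CARD('n) / 2)"
    using gaussian_integral(2)[of "t\<^sup>2 / 2", where 'a = "real^'n"] t
    by (subst integral_lebesgue_eq_lborel) simp_all
  also have "(pi / (t\<^sup>2 / 2)) powr (real CARD('n) / 2) = (2 * pi) powr (real CARD('n) / 2) * (t powr (-2)) powr (real CARD('n) / 2)"
  proof -
    have "pi / (t\<^sup>2 / 2) = 2 * pi * t powr (-2)" unfolding t2[symmetric] using t by simp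
    then show ?thesis by (simp only:) (subst powr_mult, auto)
  qed
  also have "(t powr (-2)) powr (real CARD('n) / 2) = t powr (- real CARD('n))" by (simp add: powr_powr)
  also have "A * ((2 * pi) powr (real CARD('n) / 2) * t powr (- real CARD('n))) = (\<bar>\<tau>\<bar> / t\<^sup>2)\<^sup>2 * (8 * (2 * pi) powr (real CARD('n) / 2))"
    using t by (simp add: A_def powr_minus power_divide)
  finally have "(l2 w)\<^sup>2 \<le> (\<bar>\<tau>\<bar> / t\<^sup>2)\<^sup>2 * (8 * (2 * pi) powr (real CARD('n) / 2))" .
  then have "sqrt ((l2 w)\<^sup>2) \<le> sqrt ((\<bar>\<tau>\<bar> / t\<^sup>2)\<^sup>2 * (8 * (2 * pi) powr (real CARD('n) / 2)))"
    by (rule real_sqrt_le_mono)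
  then have lw: "l2 w \<le> \<bar>\<tau>\<bar> / t\<^sup>2 * sqrt (8 * (2 * pi) powr (real CARD('n) / 2))"
    using t by (simp add: real_sqrt_mult)
  have "(\<integral>x. schroedinger_group \<tau> f x * h x \<partial>lebesgue) - (\<integral>x. f x * h x \<partial>lebesgue) = (\<integral>\<xi>. ?f \<xi> * w \<xi> \<partial>lebesgue)"
    unfolding 1 2 using L2_product_integrable[OF mfL2 kL2] L2_product_integrable[OF fL2 kL2]
    by (subst Bochner_Integration.integral_diff[symmetric]) (auto simp: w_def algebra_simps)
  then have "cmod ((\<integral>x. schroedinger_group \<tau> f x * h x \<partial>lebesgue) - (\<integral>x. f x * h x \<partial>lebesgue)) \<le> l2 ?f * l2 w"
    using L2_Cauchy_Schwarz[OF fL2 wL2] by simp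
  also have "\<dots> \<le> l2 f * (\<bar>\<tau>\<bar> / t\<^sup>2 * sqrt (8 * (2 * pi) powr (real CARD('n) / 2)))"
    by (intro mult_mono fourier_limit_contraction f lw) auto
  finally show "cmod ((\<integral>x. schroedinger_group \<tau> f x * complex_of_real (test_fun t x) \<partial>lebesgue) - (\<integral>x. f x * complex_of_real (test_fun t x) \<partial>lebesgue))
      \<le> sqrt (8 * (2 * pi) powr (real CARD('n) / 2)) * l2 f * \<bar>\<tau>\<bar> / t\<^sup>2"
    by (simp add: h_def mult_ac)
qed

section \<open>Scalar pairings of the Bochner integral\<close>

lemma lebesgue_on_borel_measurable_AE:
  fixes f g :: "real \<Rightarrow> complex"
  assumes A: "A \<in> sets lebesgue" and f: "f \<in> borel_measurable (lebesgue_on A)"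
    and ae: "AE s in lebesgue_on A. f s = g s"
  shows "g \<in> borel_measurable (lebesgue_on A)"
proof -
  have A': "A \<inter> space lebesgue \<in> sets lebesgue" using A by simp
  have "AE s in lebesgue. s \<in> A \<longrightarrow> f s = g s"
    using ae AE_restrict_space_iff[OF A'] by simp
  then have "AE s in lebesgue. indicator A s *\<^sub>R f s = indicator A s *\<^sub>R g s"
    by eventually_elim (auto simp: indicator_def)
  moreover have "(\<lambda>s. indicator A s *\<^sub>R f s) \<in> borel_measurable lebesgue"
    using f borel_measurable_restrict_space_iff[OF A', of f] by (simp add: mult.commute)
  ultimately have "(\<lambda>s. indicator A s *\<^sub>R g s) \<in> borel_measurable lebesgue"
    by (rule borel_measurable_AE[rotated])
  then show ?thesis using borel_measurable_restrict_space_iff[OF A', of g] by simp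
qed

text \<open>
  The integrand may fail to be measurable: the \<open>L\<^sup>2\<close> distances in the definition of the Bochner integral
  are functions of time to which the usual rule does not apply.
\<close>

lemma nn_integral_cmult_le:
  assumes r: "0 \<le> r"
  shows "(\<integral>\<^sup>+x. ennreal r * f x \<partial>M) \<le> ennreal r * (\<integral>\<^sup>+x. f x \<partial>M)"
proof (cases "r = 0")
  case False
  then have r: "r > 0" using assms by simp
  have inv: "ennreal r * (ennreal (1 / r) * y) = y" "ennreal (1 / r) * (ennreal r * y) = y" for y
    using r by (simp_all add: mult.assoc[symmetric] ennreal_mult[symmetric])
  show ?thesis
    unfolding nn_integral_def[of M "\<lambda>x. ennreal r * f x"]
  proof (rule SUP_least)
    fix g assume "g \<in> {g. simple_function M g \<and> g \<le> (\<lambda>x. ennreal r * f x)}"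
    then have g: "simple_function M g" "\<And>x. g x \<le> ennreal r * f x" by (auto simp: le_fun_def)
    have gm: "g \<in> borel_measurable M" using g(1) by (rule borel_measurable_simple_function)
    have le: "ennreal (1 / r) * g x \<le> f x" for x
      using mult_left_mono[OF g(2)[of x], of "ennreal (1 / r)"] by (simp add: inv)
    have "integral\<^sup>S M g = (\<integral>\<^sup>+x. g x \<partial>M)"
      using g(1) by (simp add: nn_integral_eq_simple_integral)
    also have "\<dots> = ennreal r * (\<integral>\<^sup>+x. ennreal (1 / r) * g x \<partial>M)"
      using gm by (subst nn_integral_cmult) (simp_all add: inv)
    also have "\<dots> \<le> ennreal r * (\<integral>\<^sup>+x. f x \<partial>M)"
      by (intro mult_left_mono nn_integral_mono le) simp
    finally show "integral\<^sup>S M g \<le> ennreal r * (\<integral>\<^sup>+x. f x \<partial>M)" .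
  qed
qed simp

lemma L2_simple_pairing:
  fixes S :: "real \<Rightarrow> 'a::euclidean_space \<Rightarrow> complex"
  assumes A: "A \<in> sets lebesgue" and S: "L2_simple A S" and h: "h \<in> L2"
  shows "has_bochner_integral (lebesgue_on A) (\<lambda>s. \<integral>x. S s x * h x \<partial>lebesgue)
     (\<integral>x. L2_simple_integral A S x * h x \<partial>lebesgue)"
proof -
  let ?Y = "S ` A"
  let ?B = "\<lambda>y. {s \<in> A. S s = y}"
  let ?c = "\<lambda>y. \<integral>x. y x * h x \<partial>lebesgue"
  have fin: "finite ?Y" and YL2: "\<And>y. y \<in> ?Y \<Longrightarrow> y \<in> L2" and B: "\<And>y. y \<in> ?Y \<Longrightarrow> ?B y \<in> lmeasurable"
    using S by (auto simp: L2_simple_def)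
  have A': "A \<inter> space lebesgue \<in> sets lebesgue" using A by simp
  have 1: "has_bochner_integral (lebesgue_on A) (\<lambda>s. \<Sum>y\<in>?Y. indicator (?B y) s *\<^sub>R ?c y)
      (\<Sum>y\<in>?Y. measure (lebesgue_on A) (?B y) *\<^sub>R ?c y)"
  proof (intro has_bochner_integral_sum has_bochner_integral_scaleR_left has_bochner_integral_real_indicator)
    fix y assume y: "y \<in> ?Y"
    have Bs: "?B y \<in> sets lebesgue" "?B y \<subseteq> A" using B[OF y] by (auto simp: fmeasurable_def)
    then show "?B y \<in> sets (lebesgue_on A)" using A' by (simp add: sets_restrict_space_iff)
    show "emeasure (lebesgue_on A) (?B y) < \<infinity>"
      using B[OF y] Bs A' by (subst emeasure_restrict_space) (auto simp: fmeasurable_def)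
  qed
  have m: "measure (lebesgue_on A) (?B y) = measure lebesgue (?B y)" if "y \<in> ?Y" for y
    using A' by (intro measure_restrict_space) auto
  have 2: "(\<Sum>y\<in>?Y. indicator (?B y) s *\<^sub>R ?c y) = (\<integral>x. S s x * h x \<partial>lebesgue)" if s: "s \<in> A" for s
  proof -
    have "(\<Sum>y\<in>?Y. indicator (?B y) s *\<^sub>R ?c y) = (\<Sum>y\<in>?Y. if y = S s then ?c y else 0)"
      using s by (intro sum.cong refl) (auto simp: indicator_def)
    also have "\<dots> = ?c (S s)" using fin s by (subst sum.delta) auto
    finally show ?thesis .
  qed
  have 3: "(\<Sum>y\<in>?Y. measure (lebesgue_on A) (?B y) *\<^sub>R ?c y) = (\<integral>x. L2_simple_integral A S x * h x \<partial>lebesgue)"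
  proof -
    have "(\<integral>x. L2_simple_integral A S x * h x \<partial>lebesgue)
       = (\<integral>x. (\<Sum>y\<in>?Y. complex_of_real (measure lebesgue (?B y)) * (y x * h x)) \<partial>lebesgue)"
      unfolding L2_simple_integral_def by (simp only: sum_distrib_right mult.assoc)
    also have "\<dots> = (\<Sum>y\<in>?Y. \<integral>x. complex_of_real (measure lebesgue (?B y)) * (y x * h x) \<partial>lebesgue)"
      by (intro Bochner_Integration.integral_sum integrable_mult_right L2_product_integrable YL2 h)
    also have "\<dots> = (\<Sum>y\<in>?Y. measure (lebesgue_on A) (?B y) *\<^sub>R ?c y)"
      by (intro sum.cong refl) (simp only: integral_mult_right_zero m scaleR_conv_of_real)
    finally show ?thesis by simp
  qed
  have "has_bochner_integral (lebesgue_on A) (\<lambda>s. \<Sum>y\<in>?Y. indicator (?B y) s *\<^sub>R ?c y)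
      (\<integral>x. L2_simple_integral A S x * h x \<partial>lebesgue)"
    using 1 unfolding 3 .
  then show ?thesis
    by (subst has_bochner_integral_cong[OF refl _ refl]) (auto simp: 2)
qed

lemma L2_simple_integral_L2:
  assumes "L2_simple A S"
  shows "L2_simple_integral A S \<in> L2"
proof -
  have "(\<lambda>x. \<Sum>h\<in>Y. complex_of_real (c h) * h x) \<in> L2" if "finite Y" "Y \<subseteq> L2" for Y :: "('a \<Rightarrow> complex) set" and c
    using that by (induction Y) (auto intro: L2_zero L2_add L2_mult_left)
  then show ?thesis using assms by (simp add: L2_simple_integral_def[abs_def] L2_simple_def)
qed

text \<open>
  The pairings of the approximating simple functions converge almost everywhere and in \<open>L\<^sup>1\<close>, because
  pairing with \<open>h\<close> is Lipschitz with constant \<open>l2 h\<close>. This turns the integral with values in \<open>L\<^sup>2\<close> into a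
  scalar one.
\<close>

lemma has_L2_integral_pairing:
  fixes G :: "real \<Rightarrow> 'a::euclidean_space \<Rightarrow> complex"
  assumes A: "A \<in> sets lebesgue" and G: "has_L2_integral G A w" and h: "h \<in> L2"
  shows "has_bochner_integral (lebesgue_on A) (\<lambda>s. \<integral>x. G s x * h x \<partial>lebesgue) (\<integral>x. w x * h x \<partial>lebesgue)"
proof -
  let ?M = "lebesgue_on A"
  obtain S where w: "w \<in> L2" and GL2: "AE s in ?M. G s \<in> L2"
    and S: "\<And>k. L2_simple A (S k)"
    and ptw: "AE s in ?M. (\<lambda>k. L2_norm (\<lambda>x. S k s x - G s x)) \<longlonglongrightarrow> 0"
    and int: "(\<lambda>k. \<integral>\<^sup>+ s. L2_norm (\<lambda>x. S k s x - G s x) \<partial>?M) \<longlonglongrightarrow> 0"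
    and lim: "(\<lambda>k. L2_norm (\<lambda>x. L2_simple_integral A (S k) x - w x)) \<longlonglongrightarrow> 0"
    using G unfolding has_L2_integral_def by blast
  define u where "u k s = (\<integral>x. S k s x * h x \<partial>lebesgue)" for k s
  define g where "g s = (\<integral>x. G s x * h x \<partial>lebesgue)" for s
  have SL2: "S k s \<in> L2" if "s \<in> A" for k s using S[of k] that by (auto simp: L2_simple_def)
  have ub: "has_bochner_integral ?M (u k) (\<integral>x. L2_simple_integral A (S k) x * h x \<partial>lebesgue)" for k
    unfolding u_def by (rule L2_simple_pairing[OF A S h])
  have ui: "integrable ?M (u k)" for k using ub has_bochner_integral_iff by blast
  have um [measurable]: "u k \<in> borel_measurable ?M" for k using ui by (rule borel_measurable_integrable)
  have inA: "AE s in ?M. s \<in> A" by (rule AE_I2) (simp add: space_restrict_space)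
  have conv: "AE s in ?M. (\<lambda>k. u k s) \<longlonglongrightarrow> g s"
    using GL2 ptw inA
  proof eventually_elim
    case (elim s)
    have "(\<lambda>k. l2 (\<lambda>x. S k s x - G s x)) \<longlonglongrightarrow> 0"
      using elim(2) by (subst L2_norm_tendsto_0_iff[symmetric]) (auto intro!: always_eventually L2_diff elim(1) SL2[OF elim(3)])
    then show ?case unfolding u_def g_def using elim SL2 h
      by (intro L2_pairing_tendsto) auto
  qed
  have gm [measurable]: "g \<in> borel_measurable ?M"
  proof (rule lebesgue_on_borel_measurable_AE[OF A])
    show "(\<lambda>s. lim (\<lambda>k. u k s)) \<in> borel_measurable ?M" by measurable
    show "AE s in ?M. lim (\<lambda>k. u k s) = g s" using conv by eventually_elim (rule limI)
  qed
  have le: "(\<integral>\<^sup>+s. ennreal (norm (u k s - g s)) \<partial>?M) \<le> ennreal (l2 h) * (\<integral>\<^sup>+ s. L2_norm (\<lambda>x. S k s x - G s x) \<partial>?M)" for k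
  proof -
    have "(\<integral>\<^sup>+s. ennreal (norm (u k s - g s)) \<partial>?M) \<le> (\<integral>\<^sup>+ s. ennreal (l2 h) * L2_norm (\<lambda>x. S k s x - G s x) \<partial>?M)"
    proof (rule nn_integral_mono_AE)
      show "AE s in ?M. ennreal (norm (u k s - g s)) \<le> ennreal (l2 h) * L2_norm (\<lambda>x. S k s x - G s x)"
        using GL2 inA
      proof eventually_elim
        case (elim s)
        have d: "(\<lambda>x. S k s x - G s x) \<in> L2" using elim SL2 by (intro L2_diff) auto
        have "u k s - g s = (\<integral>x. (S k s x - G s x) * h x \<partial>lebesgue)"
          using L2_product_integrable[OF SL2[OF elim(2)] h, of k] L2_product_integrable[OF elim(1) h]
          by (simp add: u_def g_def left_diff_distrib)
        then have "norm (u k s - g s) \<le> l2 h * l2 (\<lambda>x. S k s x - G s x)"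
          using L2_Cauchy_Schwarz[OF d h] by (simp add: mult.commute)
        then show ?case by (simp add: L2_norm_eq_l2[OF d] ennreal_mult[symmetric] ennreal_leI)
      qed
    qed
    also have "\<dots> \<le> ennreal (l2 h) * (\<integral>\<^sup>+ s. L2_norm (\<lambda>x. S k s x - G s x) \<partial>?M)"
      by (rule nn_integral_cmult_le) simp
    finally show ?thesis .
  qed
  have L1: "(\<lambda>k. \<integral>\<^sup>+s. ennreal (norm (u k s - g s)) \<partial>?M) \<longlonglongrightarrow> 0"
  proof (rule tendsto_sandwich[OF _ _ tendsto_const])
    show "(\<lambda>k. ennreal (l2 h) * (\<integral>\<^sup>+ s. L2_norm (\<lambda>x. S k s x - G s x) \<partial>?M)) \<longlonglongrightarrow> 0"
      using ennreal_tendsto_cmult[OF _ int, of "ennreal (l2 h)"] by simp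
  qed (auto intro!: always_eventually le)
  have gi: "integrable ?M g"
  proof -
    obtain k where k: "(\<integral>\<^sup>+s. ennreal (norm (u k s - g s)) \<partial>?M) < 1"
      using order_tendstoD(2)[OF L1, of 1] by (auto simp: eventually_sequentially)
    have "integrable ?M (\<lambda>s. u k s - g s)"
      by (rule integrableI_bounded) (use k in \<open>auto intro: less_trans\<close>)
    from Bochner_Integration.integrable_diff[OF ui[of k] this] show ?thesis by simp
  qed
  have "(\<lambda>k. \<integral>s. u k s \<partial>?M) \<longlonglongrightarrow> (\<integral>s. g s \<partial>?M)"
    by (rule tendsto_L1_int[OF ui gi L1])
  moreover have "(\<lambda>k. \<integral>s. u k s \<partial>?M) \<longlonglongrightarrow> (\<integral>x. w x * h x \<partial>lebesgue)"
  proof -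
    have sL2: "L2_simple_integral A (S k) \<in> L2" for k by (rule L2_simple_integral_L2[OF S])
    have "(\<lambda>k. l2 (\<lambda>x. L2_simple_integral A (S k) x - w x)) \<longlonglongrightarrow> 0"
      by (rule L2_norm_tendsto_0_iff[THEN iffD1, OF _ lim]) (intro always_eventually allI L2_diff sL2 w)
    then have "(\<lambda>k. \<integral>x. L2_simple_integral A (S k) x * h x \<partial>lebesgue) \<longlonglongrightarrow> (\<integral>x. w x * h x \<partial>lebesgue)"
      by (rule L2_pairing_tendsto[rotated 3]) (rule always_eventually, rule allI, rule sL2, rule w, rule h)
    then show ?thesis by (simp only: has_bochner_integral_integral_eq[OF ub])
  qed
  ultimately have "(\<integral>s. g s \<partial>?M) = (\<integral>x. w x * h x \<partial>lebesgue)" by (rule LIMSEQ_unique)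
  with gi have "has_bochner_integral ?M g (\<integral>x. w x * h x \<partial>lebesgue)"
    by (simp only: has_bochner_integral_iff simp_thms)
  then show ?thesis unfolding g_def[abs_def] .
qed

section \<open>Lebesgue measure on space-time\<close>

lemma space_time_representative:
  fixes f :: "real \<times> 'a::euclidean_space \<Rightarrow> complex"
  assumes "f \<in> borel_measurable lebesgue"
  obtains g where "g \<in> borel_measurable borel" "AE s in lebesgue. AE x in lebesgue. f (s, x) = g (s, x)"
    "AE p in lebesgue. f p = g p"
proof -
  obtain g where g: "g \<in> borel_measurable borel" "AE p in lborel. f p = g p"
    using lebesgue_borel_representative[OF assms] by (rule bexE)
  have "AE p in lborel \<Otimes>\<^sub>M lborel. f p = g p" using g(2) by (simp only: lborel_prod)
  then have "AE s in lborel. AE x in lborel. f (s, x) = g (s, x)" by (rule lborel_pair.AE_pair)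
  then have "AE s in lborel. AE x in lebesgue. f (s, x) = g (s, x)"
    by eventually_elim (rule AE_completion)
  then have "AE s in lebesgue. AE x in lebesgue. f (s, x) = g (s, x)" by (rule AE_completion)
  then show ?thesis by (rule that[OF g(1) _ AE_completion[OF g(2)]])
qed

lemma borel_pair_slice:
  assumes "g \<in> borel_measurable (borel :: ('a::second_countable_topology \<times> 'b::second_countable_topology) measure)"
  shows "(\<lambda>x. g (s, x)) \<in> borel_measurable borel"
proof -
  have "Pair s \<in> borel \<rightarrow>\<^sub>M borel"
    by (rule borel_measurable_continuous_onI) (intro continuous_intros)
  from measurable_compose[OF this assms] show ?thesis .
qed

text \<open>
  A function that is measurable for the completed measure agrees with a Borel function on almost every
  slice only. Measurability of the slice integral survives because it may be changed on null sets.
\<close>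

lemma slice_integral_measurable:
  fixes f :: "real \<times> 'a::euclidean_space \<Rightarrow> complex"
  assumes f: "f \<in> borel_measurable lebesgue" and slice: "\<And>s. (\<lambda>x. f (s, x)) \<in> borel_measurable lebesgue"
  shows "(\<lambda>s. \<integral>x. f (s, x) \<partial>lebesgue) \<in> borel_measurable lebesgue"
proof -
  obtain g where g: "g \<in> borel_measurable borel" "AE s in lebesgue. AE x in lebesgue. f (s, x) = g (s, x)"
    using space_time_representative[OF f] .
  have gp: "g \<in> borel_measurable (lborel \<Otimes>\<^sub>M lborel)" using g(1) by (simp only: lborel_prod measurable_lborel1 measurable_lborel2)
  have "(\<lambda>s. \<integral>x. g (s, x) \<partial>lborel) \<in> borel_measurable lborel"
    using lborel.borel_measurable_lebesgue_integral[of "\<lambda>s x. g (s, x)" lborel] gp by simp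
  then have 1: "(\<lambda>s. \<integral>x. g (s, x) \<partial>lborel) \<in> borel_measurable lebesgue"
    by (rule measurable_completion)
  have 2: "AE s in lebesgue. (\<integral>x. g (s, x) \<partial>lborel) = (\<integral>x. f (s, x) \<partial>lebesgue)"
    using g(2)
  proof eventually_elim
    case (elim s)
    have sm: "(\<lambda>x. g (s, x)) \<in> borel_measurable borel" by (rule borel_pair_slice[OF g(1)])
    have "(\<integral>x. f (s, x) \<partial>lebesgue) = (\<integral>x. g (s, x) \<partial>lebesgue)"
      using elim slice borel_measurable_imp_lebesgue[OF sm] by (intro integral_cong_AE) auto
    then show ?case using integral_lebesgue_eq_lborel[OF sm] by simp
  qed
  show ?thesis by (rule borel_measurable_AE[OF 1 2])
qed

text \<open>
  The function \<open>D\<close> is the integral over the slices of a Borel representative. The slice integrals of \<open>f\<close>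
  itself agree with it almost everywhere.
\<close>

lemma space_time_Tonelli:
  fixes f :: "real \<times> 'a::euclidean_space \<Rightarrow> complex"
  assumes f: "f \<in> borel_measurable (lebesgue_on (I \<times> UNIV))" and I: "I \<in> sets borel"
  obtains D :: "real \<Rightarrow> ennreal" where "D \<in> borel_measurable borel"
    "AE s in lebesgue. s \<in> I \<longrightarrow> (\<integral>\<^sup>+x. ennreal (cmod (f (s, x)) powr r) \<partial>lebesgue) = D s"
    "\<And>J. J \<in> sets borel \<Longrightarrow> J \<subseteq> I \<Longrightarrow>
      (\<integral>\<^sup>+p. ennreal (cmod (f p) powr r) \<partial>(lebesgue_on (J \<times> UNIV))) = (\<integral>\<^sup>+s. D s * indicator J s \<partial>lebesgue)"
proof -
  have prodm: "J \<times> (UNIV :: 'a set) \<in> sets borel" if "J \<in> sets borel" for J :: "real set"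
  proof -
    have "J \<times> (UNIV :: 'a set) \<in> sets (borel \<Otimes>\<^sub>M borel)" using that by (intro pair_measureI) auto
    then show ?thesis by (simp only: borel_prod)
  qed
  have prodl: "J \<times> (UNIV :: 'a set) \<inter> space lebesgue \<in> sets lebesgue" if "J \<in> sets borel" for J :: "real set"
    using prodm[OF that] by simp
  let ?f0 = "\<lambda>p. indicator (I \<times> UNIV) p *\<^sub>R f p"
  have "?f0 \<in> borel_measurable lebesgue"
    using f borel_measurable_restrict_space_iff[OF prodl[OF I], of f] by simp
  from space_time_representative[OF this]
  obtain g where g: "g \<in> borel_measurable borel" "AE s in lebesgue. AE x in lebesgue. ?f0 (s, x) = g (s, x)"
      "AE p in lebesgue. ?f0 p = g p" .
  define D where "D s = (\<integral>\<^sup>+x. ennreal (cmod (g (s, x)) powr r) \<partial>lborel)" for s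
  have gp [measurable]: "g \<in> borel_measurable (lborel \<Otimes>\<^sub>M lborel)" using g(1) by (simp only: lborel_prod measurable_lborel1 measurable_lborel2)
  have Dm: "D \<in> borel_measurable borel"
  proof -
    have "(\<lambda>s. \<integral>\<^sup>+x. ennreal (cmod (g (s, x)) powr r) \<partial>lborel) \<in> borel_measurable lborel" by measurable
    then show ?thesis by (simp add: D_def[abs_def])
  qed
  have 2: "AE s in lebesgue. s \<in> I \<longrightarrow> (\<integral>\<^sup>+x. ennreal (cmod (f (s, x)) powr r) \<partial>lebesgue) = D s"
    using g(2)
  proof eventually_elim
    case (elim s)
    show ?case
    proof
      assume s: "s \<in> I"
      have "(\<integral>\<^sup>+x. ennreal (cmod (f (s, x)) powr r) \<partial>lebesgue) = (\<integral>\<^sup>+x. ennreal (cmod (g (s, x)) powr r) \<partial>lebesgue)"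
        using elim s by (intro nn_integral_cong_AE) (auto elim!: eventually_mono)
      then show "(\<integral>\<^sup>+x. ennreal (cmod (f (s, x)) powr r) \<partial>lebesgue) = D s"
        by (simp add: D_def nn_integral_completion)
    qed
  qed
  have 3: "(\<integral>\<^sup>+p. ennreal (cmod (f p) powr r) \<partial>(lebesgue_on (J \<times> UNIV))) = (\<integral>\<^sup>+s. D s * indicator J s \<partial>lebesgue)"
    if J: "J \<in> sets borel" "J \<subseteq> I" for J
  proof -
    note J(1) [measurable]
    have "(\<integral>\<^sup>+p. ennreal (cmod (f p) powr r) \<partial>(lebesgue_on (J \<times> UNIV)))
       = (\<integral>\<^sup>+p. ennreal (cmod (f p) powr r) * indicator (J \<times> UNIV) p \<partial>lebesgue)"
      using prodl[OF J(1)] by (rule nn_integral_restrict_space)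
    also have "\<dots> = (\<integral>\<^sup>+p. ennreal (cmod (g p) powr r) * indicator J (fst p) \<partial>lebesgue)"
    proof (rule nn_integral_cong_AE)
      show "AE p in lebesgue. ennreal (cmod (f p) powr r) * indicator (J \<times> UNIV) p
          = ennreal (cmod (g p) powr r) * indicator J (fst p)"
        using g(3)
      proof eventually_elim
        case (elim p)
        show ?case
        proof (cases "fst p \<in> J")
          case True
          then have "p \<in> J \<times> UNIV" "p \<in> I \<times> UNIV" using J(2) by (auto simp: mem_Times_iff)
          then show ?thesis using True elim by simp
        next
          case False
          then have "p \<notin> J \<times> UNIV" by (auto simp: mem_Times_iff)
          then show ?thesis using False by simp
        qed
      qed
    qed
    also have "\<dots> = (\<integral>\<^sup>+p. ennreal (cmod (g p) powr r) * indicator J (fst p) \<partial>(lborel \<Otimes>\<^sub>M lborel))"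
      by (simp only: nn_integral_completion lborel_prod)
    also have "\<dots> = (\<integral>\<^sup>+s. \<integral>\<^sup>+x. ennreal (cmod (g (s, x)) powr r) * indicator J s \<partial>lborel \<partial>lborel)"
    proof -
      have "(\<lambda>p. ennreal (cmod (g p) powr r) * indicator J (fst p)) \<in> borel_measurable (lborel \<Otimes>\<^sub>M lborel)"
        by measurable
      from lborel.nn_integral_fst[OF this] show ?thesis by simp
    qed
    also have "\<dots> = (\<integral>\<^sup>+s. D s * indicator J s \<partial>lborel)"
    proof (rule nn_integral_cong)
      fix s
      have "(\<lambda>x. ennreal (cmod (g (s, x)) powr r)) \<in> borel_measurable lborel"
        using borel_pair_slice[OF g(1), of s] by measurable
      then show "(\<integral>\<^sup>+x. ennreal (cmod (g (s, x)) powr r) * indicator J s \<partial>lborel) = D s * indicator J s"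
        unfolding D_def by (rule nn_integral_multc)
    qed
    finally show ?thesis by (simp add: nn_integral_completion)
  qed
  show ?thesis by (rule that[OF Dm 2 3])
qed

lemma lebesgue_scaling:
  assumes c: "c > 0"
  shows "(lebesgue :: 'a::euclidean_space measure) = density (distr lebesgue lebesgue (\<lambda>x. c *\<^sub>R x)) (\<lambda>_. ennreal (c ^ DIM('a)))"
proof -
  have T: "(\<lambda>x::'a. 0 + (\<Sum>j\<in>Basis. (c * (x \<bullet> j)) *\<^sub>R j)) = (\<lambda>x. c *\<^sub>R x)"
    by (rule ext) (simp add: scaleR_scaleR[symmetric] scaleR_sum_right[symmetric] euclidean_representation del: scaleR_scaleR)
  show ?thesis
    using lebesgue_affine_euclidean[of "\<lambda>_::'a. c" 0] c unfolding T by (simp add: prod_constant)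
qed

lemma scaling_measurable:
  assumes "f \<in> borel_measurable lebesgue"
  shows "(\<lambda>x. f (c *\<^sub>R x)) \<in> borel_measurable lebesgue"
  using measurable_compose[OF lebesgue_measurable_scaling assms] .

lemma nn_integral_scaling:
  fixes f :: "'a::euclidean_space \<Rightarrow> ennreal"
  assumes f: "f \<in> borel_measurable lebesgue" and c: "c > 0"
  shows "(\<integral>\<^sup>+x. f x \<partial>lebesgue) = ennreal (c ^ DIM('a)) * (\<integral>\<^sup>+x. f (c *\<^sub>R x) \<partial>lebesgue)"
proof -
  have "(\<integral>\<^sup>+x. f x \<partial>lebesgue) = (\<integral>\<^sup>+x. f x \<partial>(density (distr lebesgue lebesgue (\<lambda>x. c *\<^sub>R x)) (\<lambda>_. ennreal (c ^ DIM('a)))))"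
    using lebesgue_scaling[OF c, where 'a = 'a] by simp
  also have "\<dots> = (\<integral>\<^sup>+x. ennreal (c ^ DIM('a)) * f x \<partial>(distr lebesgue lebesgue (\<lambda>x. c *\<^sub>R x)))"
    using f by (intro nn_integral_density) auto
  also have "\<dots> = (\<integral>\<^sup>+x. ennreal (c ^ DIM('a)) * f (c *\<^sub>R x) \<partial>lebesgue)"
    using f by (intro nn_integral_distr) auto
  also have "\<dots> = ennreal (c ^ DIM('a)) * (\<integral>\<^sup>+x. f (c *\<^sub>R x) \<partial>lebesgue)"
    using scaling_measurable[OF f] by (rule nn_integral_cmult)
  finally show ?thesis .
qed

lemma integral_scaling:
  fixes f :: "'a::euclidean_space \<Rightarrow> complex"
  assumes f: "f \<in> borel_measurable lebesgue" and c: "c > 0"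
  shows "(\<integral>x. f x \<partial>lebesgue) = complex_of_real (c ^ DIM('a)) * (\<integral>x. f (c *\<^sub>R x) \<partial>lebesgue)"
proof -
  have "(\<integral>x. f x \<partial>lebesgue) = (\<integral>x. f x \<partial>(density (distr lebesgue lebesgue (\<lambda>x. c *\<^sub>R x)) (\<lambda>_. ennreal (c ^ DIM('a)))))"
    using lebesgue_scaling[OF c, where 'a = 'a] by simp
  also have "\<dots> = (\<integral>x. (c ^ DIM('a)) *\<^sub>R f x \<partial>(distr lebesgue lebesgue (\<lambda>x. c *\<^sub>R x)))"
    using f c by (intro integral_density) auto
  also have "\<dots> = (\<integral>x. (c ^ DIM('a)) *\<^sub>R f (c *\<^sub>R x) \<partial>lebesgue)"
    using f by (intro integral_distr) auto
  also have "\<dots> = complex_of_real (c ^ DIM('a)) * (\<integral>x. f (c *\<^sub>R x) \<partial>lebesgue)"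
    by (simp only: scaleR_conv_of_real integral_mult_right_zero)
  finally show ?thesis .
qed

section \<open>Homogeneous nonlinearities\<close>

lemma F_mode_norm: "cmod (F_mode p n z) = cmod z powr p"
proof (cases "z = 0")
  case False
  then have "cmod z powi n = cmod z powr real_of_int n" by (simp add: powr_real_of_int')
  then show ?thesis using False by (simp add: F_mode_def norm_mult norm_power_int powr_add[symmetric])
qed (simp add: F_mode_def)

lemma F_mode_zero [simp]: "F_mode p n 0 = 0"
  by (simp add: F_mode_def)

lemma F_mode_rotate: "F_mode p n (cis \<alpha> * z) = cis (real_of_int n * \<alpha>) * F_mode p n z"
  by (simp add: F_mode_def norm_mult power_int_mult_distrib cis_power_int)

lemma F_mode_0: "F_mode p 0 z = complex_of_real (cmod z powr p)"
  by (simp add: F_mode_def)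

lemma continuous_on_F_mode:
  assumes p: "p > 0"
  shows "continuous_on UNIV (F_mode p n)"
  unfolding continuous_on_eq_continuous_at[OF open_UNIV]
proof
  fix z :: complex
  show "isCont (F_mode p n) z"
  proof (cases "z = 0")
    case True
    have "((\<lambda>w. cmod w powr p) \<longlongrightarrow> 0 powr p) (at 0)"
    proof -
      have "((\<lambda>w::complex. cmod w) \<longlongrightarrow> 0) (at 0)" by (rule tendsto_norm_zero) (rule tendsto_ident_at)
      then show ?thesis using p by (intro tendsto_powr' tendsto_const) auto
    qed
    then have "((\<lambda>w. norm (F_mode p n w)) \<longlongrightarrow> 0) (at 0)" by (simp add: F_mode_norm)
    then show ?thesis using True by (simp add: isCont_def tendsto_norm_zero_iff)
  next
    case False
    then show ?thesis unfolding F_mode_def by (intro continuous_intros) auto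
  qed
qed

text \<open>
  The coefficients are abstracted from the Fourier integrals that define them.
\<close>

locale mode_expansion =
  fixes F :: "complex \<Rightarrow> complex" and p :: real and c :: "int \<Rightarrow> complex"
  assumes p: "p > 0"
    and expansion: "\<And>z. ((\<lambda>n. c n * F_mode p n z) has_sum F z) UNIV"
    and l1: "(\<lambda>n. norm (c n)) summable_on UNIV"
begin

definition coeff_norm :: real where "coeff_norm = (\<Sum>\<^sub>\<infinity>n. norm (c n))"

lemma coeff_norm_nonneg: "0 \<le> coeff_norm"
  unfolding coeff_norm_def by (rule infsum_nonneg) simp

lemma F_le: "cmod (F z) \<le> coeff_norm * cmod z powr p"
proof -
  have "norm (F z) \<le> coeff_norm * cmod z powr p"
  proof (rule norm_infsum_le[OF expansion[of z]])
    have "((\<lambda>n. norm (c n)) has_sum coeff_norm) UNIV" unfolding coeff_norm_def by (rule has_sum_infsum[OF l1])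
    then show "((\<lambda>n. norm (c n) * cmod z powr p) has_sum coeff_norm * cmod z powr p) UNIV" by (rule has_sum_cmult_left)
  qed (simp add: norm_mult F_mode_norm)
  then show ?thesis .
qed

lemma F_zero: "F 0 = 0"
  using F_le[of 0] by simp

text \<open>
  All modes have the same modulus \<open>|z|\<^sup>p\<close>, so that the tail of the coefficient sum controls the tail of
  the expansion uniformly in \<open>z\<close>, relative to \<open>|z|\<^sup>p\<close>.
\<close>

lemma finite_mode_approximation:
  assumes e: "e > 0"
  shows "\<exists>N. finite N \<and> 0 \<in> N \<and> (\<forall>z. cmod (F z - (\<Sum>n\<in>N. c n * F_mode p n z)) \<le> e * cmod z powr p)"
proof -
  have hs: "((\<lambda>n. norm (c n)) has_sum coeff_norm) UNIV" unfolding coeff_norm_def by (rule has_sum_infsum[OF l1])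
  then have "\<forall>\<^sub>F N in finite_subsets_at_top UNIV. dist (\<Sum>n\<in>N. norm (c n)) coeff_norm < e"
    using e unfolding has_sum_def by (intro tendstoD)
  then obtain N0 where "finite N0 \<and> N0 \<subseteq> UNIV \<and> (\<forall>N. finite N \<and> N0 \<subseteq> N \<and> N \<subseteq> UNIV \<longrightarrow> dist (\<Sum>n\<in>N. norm (c n)) coeff_norm < e)"
    unfolding eventually_finite_subsets_at_top by (rule exE)
  then have N0: "finite N0" "\<And>N. finite N \<Longrightarrow> N0 \<subseteq> N \<Longrightarrow> dist (\<Sum>n\<in>N. norm (c n)) coeff_norm < e" by simp_all
  define N where "N = insert 0 N0"
  have N: "finite N" "0 \<in> N" "dist (\<Sum>n\<in>N. norm (c n)) coeff_norm < e"
    using N0(1) N0(2)[of N] by (simp_all add: N_def subset_insertI)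
  have "cmod (F z - (\<Sum>n\<in>N. c n * F_mode p n z)) \<le> e * cmod z powr p" for z
  proof -
    have 1: "((\<lambda>n. c n * F_mode p n z) has_sum (F z - (\<Sum>n\<in>N. c n * F_mode p n z))) (UNIV - N)"
      by (rule has_sum_Diff[OF expansion has_sum_finite[OF N(1)]]) simp
    have 2: "((\<lambda>n. norm (c n)) has_sum (coeff_norm - (\<Sum>n\<in>N. norm (c n)))) (UNIV - N)"
      by (rule has_sum_Diff[OF hs has_sum_finite[OF N(1)]]) simp
    have "norm (F z - (\<Sum>n\<in>N. c n * F_mode p n z)) \<le> (coeff_norm - (\<Sum>n\<in>N. norm (c n))) * cmod z powr p"
      by (rule norm_infsum_le[OF 1 has_sum_cmult_left[OF 2]]) (simp add: norm_mult F_mode_norm)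
    also have "\<dots> \<le> e * cmod z powr p" using N(3) by (intro mult_right_mono) (auto simp: dist_real_def)
    finally show ?thesis .
  qed
  with N show ?thesis by (intro exI[of _ N] conjI allI)
qed

lemma continuous_on_F: "continuous_on UNIV F"
proof -
  have "continuous_on (ball 0 R) F" for R
  proof (rule uniform_limit_theorem)
    show "uniform_limit (ball 0 R) (\<lambda>X z. \<Sum>n\<in>X. c n * F_mode p n z) F (finite_subsets_at_top UNIV)"
    proof (rule Weierstrass_m_test_general')
      show "norm (c n * F_mode p n z) \<le> norm (c n) * R powr p" if "z \<in> ball 0 R" for n z
        using that p by (auto simp: norm_mult F_mode_norm intro!: mult_left_mono powr_mono2)
      show "(\<lambda>n. norm (c n) * R powr p) summable_on UNIV" using l1 by (rule summable_on_cmult_left)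
    qed (rule expansion)
    show "\<forall>\<^sub>F X in finite_subsets_at_top UNIV. continuous_on (ball 0 R) (\<lambda>z. \<Sum>n\<in>X. c n * F_mode p n z)"
      by (intro always_eventually allI continuous_intros continuous_on_subset[OF continuous_on_F_mode[OF p]]) auto
  qed simp
  then have "isCont F z" for z
    using continuous_on_interior[of "ball 0 (norm z + 1)" F z] by (simp add: interior_open)
  then show ?thesis by (simp add: continuous_at_imp_continuous_on)
qed

lemma F_measurable: "F \<in> borel_measurable borel"
  using continuous_on_F by (rule borel_measurable_continuous_onI)

text \<open>
  Absolute summability of the coefficients makes \<open>F\<close> continuous, but not necessarily Lipschitz. By homogeneity it is
  enough to treat \<open>|w| = 1\<close>. There uniform continuity near the unit circle handles \<open>z\<close> close to \<open>w\<close>,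
  and for the other \<open>z\<close> both \<open>|z|\<^sup>p\<close> and \<open>|w|\<^sup>p\<close> are bounded by a multiple of \<open>|z - w|\<^sup>p\<close>.
\<close>

lemma F_difference:
  assumes hom: "homogeneous p F" and e: "e > 0"
  shows "\<exists>C\<ge>0. \<forall>z w. cmod (F z - F w) \<le> e * cmod w powr p + C * cmod (z - w) powr p"
proof -
  have "uniformly_continuous_on (cball 0 2) F"
    by (intro compact_uniformly_continuous continuous_on_subset[OF continuous_on_F]) auto
  then obtain d0 where d0: "d0 > 0" "\<And>x y. x \<in> cball 0 2 \<Longrightarrow> y \<in> cball 0 2 \<Longrightarrow> dist y x < d0 \<Longrightarrow> dist (F y) (F x) < e"
    unfolding uniformly_continuous_on_def using e by meson
  define d where "d = min d0 1"
  have d: "d > 0" "d \<le> 1" "d \<le> d0" using d0 by (auto simp: d_def)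
  define C where "C = coeff_norm * (1/d + 1) powr p + coeff_norm * (1/d) powr p"
  have C: "C \<ge> 0" unfolding C_def using coeff_norm_nonneg by simp
  have unit: "cmod (F z - F w) \<le> e + C * cmod (z - w) powr p" if w: "cmod w = 1" for z w
  proof (cases "cmod (z - w) < d")
    case True
    have "cmod z \<le> cmod (z - w) + cmod w" using norm_triangle_ineq[of "z - w" w] by simp
    then have "z \<in> cball 0 2" "w \<in> cball 0 2" using True w d by auto
    then have "cmod (F z - F w) < e" using d0(2)[of w z] True d by (simp add: dist_norm)
    moreover have "0 \<le> C * cmod (z - w) powr p" using C by simp
    ultimately show ?thesis by linarith
  next
    case False
    let ?x = "cmod (z - w)"
    have x: "?x > 0" "1 \<le> (1/d) * ?x" using False d by (auto simp: field_simps)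
    have "cmod z \<le> ?x + 1" using norm_triangle_ineq[of "z - w" w] w by simp
    also have "\<dots> \<le> (1/d + 1) * ?x" using x by (simp add: algebra_simps)
    finally have "cmod z powr p \<le> ((1/d + 1) * ?x) powr p" using p by (intro powr_mono2) auto
    also have "\<dots> = (1/d + 1) powr p * ?x powr p" using d by (simp add: powr_mult)
    finally have z: "cmod z powr p \<le> (1/d + 1) powr p * ?x powr p" .
    have "1 powr p \<le> ((1/d) * ?x) powr p" using p x by (intro powr_mono2) auto
    also have "\<dots> = (1/d) powr p * ?x powr p" using d by (subst powr_mult) auto
    finally have w1: "cmod w powr p \<le> (1/d) powr p * ?x powr p" using w by simp
    have "cmod (F z - F w) \<le> cmod (F z) + cmod (F w)" by (rule norm_triangle_ineq4)
    also have "\<dots> \<le> coeff_norm * cmod z powr p + coeff_norm * cmod w powr p" by (intro add_mono F_le)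
    also have "\<dots> \<le> coeff_norm * ((1/d + 1) powr p * ?x powr p) + coeff_norm * ((1/d) powr p * ?x powr p)"
      by (intro add_mono mult_left_mono z w1 coeff_norm_nonneg)
    also have "\<dots> = C * ?x powr p" by (simp add: C_def algebra_simps)
    finally show ?thesis using e by simp
  qed
  have "cmod (F z - F w) \<le> e * cmod w powr p + (C + coeff_norm) * cmod (z - w) powr p" for z w
  proof (cases "w = 0")
    case True
    have "cmod (F z - F w) \<le> coeff_norm * cmod z powr p" using F_le[of z] True F_zero by simp
    also have "\<dots> \<le> (C + coeff_norm) * cmod z powr p" using C by (intro mult_right_mono) auto
    finally show ?thesis using True by simp
  next
    case False
    define r where "r = cmod w"
    have r: "r > 0" using False by (simp add: r_def)
    define z' w' where "z' = z / complex_of_real r" and "w' = w / complex_of_real r"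
    have zw: "z = complex_of_real r * z'" "w = complex_of_real r * w'" using r by (auto simp: z'_def w'_def)
    have hF: "F (complex_of_real r * y) = complex_of_real (r powr p) * F y" for y
      using hom r unfolding homogeneous_def by blast
    have "cmod w' = 1" using r by (simp add: w'_def norm_divide r_def)
    have "cmod (F z - F w) = cmod (complex_of_real (r powr p) * (F z' - F w'))"
      unfolding zw hF by (simp only: right_diff_distrib)
    also have "\<dots> = r powr p * cmod (F z' - F w')" by (simp add: norm_mult)
    also have "\<dots> \<le> r powr p * (e + C * cmod (z' - w') powr p)"
      by (intro mult_left_mono unit \<open>cmod w' = 1\<close>) simp
    also have "\<dots> = e * r powr p + C * (r * cmod (z' - w')) powr p"
      using r by (simp add: powr_mult algebra_simps)
    also have "r * cmod (z' - w') = cmod (z - w)"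
      unfolding zw right_diff_distrib[symmetric] using r by (simp add: norm_mult)
    also have "e * r powr p + C * cmod (z - w) powr p \<le> e * cmod w powr p + (C + coeff_norm) * cmod (z - w) powr p"
      unfolding r_def using coeff_norm_nonneg by (intro add_mono mult_right_mono) auto
    finally show ?thesis .
  qed
  then show ?thesis using C coeff_norm_nonneg by (intro exI[of _ "C + coeff_norm"]) auto
qed

end

section \<open>Joint measurability of rescaled functions\<close>

text \<open>
  Lebesgue measurability is preserved by substitutions that pull null sets back to null sets, since then
  a Borel representative of \<open>f\<close> yields one of the composition.
\<close>

lemma measurable_compose_null:
  fixes f :: "'b::euclidean_space \<Rightarrow> complex" and \<tau> :: "'c::euclidean_space \<Rightarrow> 'b"
  assumes f: "f \<in> borel_measurable lebesgue" and \<tau>: "\<tau> \<in> borel_measurable borel" and S: "S \<in> sets borel"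
    and null: "\<And>N. N \<in> null_sets lborel \<Longrightarrow> AE p in lborel. p \<in> S \<longrightarrow> \<tau> p \<notin> N"
  shows "(\<lambda>p. f (\<tau> p)) \<in> borel_measurable (lebesgue_on S)"
proof -
  obtain g where g: "g \<in> borel_measurable borel" "AE x in lborel. f x = g x"
    using lebesgue_borel_representative[OF f] by (rule bexE)
  obtain N where N: "\<And>x. x \<in> space lborel - N \<Longrightarrow> f x = g x" "N \<in> null_sets lborel"
    by (rule AE_E3[OF g(2)]) (rule that)
  have S': "S \<inter> space lebesgue \<in> sets lebesgue" using S by simp
  have "(\<lambda>p. g (\<tau> p)) \<in> borel_measurable borel" using measurable_compose[OF \<tau> g(1)] .
  then have "(\<lambda>p. indicator S p *\<^sub>R g (\<tau> p)) \<in> borel_measurable borel"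
    using S by (intro borel_measurable_scaleR borel_measurable_indicator) simp_all
  then have m: "(\<lambda>p. indicator S p *\<^sub>R g (\<tau> p)) \<in> borel_measurable lebesgue"
    by (rule borel_measurable_imp_lebesgue)
  have "AE p in lborel. indicator S p *\<^sub>R g (\<tau> p) = indicator S p *\<^sub>R f (\<tau> p)"
    using null[OF N(2)]
  proof eventually_elim
    case (elim p)
    show ?case
    proof (cases "p \<in> S")
      case True
      then have "\<tau> p \<notin> N" using elim by simp
      then have "f (\<tau> p) = g (\<tau> p)" using N(1)[of "\<tau> p"] by simp
      then show ?thesis by simp
    qed simp
  qed
  then have "AE p in lebesgue. indicator S p *\<^sub>R g (\<tau> p) = indicator S p *\<^sub>R f (\<tau> p)"
    by (rule AE_completion)
  from borel_measurable_AE[OF m this] show ?thesis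
    using borel_measurable_restrict_space_iff[OF S', of "\<lambda>p. f (\<tau> p)"] by simp
qed

lemma AE_space_time_I:
  assumes P: "{p. \<not> P p} \<in> sets (borel :: (real \<times> 'a::euclidean_space) measure)"
    and ae: "\<And>s. AE x in lborel. P (s, x)"
  shows "AE p in (lborel :: (real \<times> 'a) measure). P p"
proof -
  have P': "{p. P p} \<in> sets (borel :: (real \<times> 'a) measure)"
  proof -
    have "{p. P p} = space borel - {p. \<not> P p}" by auto
    then show ?thesis using sets.compl_sets[OF P] by simp
  qed
  have s: "sets (lborel \<Otimes>\<^sub>M lborel) = sets (borel :: (real \<times> 'a) measure)"
    by (simp only: lborel_prod sets_lborel)
  have "AE p in (lborel :: real measure) \<Otimes>\<^sub>M (lborel :: 'a measure). P p"
  proof (rule lborel_pair.AE_pair_measure)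
    show "{p \<in> space (lborel \<Otimes>\<^sub>M lborel). P p} \<in> sets ((lborel :: real measure) \<Otimes>\<^sub>M (lborel :: 'a measure))"
      unfolding s using P' by (simp add: space_pair_measure)
    show "AE s in lborel. AE x in lborel. P (s, x)" using ae by simp
  qed
  then show ?thesis by (simp only: lborel_prod)
qed

lemma space_time_null_slices:
  assumes "N \<in> null_sets (lborel :: (real \<times> 'a::euclidean_space) measure)"
  shows "AE s in lborel. AE x in lborel. (s, x) \<notin> N"
proof -
  have "AE p in (lborel :: (real \<times> 'a) measure). p \<notin> N" using assms by (rule AE_not_in)
  then have "AE p in (lborel :: real measure) \<Otimes>\<^sub>M (lborel :: 'a measure). p \<notin> N" by (simp only: lborel_prod)
  then show ?thesis by (rule lborel_pair.AE_pair)
qed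

lemma AE_lborel_scaling:
  assumes c: "c > 0" and Q: "{x. Q x} \<in> sets (borel :: 'a::euclidean_space measure)" and ae: "AE x in lborel. Q (x :: 'a)"
  shows "AE x in lborel. Q (c *\<^sub>R x)"
proof -
  have eq: "(lborel :: 'a measure) = density (distr lborel borel (\<lambda>x. 0 + c *\<^sub>R x)) (\<lambda>_. ennreal (\<bar>c\<bar> ^ DIM('a)))"
    using c by (intro lborel_affine) simp
  have "AE x in density (distr lborel borel (\<lambda>x::'a. 0 + c *\<^sub>R x)) (\<lambda>_. ennreal (\<bar>c\<bar> ^ DIM('a))). Q x"
    using ae by (subst eq[symmetric])
  then have "AE x in distr lborel borel (\<lambda>x::'a. 0 + c *\<^sub>R x). Q x"
    using c by (simp add: AE_density)
  then show ?thesis using Q by (subst (asm) AE_distr_iff) auto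
qed

lemma space_time_measurable_space_component:
  fixes f :: "'a::euclidean_space \<Rightarrow> complex"
  assumes f: "f \<in> borel_measurable lebesgue"
  shows "(\<lambda>p. f (snd p)) \<in> borel_measurable (lebesgue :: (real \<times> 'a) measure)"
proof -
  have "(\<lambda>p::real \<times> 'a. f (snd p)) \<in> borel_measurable (lebesgue_on UNIV)"
  proof (rule measurable_compose_null[OF f])
    show sm: "snd \<in> borel_measurable (borel :: (real \<times> 'a) measure)"
      by (intro borel_measurable_continuous_onI continuous_intros)
    fix N :: "'a set" assume N: "N \<in> null_sets lborel"
    have "{p::real \<times> 'a. \<not> snd p \<notin> N} = snd -` N \<inter> space borel" by auto
    then have m: "{p::real \<times> 'a. \<not> snd p \<notin> N} \<in> sets borel"
      using measurable_sets[OF sm] N by (auto simp: null_sets_def)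
    have "AE p in lborel. snd (p :: real \<times> 'a) \<notin> N"
      by (rule AE_space_time_I[OF m]) (simp add: AE_not_in N)
    then show "AE p in lborel. (p :: real \<times> 'a) \<in> UNIV \<longrightarrow> snd p \<notin> N" by simp
  qed simp
  then show ?thesis by (simp add: lebesgue_on_UNIV_eq)
qed

text \<open>
  The map \<open>(s, x) \<mapsto> (s, x / (2s))\<close> acts on each time slice as a dilation, and by Fubini a set is null
  precisely when almost all its slices are null.
\<close>

lemma space_time_measurable_rescaled:
  fixes f :: "real \<times> 'a::euclidean_space \<Rightarrow> complex"
  assumes f: "f \<in> borel_measurable (lebesgue_on ({0<..} \<times> UNIV))"
  shows "(\<lambda>(s, x). f (s, x /\<^sub>R (2 * s))) \<in> borel_measurable (lebesgue_on ({0<..} \<times> UNIV))"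
proof -
  let ?S = "{0<..} \<times> UNIV :: (real \<times> 'a) set"
  have Sb: "?S \<in> sets (borel :: (real \<times> 'a) measure)"
    by (intro borel_open open_Times) auto
  have "?S \<in> sets lebesgue" by (rule sets_completionI_sets) (simp only: sets_lborel Sb)
  then have S': "?S \<inter> space lebesgue \<in> sets lebesgue" by simp
  define f0 where "f0 p = indicator ?S p *\<^sub>R f p" for p
  have f0: "f0 \<in> borel_measurable lebesgue"
    unfolding f0_def using f borel_measurable_restrict_space_iff[OF S', of f] by simp
  define \<tau> where "\<tau> p = (fst p, (inverse (2 * fst p)) *\<^sub>R snd p)" for p :: "real \<times> 'a"
  have \<tau>m: "\<tau> \<in> borel_measurable borel"
  proof -
    have [measurable]: "fst \<in> borel_measurable (borel :: (real \<times> 'a) measure)" "snd \<in> borel_measurable (borel :: (real \<times> 'a) measure)"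
      by (intro borel_measurable_continuous_onI continuous_intros)+
    show ?thesis unfolding \<tau>_def by measurable
  qed
  have "(\<lambda>p. f0 (\<tau> p)) \<in> borel_measurable (lebesgue_on ?S)"
  proof (rule measurable_compose_null[OF f0 \<tau>m Sb])
    fix N :: "(real \<times> 'a) set" assume N: "N \<in> null_sets lborel"
    have Nb: "N \<in> sets borel" using N by (auto simp: null_sets_def)
    obtain B where B2: "\<And>s. s \<in> space lborel - B \<Longrightarrow> AE x in lborel. (s, x) \<notin> N"
      and B: "B \<in> null_sets lborel"
      by (rule AE_E3[OF space_time_null_slices[OF N]]) (rule that)
    have m: "{p. \<not> (p \<in> ?S \<and> fst p \<notin> B \<longrightarrow> \<tau> p \<notin> N)} \<in> sets borel"
    proof -
      have "fst -` B \<inter> space borel \<in> sets (borel :: (real \<times> 'a) measure)"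
        by (rule measurable_sets[of fst borel borel])
           (use B in \<open>auto simp: null_sets_def intro!: borel_measurable_continuous_onI continuous_intros\<close>)
      then have "?S \<inter> (space borel - fst -` B \<inter> space borel) \<inter> (\<tau> -` N \<inter> space borel) \<in> sets borel"
        by (intro sets.Int sets.Diff Sb measurable_sets[OF \<tau>m Nb]) auto
      moreover have "{p. \<not> (p \<in> ?S \<and> fst p \<notin> B \<longrightarrow> \<tau> p \<notin> N)} = ?S \<inter> (space borel - fst -` B \<inter> space borel) \<inter> (\<tau> -` N \<inter> space borel)"
        by auto
      ultimately show ?thesis by simp
    qed
    have 1: "AE p in lborel. p \<in> ?S \<and> fst p \<notin> B \<longrightarrow> \<tau> p \<notin> N"
    proof (rule AE_space_time_I[OF m])
      fix s :: real
      show "AE x in lborel. (s, x) \<in> ?S \<and> fst (s, x) \<notin> B \<longrightarrow> \<tau> (s, x) \<notin> N"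
      proof (cases "s > 0 \<and> s \<notin> B")
        case True
        then have ae: "AE x in lborel. (s, x) \<notin> N" using B2[of s] by simp
        have "{x. (s, x) \<notin> N} \<in> sets (borel :: 'a measure)"
        proof -
          have "Pair s -` (- N) \<inter> space borel \<in> sets (borel :: 'a measure)"
            by (rule measurable_sets[of _ borel borel])
               (use Nb in \<open>auto intro!: borel_measurable_continuous_onI continuous_intros\<close>)
          then show ?thesis by (simp add: vimage_def)
        qed
        from AE_lborel_scaling[OF _ this ae, of "inverse (2 * s)"] True show ?thesis
          by (simp add: \<tau>_def)
      qed auto
    qed
    have 2: "AE p in (lborel :: (real \<times> 'a) measure). fst p \<notin> B"
    proof -
      have Bs: "B \<in> sets lborel" and B0: "emeasure lborel B = 0" using B by (auto simp only: null_sets_def)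
      have "B \<times> (UNIV :: 'a set) \<in> null_sets (lborel \<Otimes>\<^sub>M lborel)"
      proof (rule null_setsI)
        show "emeasure (lborel \<Otimes>\<^sub>M lborel) (B \<times> (UNIV :: 'a set)) = 0"
          using Bs B0 by (subst lborel.emeasure_pair_measure_Times) auto
        show "B \<times> (UNIV :: 'a set) \<in> sets (lborel \<Otimes>\<^sub>M lborel)"
          using Bs by (intro pair_measureI) auto
      qed
      then have "B \<times> (UNIV :: 'a set) \<in> null_sets lborel" by (simp only: lborel_prod)
      from AE_not_in[OF this] show ?thesis by eventually_elim (auto simp: mem_Times_iff)
    qed
    show "AE p in lborel. p \<in> ?S \<longrightarrow> \<tau> p \<notin> N"
      using 1 2 by eventually_elim simp
  qed
  moreover have "f0 (\<tau> p) = (case p of (s, x) \<Rightarrow> f (s, x /\<^sub>R (2 * s)))" if "p \<in> ?S" for p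
    using that by (auto simp: f0_def \<tau>_def split: prod.split)
  ultimately show ?thesis
    by (subst measurable_cong[where g = "\<lambda>p. f0 (\<tau> p)"]) (auto simp: space_restrict_space)
qed

section \<open>The error terms at a fixed time\<close>

abbreviation tested :: "real \<Rightarrow> (real^'n \<Rightarrow> complex) \<Rightarrow> complex" where
  "tested t f \<equiv> \<integral>x. f x * complex_of_real (test_fun t x) \<partial>lebesgue"

abbreviation nn_power :: "real \<Rightarrow> (real^'n \<Rightarrow> complex) \<Rightarrow> ennreal" where
  "nn_power r f \<equiv> \<integral>\<^sup>+x. ennreal (cmod (f x) powr r) \<partial>lebesgue"

lemma test_fun_L2:
  assumes "t > 0"
  shows "(\<lambda>x::real^'n. complex_of_real (test_fun t x)) \<in> L2"
    and "(l2 (\<lambda>x::real^'n. complex_of_real (test_fun t x)))\<^sup>2 = pi powr (real CARD('n) / 2)"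
proof -
  have eq: "(\<lambda>x::real^'n. complex_of_real (test_fun t x))
    = (\<lambda>x. complex_of_real (t powr (- real CARD('n) / 2)) * complex_of_real (gauss (1 / (2 * t\<^sup>2)) x))"
    by (simp add: test_fun_def)
  show "(\<lambda>x::real^'n. complex_of_real (test_fun t x)) \<in> L2"
    unfolding eq using assms by (intro L2_mult_left gaussian_L2) simp
  have sq: "(cmod (complex_of_real (test_fun t x)))\<^sup>2 = t powr (- real CARD('n)) * gauss (1 / t\<^sup>2) x" for x :: "real^'n"
  proof -
    have "(t powr (- real CARD('n) / 2))\<^sup>2 = t powr (- real CARD('n))"
      by (simp add: power2_eq_square powr_add[symmetric])
    moreover have "(gauss (1 / (2 * t\<^sup>2)) x)\<^sup>2 = gauss (1 / t\<^sup>2) x"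
      unfolding exp_double[symmetric] by simp
    ultimately show ?thesis
      by (simp only: norm_of_real power2_abs test_fun_def power_mult_distrib)
  qed
  have "(\<integral>x. (cmod (complex_of_real (test_fun t x)))\<^sup>2 \<partial>(lebesgue :: (real^'n) measure)) = t powr (- real CARD('n)) * (\<integral>x. gauss (1 / t\<^sup>2) x \<partial>(lebesgue :: (real^'n) measure))"
    unfolding sq by (rule integral_mult_right_zero)
  also have "(\<integral>x. gauss (1 / t\<^sup>2) x \<partial>(lebesgue :: (real^'n) measure)) = (pi / (1 / t\<^sup>2)) powr (real CARD('n) / 2)"
    using gaussian_integral(2)[of "1 / t\<^sup>2", where 'a = "real^'n"] assms
    by (subst integral_lebesgue_eq_lborel) simp_all
  also have "pi / (1 / t\<^sup>2) = pi * t powr 2" using assms by simp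
  also have "(pi * t powr 2) powr (real CARD('n) / 2) = pi powr (real CARD('n) / 2) * (t powr 2) powr (real CARD('n) / 2)"
    by (rule powr_mult)
  also have "(t powr 2) powr (real CARD('n) / 2) = t powr (real CARD('n))" by (simp add: powr_powr)
  also have "t powr (- real CARD('n)) * (pi powr (real CARD('n) / 2) * t powr (real CARD('n))) = pi powr (real CARD('n) / 2) * (t powr (- real CARD('n)) * t powr (real CARD('n)))"
    by simp
  also have "t powr (- real CARD('n)) * t powr (real CARD('n)) = 1" using assms by (simp add: powr_add[symmetric])
  finally show "(l2 (\<lambda>x::real^'n. complex_of_real (test_fun t x)))\<^sup>2 = pi powr (real CARD('n) / 2)"
    by (simp add: l2_power2)
qed

lemma powr_add_le:
  fixes x y r :: real
  assumes "0 \<le> x" "0 \<le> y" "0 \<le> r"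
  shows "(x + y) powr r \<le> 2 powr r * (x powr r + y powr r)"
proof -
  have "(x + y) powr r \<le> (2 * max x y) powr r" using assms by (intro powr_mono2) auto
  also have "\<dots> = 2 powr r * max x y powr r" by (rule powr_mult)
  also have "max x y powr r \<le> x powr r + y powr r" by (auto simp: max_def)
  finally show ?thesis by simp
qed

context mode_expansion begin

lemma F_compose_L2:
  fixes f :: "'a::euclidean_space \<Rightarrow> complex"
  assumes f: "f \<in> borel_measurable lebesgue" and i: "integrable lebesgue (\<lambda>x. cmod (f x) powr (2 * p))"
  shows "(\<lambda>x. F (f x)) \<in> L2" and "(l2 (\<lambda>x. F (f x)))\<^sup>2 \<le> coeff_norm\<^sup>2 * (\<integral>x. cmod (f x) powr (2 * p) \<partial>lebesgue)"
proof -
  have m: "(\<lambda>x. F (f x)) \<in> borel_measurable lebesgue" by (rule measurable_compose[OF f F_measurable])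
  have le: "(cmod (F (f x)))\<^sup>2 \<le> coeff_norm\<^sup>2 * cmod (f x) powr (2 * p)" for x
  proof -
    have "(cmod (F (f x)))\<^sup>2 \<le> (coeff_norm * cmod (f x) powr p)\<^sup>2" by (intro power_mono F_le) simp
    also have "\<dots> = coeff_norm\<^sup>2 * cmod (f x) powr (2 * p)"
      by (simp add: power_mult_distrib power2_eq_square powr_add[symmetric])
    finally show ?thesis .
  qed
  have bi: "integrable lebesgue (\<lambda>x. coeff_norm\<^sup>2 * cmod (f x) powr (2 * p))" using i by simp
  have Fi: "integrable lebesgue (\<lambda>x. (cmod (F (f x)))\<^sup>2)"
  proof (rule Bochner_Integration.integrable_bound[OF bi])
    show "(\<lambda>x. (cmod (F (f x)))\<^sup>2) \<in> borel_measurable lebesgue" using m by measurable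
    show "AE x in lebesgue. norm ((cmod (F (f x)))\<^sup>2) \<le> norm (coeff_norm\<^sup>2 * cmod (f x) powr (2 * p))"
      using le by (intro AE_I2) simp
  qed
  show "(\<lambda>x. F (f x)) \<in> L2" using m Fi by (simp add: L2_iff)
  have "(l2 (\<lambda>x. F (f x)))\<^sup>2 \<le> (\<integral>x. coeff_norm\<^sup>2 * cmod (f x) powr (2 * p) \<partial>lebesgue)"
    unfolding l2_power2 by (rule integral_mono[OF Fi bi le])
  then show "(l2 (\<lambda>x. F (f x)))\<^sup>2 \<le> coeff_norm\<^sup>2 * (\<integral>x. cmod (f x) powr (2 * p) \<partial>lebesgue)" by simp
qed

text \<open>
  Each of the two terms of the difference bound is split from \<open>h\<close> by the weighted inequality between the
  arithmetic and the geometric mean. The weights \<open>\<alpha>\<close> and \<open>\<beta>\<close> stay free because they are later chosen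
  proportional to the time.
\<close>

lemma F_difference_pairing:
  fixes f g h :: "'a::euclidean_space \<Rightarrow> complex"
  assumes fm: "f \<in> borel_measurable lebesgue" and gm: "g \<in> borel_measurable lebesgue" and h: "h \<in> L2"
    and fi: "integrable lebesgue (\<lambda>x. cmod (f x) powr (2 * p))"
    and gi: "integrable lebesgue (\<lambda>x. cmod (g x) powr (2 * p))"
    and di: "integrable lebesgue (\<lambda>x. cmod (f x - g x) powr (2 * p))"
    and C: "0 \<le> C" "0 \<le> e" "\<And>z w. cmod (F z - F w) \<le> e * cmod w powr p + C * cmod (z - w) powr p"
    and ab: "\<alpha> > 0" "\<beta> > 0"
  shows "cmod ((\<integral>x. F (f x) * h x \<partial>lebesgue) - (\<integral>x. F (g x) * h x \<partial>lebesgue))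
     \<le> e / 2 * (\<alpha> * (\<integral>x. cmod (g x) powr (2 * p) \<partial>lebesgue) + (l2 h)\<^sup>2 / \<alpha>)
       + C / 2 * (\<beta> * (\<integral>x. cmod (f x - g x) powr (2 * p) \<partial>lebesgue) + (l2 h)\<^sup>2 / \<beta>)"
proof -
  note FL2 = F_compose_L2(1)[OF fm fi] F_compose_L2(1)[OF gm gi]
  have amgm: "y * z \<le> (c * y\<^sup>2 + z\<^sup>2 / c) / 2" if "c > 0" for y z c :: real
  proof -
    have "0 \<le> (c * y - z)\<^sup>2 / c" using that by simp
    also have "(c * y - z)\<^sup>2 / c = c * y\<^sup>2 + z\<^sup>2 / c - 2 * (y * z)"
      using that by (simp add: power2_eq_square field_simps)
    finally show ?thesis by simp
  qed
  have sq: "(y powr p)\<^sup>2 = y powr (2 * p)" for y :: real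
    by (simp add: power2_eq_square powr_add[symmetric])
  have hi: "integrable lebesgue (\<lambda>x. (cmod (h x))\<^sup>2)" using h by (simp add: L2_iff)
  have lin: "(\<integral>x. k1 * (\<alpha> * G x + H x / \<alpha>) + k2 * (\<beta> * D x + H x / \<beta>) \<partial>lebesgue)
     = k1 * (\<alpha> * integral\<^sup>L lebesgue G + integral\<^sup>L lebesgue H / \<alpha>) + k2 * (\<beta> * integral\<^sup>L lebesgue D + integral\<^sup>L lebesgue H / \<beta>)"
    if [simp]: "integrable lebesgue G" "integrable lebesgue H" "integrable lebesgue D"
    for G H D :: "'a \<Rightarrow> real" and k1 k2
    by simp
  have le: "cmod ((F (f x) - F (g x)) * h x)
     \<le> e / 2 * (\<alpha> * cmod (g x) powr (2 * p) + (cmod (h x))\<^sup>2 / \<alpha>)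
      + C / 2 * (\<beta> * cmod (f x - g x) powr (2 * p) + (cmod (h x))\<^sup>2 / \<beta>)" for x
  proof -
    have "cmod ((F (f x) - F (g x)) * h x) \<le> (e * cmod (g x) powr p + C * cmod (f x - g x) powr p) * cmod (h x)"
      unfolding norm_mult by (intro mult_right_mono C) simp
    also have "\<dots> = e * (cmod (g x) powr p * cmod (h x)) + C * (cmod (f x - g x) powr p * cmod (h x))"
      by (simp add: algebra_simps)
    also have "\<dots> \<le> e * ((\<alpha> * (cmod (g x) powr p)\<^sup>2 + (cmod (h x))\<^sup>2 / \<alpha>) / 2)
        + C * ((\<beta> * (cmod (f x - g x) powr p)\<^sup>2 + (cmod (h x))\<^sup>2 / \<beta>) / 2)"
      by (intro add_mono mult_left_mono amgm ab C)
    finally show ?thesis by (simp add: sq)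
  qed
  have "(\<integral>x. F (f x) * h x \<partial>lebesgue) - (\<integral>x. F (g x) * h x \<partial>lebesgue) = (\<integral>x. (F (f x) - F (g x)) * h x \<partial>lebesgue)"
    using L2_product_integrable[OF FL2(1) h] L2_product_integrable[OF FL2(2) h]
    by (simp add: left_diff_distrib)
  also have "cmod \<dots> \<le> (\<integral>x. e / 2 * (\<alpha> * cmod (g x) powr (2 * p) + (cmod (h x))\<^sup>2 / \<alpha>)
      + C / 2 * (\<beta> * cmod (f x - g x) powr (2 * p) + (cmod (h x))\<^sup>2 / \<beta>) \<partial>lebesgue)"
  proof (rule Bochner_Integration.integral_norm_bound_integral)
    show "integrable lebesgue (\<lambda>x. (F (f x) - F (g x)) * h x)"
      by (intro L2_product_integrable L2_diff FL2 h)
    show "integrable lebesgue (\<lambda>x. e / 2 * (\<alpha> * cmod (g x) powr (2 * p) + (cmod (h x))\<^sup>2 / \<alpha>)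
      + C / 2 * (\<beta> * cmod (f x - g x) powr (2 * p) + (cmod (h x))\<^sup>2 / \<beta>))"
      using gi di hi by (intro Bochner_Integration.integrable_add integrable_mult_right integrable_divide_zero) auto
  qed (rule le)
  also have "\<dots> = e / 2 * (\<alpha> * (\<integral>x. cmod (g x) powr (2 * p) \<partial>lebesgue) + (l2 h)\<^sup>2 / \<alpha>)
       + C / 2 * (\<beta> * (\<integral>x. cmod (f x - g x) powr (2 * p) \<partial>lebesgue) + (l2 h)\<^sup>2 / \<beta>)"
    unfolding l2_power2 by (rule lin[OF gi hi di])
  finally show ?thesis .
qed

end

section \<open>Solutions asymptotic to a profile\<close>

text \<open>
  The hypotheses of the theorem for an abstract square integrable profile \<open>v\<close>, with separate names for
  the exponents \<open>p\<close> and \<open>q\<close>.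
\<close>

locale critical_profile = mode_expansion F p c
  for F :: "complex \<Rightarrow> complex" and p :: real and c :: "int \<Rightarrow> complex" +
  fixes d q :: real
    and \<phi> :: "real \<Rightarrow> real^'n \<Rightarrow> real"
    and a b T :: real
    and u :: "real \<Rightarrow> real^'n \<Rightarrow> complex"
    and v :: "real^'n \<Rightarrow> complex"
  assumes d: "d = real CARD('n)" and p_eq: "p = 1 + 2 / d" and q_eq: "q = 2 * p"
    and hom: "homogeneous p F"
    and c0: "c 0 = 1"
    and phi_joint: "(\<lambda>(t, x). \<phi> t x) \<in> borel_measurable (lebesgue_on ({0<..} \<times> UNIV))"
    and phi_slice: "\<And>t. t > 0 \<Longrightarrow> \<phi> t \<in> borel_measurable lebesgue"
    and ab: "0 < a" "a < b"
    and weak_limit: "\<And>f g \<sigma> n. f \<in> L2 \<Longrightarrow> g \<in> L2 \<Longrightarrow> \<sigma> \<in> {a..b} \<Longrightarrow> n \<noteq> (0::int) \<Longrightarrow>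
      ((\<lambda>t. L2_inner
              (\<lambda>x. cis (real_of_int n * (\<sigma> * t * (norm x)\<^sup>2 + \<phi> (\<sigma> * t) x)) * f x) g)
         \<longlongrightarrow> 0) at_top"
    and solution: "is_solution F {T..} u"
    and v: "v \<in> L2"
    and limit_L2: "((\<lambda>t. L2_norm (\<lambda>x. u t x - V_profile \<phi> v t x)) \<longlongrightarrow> 0) at_top"
    and limit_Lq: "((\<lambda>t. ennreal (t powr (1 / q)) *
        Lp_norm q ({t..} \<times> UNIV) (\<lambda>(s, x). u s x - V_profile \<phi> v s x)) \<longlongrightarrow> 0) at_top"
begin

abbreviation V :: "real \<Rightarrow> real^'n \<Rightarrow> complex" where "V \<equiv> V_profile \<phi> v"

definition W :: "real^'n \<Rightarrow> complex" where "W = fourier v"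

text \<open>
  The profile in the variable \<open>\<xi> = x / (2s)\<close>, without the dispersive factor \<open>(2s)\<^sup>-\<^sup>d\<^sup>/\<^sup>2\<close>.
\<close>

definition Z :: "real \<Rightarrow> real^'n \<Rightarrow> complex" where
  "Z s \<xi> = cis (- (pi / 4) * d) * (cis (s * (norm \<xi>)\<^sup>2 + \<phi> s \<xi>) * W \<xi>)"

text \<open>
  The test function at time \<open>t\<close>, seen in the variable \<open>\<xi> = x / (2s)\<close> for \<open>s = \<sigma>t\<close>, up to normalisation.
\<close>

definition \<gamma> :: "real \<Rightarrow> real^'n \<Rightarrow> complex" where
  "\<gamma> \<sigma> \<xi> = complex_of_real (gauss (2 * \<sigma>\<^sup>2) \<xi>)"

abbreviation weighted :: "real \<Rightarrow> (real^'n \<Rightarrow> complex) \<Rightarrow> complex" where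
  "weighted \<sigma> f \<equiv> \<integral>\<xi>. f \<xi> * \<gamma> \<sigma> \<xi> \<partial>lebesgue"

lemma d_pos: "d \<ge> 1" "d > 0"
proof -
  have "1 \<le> CARD('n)" by (simp add: Suc_leI)
  then show "d \<ge> 1" unfolding d by simp
  then show "d > 0" by simp
qed

lemma dp: "d * p = d + 2"
  using d_pos by (simp add: p_eq field_simps)

lemma W_L2: "W \<in> L2"
  unfolding W_def fourier_def by (rule fourier_limit_L2[OF v]) simp

lemma W_measurable: "W \<in> borel_measurable lebesgue"
  by (rule L2_measurable[OF W_L2])

lemma \<gamma>_L2: "\<sigma> > 0 \<Longrightarrow> \<gamma> \<sigma> \<in> L2"
  unfolding \<gamma>_def[abs_def] by (rule gaussian_L2) simp

lemma cmod_Z: "cmod (Z s \<xi>) = cmod (W \<xi>)"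
  by (simp add: Z_def norm_mult)

lemma V_scaled:
  assumes s: "s > 0"
  shows "V s ((2 * s) *\<^sub>R \<xi>) = complex_of_real ((2 * s) powr (- d / 2)) * Z s \<xi>"
proof -
  have 1: "((2 * s) *\<^sub>R \<xi>) /\<^sub>R (2 * s) = \<xi>" using s by simp
  have 2: "(norm ((2 * s) *\<^sub>R \<xi>))\<^sup>2 / (4 * s) = s * (norm \<xi>)\<^sup>2"
    using s by (simp add: power_mult_distrib power2_eq_square)
  have 3: "cis (s * (norm \<xi>)\<^sup>2) * cis (\<phi> s \<xi>) = cis (s * (norm \<xi>)\<^sup>2 + \<phi> s \<xi>)" by (rule cis_mult)
  show ?thesis
    unfolding V_profile_def M_op_def D_op_def d[symmetric] 1 2 Z_def W_def 3[symmetric]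
    by (simp only: mult_ac)
qed

lemma V_eq:
  assumes s: "s > 0"
  shows "V s x = complex_of_real ((2 * s) powr (- d / 2)) * Z s (inverse (2 * s) *\<^sub>R x)"
  using V_scaled[OF s, of "inverse (2 * s) *\<^sub>R x"] s by simp

lemma Z_measurable:
  assumes s: "s > 0"
  shows "Z s \<in> borel_measurable lebesgue"
proof -
  have n: "(\<lambda>\<xi>::real^'n. s * (norm \<xi>)\<^sup>2) \<in> borel_measurable lebesgue"
    by (rule borel_measurable_imp_lebesgue) measurable
  show ?thesis unfolding Z_def
    by (intro borel_measurable_times borel_measurable_const borel_measurable_cis borel_measurable_add n phi_slice s W_measurable)
qed

lemma V_measurable:
  assumes s: "s > 0"
  shows "V s \<in> borel_measurable lebesgue"
proof -
  have "(\<lambda>x. complex_of_real ((2 * s) powr (- d / 2)) * Z s (inverse (2 * s) *\<^sub>R x)) \<in> borel_measurable lebesgue"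
    by (intro borel_measurable_times borel_measurable_const scaling_measurable Z_measurable s)
  moreover have "V s = (\<lambda>x. complex_of_real ((2 * s) powr (- d / 2)) * Z s (inverse (2 * s) *\<^sub>R x))"
    by (rule ext) (rule V_eq[OF s])
  ultimately show ?thesis by (simp only:)
qed

lemma V_nn_integral_power:
  assumes s: "s > 0" and r: "r \<ge> 0"
  shows "nn_power r (V s)
    = ennreal ((2 * s) powr (d - d * r / 2)) * nn_power r W"
proof -
  have m: "(\<lambda>x. ennreal (cmod (V s x) powr r)) \<in> borel_measurable lebesgue"
    using V_measurable[OF s] by measurable
  have mW: "(\<lambda>x. ennreal (cmod (W x) powr r)) \<in> borel_measurable lebesgue"
    using W_measurable by measurable
  have "cmod (V s ((2 * s) *\<^sub>R x)) powr r = (2 * s) powr (- d * r / 2) * cmod (W x) powr r" for x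
    unfolding V_scaled[OF s] by (simp add: norm_mult cmod_Z powr_mult powr_powr)
  then have "nn_power r (V s)
    = ennreal ((2 * s) ^ CARD('n)) * (\<integral>\<^sup>+x. ennreal ((2 * s) powr (- d * r / 2)) * ennreal (cmod (W x) powr r) \<partial>lebesgue)"
    using nn_integral_scaling[OF m, of "2 * s"] s by (simp add: ennreal_mult)
  also have "\<dots> = ennreal ((2 * s) ^ CARD('n) * (2 * s) powr (- d * r / 2)) * nn_power r W"
    using mW s by (simp add: nn_integral_cmult ennreal_mult mult.assoc)
  also have "(2 * s) ^ CARD('n) * (2 * s) powr (- d * r / 2) = (2 * s) powr (d - d * r / 2)"
  proof -
    have "(2 * s) ^ CARD('n) = (2 * s) powr d"
      unfolding d by (rule powr_realpow[symmetric]) (use s in simp)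
    then show ?thesis by (simp only: powr_add[symmetric]) simp
  qed
  finally show ?thesis .
qed

lemma V_L2:
  assumes s: "s > 0"
  shows "V s \<in> L2" "l2 (V s) = l2 W"
proof -
  have "nn_power 2 (V s) = nn_power 2 W"
    using V_nn_integral_power[OF s, of 2] s by simp
  then have eq: "L2_norm (V s) = L2_norm W"
    by (simp add: Lp_norm_def lebesgue_on_UNIV_eq)
  have "L2_norm W < \<infinity>" using W_L2 by (simp add: Lp_def)
  then show VL2: "V s \<in> L2"
    using V_measurable[OF s] eq by (simp add: Lp_def lebesgue_on_UNIV_eq)
  have "ennreal (l2 (V s)) = ennreal (l2 W)"
    using eq L2_norm_eq_l2[OF VL2] L2_norm_eq_l2[OF W_L2] by simp
  then show "l2 (V s) = l2 W" by simp
qed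

lemma H_joint_measurable:
  "(\<lambda>(s, \<xi>). cis (\<phi> s \<xi>) * W \<xi>) \<in> borel_measurable (lebesgue_on ({0<..} \<times> UNIV))"
proof -
  have 1: "(\<lambda>p. cis (case p of (s, \<xi>) \<Rightarrow> \<phi> s \<xi>)) \<in> borel_measurable (lebesgue_on ({0<..} \<times> UNIV))"
    by (intro borel_measurable_cis phi_joint)
  have 2: "(\<lambda>p::real \<times> (real^'n). W (snd p)) \<in> borel_measurable (lebesgue_on ({0<..} \<times> UNIV))"
    by (rule measurable_restrict_space1[OF space_time_measurable_space_component[OF W_measurable]])
  have "(\<lambda>p. cis (case p of (s, \<xi>) \<Rightarrow> \<phi> s \<xi>) * W (snd p)) \<in> borel_measurable (lebesgue_on ({0<..} \<times> UNIV))"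
    by (intro borel_measurable_times 1 2)
  then show ?thesis by (simp add: case_prod_unfold)
qed

lemma borel_space_time:
  assumes "f \<in> borel_measurable (borel :: (real \<times> (real^'n)) measure)"
  shows "f \<in> borel_measurable (lebesgue_on A)"
  by (rule measurable_restrict_space1[OF borel_measurable_imp_lebesgue[OF assms]])

lemma fst_snd_borel [measurable]:
  "fst \<in> borel_measurable (borel :: (real \<times> (real^'n)) measure)"
  "snd \<in> borel_measurable (borel :: (real \<times> (real^'n)) measure)"
  by (intro borel_measurable_continuous_onI continuous_intros)+

lemma Z_joint_measurable:
  "(\<lambda>(s, \<xi>). Z s \<xi>) \<in> borel_measurable (lebesgue_on ({0<..} \<times> UNIV))"
proof -
  have 1: "(\<lambda>p::real \<times> (real^'n). cis (- (pi / 4) * d) * cis (fst p * (norm (snd p))\<^sup>2)) \<in> borel_measurable (lebesgue_on ({0<..} \<times> UNIV))"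
    by (rule borel_space_time) measurable
  have eq: "(\<lambda>(s, \<xi>). Z s \<xi>) = (\<lambda>p. (cis (- (pi / 4) * d) * cis (fst p * (norm (snd p))\<^sup>2)) * (case p of (s, \<xi>) \<Rightarrow> cis (\<phi> s \<xi>) * W \<xi>))"
    by (rule ext) (simp add: Z_def case_prod_unfold mult.assoc cis_mult[symmetric])
  show ?thesis unfolding eq by (rule borel_measurable_times[OF 1 H_joint_measurable])
qed

lemma V_joint_measurable:
  "(\<lambda>(s, x). V s x) \<in> borel_measurable (lebesgue_on ({0<..} \<times> UNIV))"
proof -
  have 1: "(\<lambda>p::real \<times> (real^'n). cis (- (pi / 4) * d) * cis ((norm (snd p))\<^sup>2 / (4 * fst p)) * complex_of_real ((2 * fst p) powr (- d / 2)))
     \<in> borel_measurable (lebesgue_on ({0<..} \<times> UNIV))"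
    by (rule borel_space_time) measurable
  have eq: "(\<lambda>(s, x). V s x) = (\<lambda>p. (cis (- (pi / 4) * d) * cis ((norm (snd p))\<^sup>2 / (4 * fst p)) * complex_of_real ((2 * fst p) powr (- d / 2)))
     * (case p of (s, x) \<Rightarrow> (\<lambda>(s, \<xi>). cis (\<phi> s \<xi>) * W \<xi>) (s, x /\<^sub>R (2 * s))))"
    by (rule ext) (simp add: V_profile_def M_op_def D_op_def W_def d case_prod_unfold mult.assoc)
  show ?thesis unfolding eq
    by (rule borel_measurable_times[OF 1 space_time_measurable_rescaled[OF H_joint_measurable]])
qed

lemma u_L2: "s \<ge> T \<Longrightarrow> u s \<in> L2"
  using solution unfolding is_solution_def by simp

lemma Lp_norm_finite_iff:
  "Lp_norm r S f < \<infinity> \<longleftrightarrow> (\<integral>\<^sup>+ x. ennreal (cmod (f x) powr r) \<partial>(lebesgue_on S)) < \<infinity>"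
  by (auto simp: Lp_norm_def Let_def less_top)

text \<open>
  The profile is singular at time zero, so that the comparison starts at a positive time.
\<close>

definition T0 :: real where "T0 = max T 1"

lemma T0: "T0 \<ge> 1" "T0 \<ge> T" by (simp_all add: T0_def)

lemma u_joint_measurable: "(\<lambda>(s, x). u s x) \<in> borel_measurable (lebesgue_on ({T0..} \<times> UNIV))"
proof (rule measurable_restrict_mono)
  show "(\<lambda>(s, x). u s x) \<in> borel_measurable (lebesgue_on ({T..} \<times> UNIV))"
    using solution unfolding is_solution_def by simp
qed (use T0 in auto)

lemma diff_joint_measurable: "(\<lambda>(s, x). u s x - V s x) \<in> borel_measurable (lebesgue_on ({T0..} \<times> UNIV))"
proof -
  have "(\<lambda>(s, x). V s x) \<in> borel_measurable (lebesgue_on ({T0..} \<times> UNIV))"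
    by (rule measurable_restrict_mono[OF V_joint_measurable]) (use T0 in auto)
  from borel_measurable_diff[OF u_joint_measurable this] show ?thesis
    by (simp add: case_prod_unfold)
qed

text \<open>
  The solution has finite \<open>L\<^sup>q\<close> norm on bounded time slabs, and \<open>u - V\<close> on all late ones. Hence at
  almost every time of a late slab both have finite \<open>L\<^sup>q\<close> norm, and so has \<open>V\<close>, whose norm at a fixed
  time is a multiple of that of \<open>W\<close>.
\<close>

lemma W_Lq: "integrable lebesgue (\<lambda>x. cmod (W x) powr q)"
proof -
  have Ib: "{T0..} \<in> sets borel" by simp
  obtain E :: "real \<Rightarrow> ennreal" where E: "E \<in> borel_measurable borel"
    "AE s in lebesgue. s \<in> {T0..} \<longrightarrow> (\<integral>\<^sup>+x. ennreal (cmod (case (s, x) of (s, x) \<Rightarrow> u s x) powr q) \<partial>lebesgue) = E s"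
    "\<And>J. J \<in> sets borel \<Longrightarrow> J \<subseteq> {T0..} \<Longrightarrow>
      (\<integral>\<^sup>+p. ennreal (cmod (case p of (s, x) \<Rightarrow> u s x) powr q) \<partial>(lebesgue_on (J \<times> UNIV))) = (\<integral>\<^sup>+s. E s * indicator J s \<partial>lebesgue)"
    by (rule space_time_Tonelli[OF u_joint_measurable Ib, of q]) (rule that)
  obtain D :: "real \<Rightarrow> ennreal" where D: "D \<in> borel_measurable borel"
    "AE s in lebesgue. s \<in> {T0..} \<longrightarrow> (\<integral>\<^sup>+x. ennreal (cmod (case (s, x) of (s, x) \<Rightarrow> u s x - V s x) powr q) \<partial>lebesgue) = D s"
    "\<And>J. J \<in> sets borel \<Longrightarrow> J \<subseteq> {T0..} \<Longrightarrow>
      (\<integral>\<^sup>+p. ennreal (cmod (case p of (s, x) \<Rightarrow> u s x - V s x) powr q) \<partial>(lebesgue_on (J \<times> UNIV))) = (\<integral>\<^sup>+s. D s * indicator J s \<partial>lebesgue)"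
    by (rule space_time_Tonelli[OF diff_joint_measurable Ib, of q]) (rule that)
  have q0: "q \<ge> 0" using p by (simp add: q_eq)
  have "\<forall>\<^sub>F t in at_top. ennreal (t powr (1 / q)) * Lp_norm q ({t..} \<times> UNIV) (\<lambda>(s, x). u s x - V s x) < 1"
    using order_tendstoD(2)[OF limit_Lq, of 1] by simp
  then have "\<forall>\<^sub>F t in at_top. t \<ge> T0 \<and> ennreal (t powr (1 / q)) * Lp_norm q ({t..} \<times> UNIV) (\<lambda>(s, x). u s x - V s x) < 1"
    using eventually_ge_at_top[of T0] by eventually_elim simp
  then obtain t0 where t0: "t0 \<ge> T0" "ennreal (t0 powr (1 / q)) * Lp_norm q ({t0..} \<times> UNIV) (\<lambda>(s, x). u s x - V s x) < 1"
    using eventually_happens'[OF trivial_limit_at_top_linorder] by blast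
  have t1: "t0 > 0" using t0 T0 by simp
  have Dfin: "Lp_norm q ({t0..} \<times> UNIV) (\<lambda>(s, x). u s x - V s x) < \<infinity>"
  proof (rule ccontr)
    assume "\<not> ?thesis"
    then have "Lp_norm q ({t0..} \<times> UNIV) (\<lambda>(s, x). u s x - V s x) = \<infinity>" by (simp add: not_less top_unique)
    then show False using t0(2) t1 by (simp add: ennreal_mult_eq_top_iff)
  qed
  have "(\<integral>\<^sup>+s. D s * indicator {t0..} s \<partial>lebesgue) < \<infinity>"
    using Dfin D(3)[of "{t0..}"] t0(1) unfolding Lp_norm_finite_iff by simp
  then have Dae: "AE s in lebesgue. D s * indicator {t0..} s \<noteq> \<infinity>"
    using D(1) by (intro nn_integral_noteq_infinite borel_measurable_times_ennreal borel_measurable_indicator borel_measurable_imp_lebesgue) auto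
  have "Lp_norm (2 * (real CARD('n) + 2) / real CARD('n)) ({t0..t0+1} \<times> UNIV) (\<lambda>(t, x). u t x) < \<infinity>"
  proof -
    have "compact {t0..t0+1}" "{t0..t0+1} \<subseteq> {T..}" using t0 T0 by auto
    then show ?thesis using solution unfolding is_solution_def by simp
  qed
  moreover have "2 * (real CARD('n) + 2) / real CARD('n) = q"
    using d_pos by (simp add: q_eq p_eq d field_simps)
  ultimately have "Lp_norm q ({t0..t0+1} \<times> UNIV) (\<lambda>(t, x). u t x) < \<infinity>" by simp
  then have "(\<integral>\<^sup>+s. E s * indicator {t0..t0+1} s \<partial>lebesgue) < \<infinity>"
    using E(3)[of "{t0..t0+1}"] t0(1) unfolding Lp_norm_finite_iff by simp
  then have Eae: "AE s in lebesgue. E s * indicator {t0..t0+1} s \<noteq> \<infinity>"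
    using E(1) by (intro nn_integral_noteq_infinite borel_measurable_times_ennreal borel_measurable_indicator borel_measurable_imp_lebesgue) auto
  have "AE s in lebesgue. s \<in> {t0..t0+1} \<longrightarrow>
     nn_power q (u s) < \<infinity> \<and> nn_power q (\<lambda>x. u s x - V s x) < \<infinity>"
    using Dae Eae D(2) E(2) by eventually_elim (use t0(1) in \<open>auto simp: less_top\<close>)
  then have "\<exists>s\<in>{t0..t0+1}. nn_power q (u s) < \<infinity> \<and> nn_power q (\<lambda>x. u s x - V s x) < \<infinity>"
  proof (rule contrapos_pp)
    assume n: "\<not> (\<exists>s\<in>{t0..t0+1}. nn_power q (u s) < \<infinity> \<and> nn_power q (\<lambda>x. u s x - V s x) < \<infinity>)"
    show "\<not> (AE s in lebesgue. s \<in> {t0..t0+1} \<longrightarrow>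
     nn_power q (u s) < \<infinity> \<and> nn_power q (\<lambda>x. u s x - V s x) < \<infinity>)"
    proof
      assume "AE s in lebesgue. s \<in> {t0..t0+1} \<longrightarrow>
       nn_power q (u s) < \<infinity> \<and> nn_power q (\<lambda>x. u s x - V s x) < \<infinity>"
      then have "AE s in lebesgue. s \<notin> {t0..t0+1}" by eventually_elim (use n in blast)
      then have "{t0..t0+1} \<in> null_sets lebesgue" by (simp add: AE_iff_null_sets)
      then show False by (simp add: null_sets_def)
    qed
  qed
  then obtain s where s: "s \<in> {t0..t0+1}" "nn_power q (u s) < \<infinity>"
      "nn_power q (\<lambda>x. u s x - V s x) < \<infinity>" by auto
  have s0: "s > 0" "s \<ge> T" using s t1 t0 T0 by auto
  have um: "u s \<in> borel_measurable lebesgue" by (rule L2_measurable[OF u_L2[OF s0(2)]])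
  have Vm: "V s \<in> borel_measurable lebesgue" by (rule V_measurable[OF s0(1)])
  have "nn_power q (V s)
     \<le> (\<integral>\<^sup>+x. ennreal (2 powr q) * (ennreal (cmod (u s x) powr q) + ennreal (cmod (u s x - V s x) powr q)) \<partial>lebesgue)"
  proof (rule nn_integral_mono)
    fix x
    have "cmod (V s x) \<le> cmod (u s x) + cmod (u s x - V s x)"
      using norm_triangle_ineq4[of "u s x" "u s x - V s x"] by simp
    then have "cmod (V s x) powr q \<le> (cmod (u s x) + cmod (u s x - V s x)) powr q"
      using q0 by (intro powr_mono2) auto
    also have "\<dots> \<le> 2 powr q * (cmod (u s x) powr q + cmod (u s x - V s x) powr q)"
      using q0 by (intro powr_add_le) auto
    finally show "ennreal (cmod (V s x) powr q) \<le> ennreal (2 powr q) * (ennreal (cmod (u s x) powr q) + ennreal (cmod (u s x - V s x) powr q))"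
      by (simp add: ennreal_mult[symmetric] ennreal_plus[symmetric] ennreal_leI del: ennreal_plus)
  qed
  also have "\<dots> = ennreal (2 powr q) * (nn_power q (u s) + nn_power q (\<lambda>x. u s x - V s x))"
    using um Vm by (subst nn_integral_cmult, measurable) (subst nn_integral_add, auto)
  also have "\<dots> < \<infinity>" using s(2,3) by (simp add: ennreal_mult_less_top)
  finally have "nn_power q (V s) < \<infinity>" .
  then have "nn_power q W < \<infinity>"
    unfolding V_nn_integral_power[OF s0(1) q0] using s0(1) by (auto simp: ennreal_mult_less_top)
  moreover have "(\<lambda>x. cmod (W x) powr q) \<in> borel_measurable lebesgue" using W_measurable by measurable
  ultimately show ?thesis by (simp add: integrable_iff_bounded)
qed

definition Q :: real where "Q = (\<integral>x. cmod (W x) powr q \<partial>lebesgue)"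

lemma Q_nonneg: "0 \<le> Q" by (simp add: Q_def)

lemma V_Lq:
  assumes s: "s > 0"
  shows "integrable lebesgue (\<lambda>x. cmod (V s x) powr q)" "(\<integral>x. cmod (V s x) powr q \<partial>lebesgue) = Q / (4 * s\<^sup>2)"
proof -
  have q0: "q \<ge> 0" using p by (simp add: q_eq)
  have m: "(\<lambda>x. cmod (V s x) powr q) \<in> borel_measurable lebesgue" using V_measurable[OF s] by measurable
  have "d - d * q / 2 = - 2" using dp by (simp add: q_eq)
  then have e: "(2 * s) powr (d - d * q / 2) = 1 / (4 * s\<^sup>2)"
    using s by (simp add: powr_minus_divide power_mult_distrib)
  have "nn_power q W = ennreal Q"
    unfolding Q_def by (rule nn_integral_eq_integral[OF W_Lq]) simp
  then have n: "nn_power q (V s) = ennreal (Q / (4 * s\<^sup>2))"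
    unfolding V_nn_integral_power[OF s q0] e using Q_nonneg by (simp add: ennreal_mult[symmetric])
  then show "integrable lebesgue (\<lambda>x. cmod (V s x) powr q)"
    using m by (simp add: integrable_iff_bounded)
  show "(\<integral>x. cmod (V s x) powr q \<partial>lebesgue) = Q / (4 * s\<^sup>2)"
    by (rule integral_eq_nn_integral[THEN trans]) (use m n Q_nonneg in auto)
qed

section \<open>Oscillatory limits of the profile\<close>

text \<open>
  The substitution \<open>x = 2s\<xi>\<close>, common to the pairing of the profile itself and that of its nonlinearity.
\<close>

lemma pairing_factor:
  assumes s: "s > 0" and t: "t > 0" and f: "f \<in> borel_measurable borel"
  shows "tested t (\<lambda>x. f (V s x))
    = complex_of_real ((2 * s) powr d * t powr (- d / 2)) *
      (\<integral>\<xi>. f (complex_of_real ((2 * s) powr (- d / 2)) * Z s \<xi>) * complex_of_real (gauss (2 * (s / t)\<^sup>2) \<xi>) \<partial>lebesgue)"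
proof -
  have m: "(\<lambda>x. f (V s x) * complex_of_real (test_fun t x)) \<in> borel_measurable lebesgue"
    by (intro borel_measurable_times measurable_compose[OF V_measurable[OF s] f] L2_measurable[OF test_fun_L2(1)[OF t]])
  have e: "complex_of_real (test_fun t ((2 * s) *\<^sub>R \<xi>)) = complex_of_real (t powr (- d / 2)) * complex_of_real (gauss (2 * (s / t)\<^sup>2) \<xi>)" for \<xi> :: "real^'n"
  proof -
    have "1 / (2 * t\<^sup>2) * (norm ((2 * s) *\<^sub>R \<xi>))\<^sup>2 = 2 * (s / t)\<^sup>2 * (norm \<xi>)\<^sup>2"
      by (simp add: power_mult_distrib power_divide)
    then show ?thesis unfolding test_fun_def d by (simp only: mult_minus_left of_real_mult)
  qed
  have pow: "(2 * s) ^ DIM(real^'n) = (2 * s) powr d"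
  proof -
    have "DIM(real^'n) = CARD('n)" by simp
    then show ?thesis unfolding d by (simp only:) (rule powr_realpow[symmetric], use s in simp)
  qed
  have "tested t (\<lambda>x. f (V s x))
    = complex_of_real ((2 * s) ^ DIM(real^'n)) * (\<integral>\<xi>. f (V s ((2 * s) *\<^sub>R \<xi>)) * complex_of_real (test_fun t ((2 * s) *\<^sub>R \<xi>)) \<partial>lebesgue)"
    using s by (intro integral_scaling m) simp
  also have "\<dots> = complex_of_real ((2 * s) powr d) * (\<integral>\<xi>. complex_of_real (t powr (- d / 2)) *
      (f (complex_of_real ((2 * s) powr (- d / 2)) * Z s \<xi>) * complex_of_real (gauss (2 * (s / t)\<^sup>2) \<xi>)) \<partial>lebesgue)"
    unfolding pow V_scaled[OF s] e by (simp only: mult.left_commute)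
  also have "\<dots> = complex_of_real ((2 * s) powr d * t powr (- d / 2)) *
      (\<integral>\<xi>. f (complex_of_real ((2 * s) powr (- d / 2)) * Z s \<xi>) * complex_of_real (gauss (2 * (s / t)\<^sup>2) \<xi>) \<partial>lebesgue)"
    by (simp only: integral_mult_right_zero of_real_mult mult.assoc)
  finally show ?thesis .
qed

lemma V_pairing:
  assumes t: "t > 0" and \<sigma>: "\<sigma> > 0"
  shows "tested t (V (\<sigma> * t))
    = complex_of_real ((2 * \<sigma>) powr (d / 2)) * weighted \<sigma> (Z (\<sigma> * t))"
proof -
  have s: "\<sigma> * t > 0" using t \<sigma> by simp
  have "tested t (V (\<sigma> * t))
    = complex_of_real ((2 * (\<sigma> * t)) powr d * t powr (- d / 2)) * (\<integral>\<xi>. complex_of_real ((2 * (\<sigma> * t)) powr (- d / 2)) * (Z (\<sigma> * t) \<xi> * \<gamma> \<sigma> \<xi>) \<partial>lebesgue)"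
    using pairing_factor[OF s t, of "\<lambda>z. z"] t by (simp add: \<gamma>_def mult.assoc)
  also have "\<dots> = complex_of_real ((2 * (\<sigma> * t)) powr d * t powr (- d / 2) * (2 * (\<sigma> * t)) powr (- d / 2)) * weighted \<sigma> (Z (\<sigma> * t))"
    by (simp only: integral_mult_right_zero of_real_mult mult.assoc)
  also have "(2 * (\<sigma> * t)) powr d * t powr (- d / 2) * (2 * (\<sigma> * t)) powr (- d / 2) = (2 * \<sigma>) powr (d / 2)"
  proof -
    have "(2 * (\<sigma> * t)) powr d * (2 * (\<sigma> * t)) powr (- d / 2) = (2 * \<sigma> * t) powr (d / 2)"
      by (simp add: powr_add[symmetric] mult.assoc)
    also have "\<dots> = (2 * \<sigma>) powr (d / 2) * t powr (d / 2)" by (rule powr_mult)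
    finally have "(2 * (\<sigma> * t)) powr d * t powr (- d / 2) * (2 * (\<sigma> * t)) powr (- d / 2) = (2 * \<sigma>) powr (d / 2) * (t powr (d / 2) * t powr (- d / 2))"
      by (simp only: mult_ac)
    also have "t powr (d / 2) * t powr (- d / 2) = 1" using t by (simp add: powr_add[symmetric])
    finally show ?thesis by simp
  qed
  finally show ?thesis .
qed

text \<open>
  The factor \<open>t\<close> compensates exactly the decay of the pairing: criticality of the exponent, in the form
  \<open>d p = d + 2\<close>, lets all powers of \<open>t\<close> cancel.
\<close>

lemma F_V_pairing:
  assumes t: "t > 0" and \<sigma>: "\<sigma> > 0"
  shows "complex_of_real t * tested t (\<lambda>x. F (V (\<sigma> * t) x))
    = complex_of_real ((2 * \<sigma>) powr (d / 2 - 1)) * weighted \<sigma> (\<lambda>\<xi>. F (Z (\<sigma> * t) \<xi>))"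
proof -
  let ?s = "\<sigma> * t"
  have s: "?s > 0" using t \<sigma> by simp
  have hF: "F (complex_of_real ((2 * ?s) powr (- d / 2)) * z) = complex_of_real ((2 * ?s) powr (- d / 2 - 1)) * F z" for z
  proof -
    have "(2 * ?s) powr (- d / 2) > 0" using t \<sigma> by simp
    from hom[unfolded homogeneous_def, rule_format, OF this]
    have "F (complex_of_real ((2 * ?s) powr (- d / 2)) * z) = complex_of_real (((2 * ?s) powr (- d / 2)) powr p) * F z" .
    also have "((2 * ?s) powr (- d / 2)) powr p = (2 * ?s) powr (- d / 2 - 1)"
    proof -
      have "- d / 2 * p = - (d * p) / 2" by simp
      also have "\<dots> = - d / 2 - 1" unfolding dp by (simp add: field_simps)
      finally have "- d / 2 * p = - d / 2 - 1" .
      then show ?thesis by (simp only: powr_powr)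
    qed
    finally show ?thesis .
  qed
  have "tested t (\<lambda>x. F (V ?s x))
    = complex_of_real ((2 * ?s) powr d * t powr (- d / 2)) * (\<integral>\<xi>. complex_of_real ((2 * ?s) powr (- d / 2 - 1)) * (F (Z ?s \<xi>) * \<gamma> \<sigma> \<xi>) \<partial>lebesgue)"
    unfolding pairing_factor[OF s t F_measurable] hF \<gamma>_def using t by (simp add: mult.assoc)
  also have "\<dots> = complex_of_real ((2 * ?s) powr d * t powr (- d / 2) * (2 * ?s) powr (- d / 2 - 1)) * weighted \<sigma> (\<lambda>\<xi>. F (Z ?s \<xi>))"
    by (simp only: integral_mult_right_zero of_real_mult mult.assoc)
  finally have eq: "tested t (\<lambda>x. F (V ?s x)) = \<dots>" .
  have "t * ((2 * ?s) powr d * t powr (- d / 2) * (2 * ?s) powr (- d / 2 - 1)) = (2 * \<sigma>) powr (d / 2 - 1)"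
  proof -
    have "(2 * ?s) powr d * (2 * ?s) powr (- d / 2 - 1) = (2 * \<sigma> * t) powr (d / 2 - 1)"
      by (simp add: powr_add[symmetric] mult.assoc)
    also have "\<dots> = (2 * \<sigma>) powr (d / 2 - 1) * t powr (d / 2 - 1)" by (rule powr_mult)
    finally have "t * ((2 * ?s) powr d * t powr (- d / 2) * (2 * ?s) powr (- d / 2 - 1)) = (2 * \<sigma>) powr (d / 2 - 1) * (t powr 1 * t powr (d / 2 - 1) * t powr (- d / 2))"
      using t by (simp only: powr_one mult_ac) 
    also have "t powr 1 * t powr (d / 2 - 1) * t powr (- d / 2) = 1" using t by (simp only: powr_add[symmetric]) simp
    finally show ?thesis by simp
  qed
  then show ?thesis unfolding eq mult.assoc[symmetric] of_real_mult[symmetric] by simp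
qed

lemma mode_limit:
  assumes \<sigma>: "\<sigma> \<in> {a..b}" and n: "n \<noteq> 0" and f: "f \<in> L2"
  shows "((\<lambda>t. \<integral>x. cis (real_of_int n * (\<sigma> * t * (norm x)\<^sup>2 + \<phi> (\<sigma> * t) x)) * f x * \<gamma> \<sigma> x \<partial>lebesgue) \<longlongrightarrow> 0) at_top"
proof -
  have "\<sigma> > 0" using \<sigma> ab by simp
  have "cnj (\<gamma> \<sigma> x) = \<gamma> \<sigma> x" for x unfolding \<gamma>_def by (rule complex_cnj_complex_of_real)
  then show ?thesis
    using weak_limit[OF f \<gamma>_L2[OF \<open>\<sigma> > 0\<close>] \<sigma> n] unfolding L2_inner_def by simp
qed

lemma Z_limit:
  assumes \<sigma>: "\<sigma> \<in> {a..b}"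
  shows "((\<lambda>t. \<integral>\<xi>. Z (\<sigma> * t) \<xi> * \<gamma> \<sigma> \<xi> \<partial>lebesgue) \<longlongrightarrow> 0) at_top"
proof -
  have "((\<lambda>t. cis (- (pi / 4) * d) * (\<integral>x. cis (real_of_int 1 * (\<sigma> * t * (norm x)\<^sup>2 + \<phi> (\<sigma> * t) x)) * W x * \<gamma> \<sigma> x \<partial>lebesgue)) \<longlongrightarrow> cis (- (pi / 4) * d) * 0) at_top"
    by (intro tendsto_mult tendsto_const mode_limit \<sigma> W_L2) simp
  moreover have "cis (- (pi / 4) * d) * (\<integral>x. cis (real_of_int 1 * (\<sigma> * t * (norm x)\<^sup>2 + \<phi> (\<sigma> * t) x)) * W x * \<gamma> \<sigma> x \<partial>lebesgue)
    = weighted \<sigma> (Z (\<sigma> * t))" for t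
    by (subst integral_mult_right_zero[symmetric]) (simp only: Z_def of_int_1 mult_1 mult.assoc)
  ultimately show ?thesis by simp
qed

lemma mode_W_L2: "(\<lambda>\<xi>. F_mode p n (W \<xi>)) \<in> L2"
proof -
  have "F_mode p n \<in> borel_measurable borel"
    by (rule borel_measurable_continuous_onI[OF continuous_on_F_mode[OF p]])
  then have m: "(\<lambda>\<xi>. F_mode p n (W \<xi>)) \<in> borel_measurable lebesgue"
    by (rule measurable_compose[OF W_measurable])
  have sq: "(cmod (F_mode p n (W \<xi>)))\<^sup>2 = cmod (W \<xi>) powr q" for \<xi>
    by (simp add: F_mode_norm q_eq power2_eq_square powr_add[symmetric])
  show ?thesis unfolding L2_iff sq using m W_Lq by simp
qed

definition main_term :: "real \<Rightarrow> complex" where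
  "main_term \<sigma> = weighted \<sigma> (\<lambda>\<xi>. complex_of_real (cmod (W \<xi>) powr p))"

lemma modulus_power_L2: "(\<lambda>\<xi>. complex_of_real (cmod (W \<xi>) powr p)) \<in> L2"
  using mode_W_L2[of 0] by (simp add: F_mode_0)

lemma F_Z_L2:
  assumes s: "s > 0" shows "(\<lambda>\<xi>. F (Z s \<xi>)) \<in> L2"
proof -
  have "integrable lebesgue (\<lambda>x. cmod (Z s x) powr (2 * p))"
    using W_Lq by (simp add: cmod_Z q_eq)
  from F_compose_L2(1)[OF Z_measurable[OF s] this] show ?thesis .
qed

lemma mode_Z: "F_mode p n (Z s \<xi>) = cis (real_of_int n * (- (pi / 4) * d)) * (cis (real_of_int n * (s * (norm \<xi>)\<^sup>2 + \<phi> s \<xi>)) * F_mode p n (W \<xi>))"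
  unfolding Z_def F_mode_rotate ..

text \<open>
  A mode multiplies the phase by \<open>n\<close>, so it vanishes weakly unless \<open>n = 0\<close>, in which case the pairing
  does not depend on \<open>t\<close> at all.
\<close>

lemma mode_Z_limit:
  assumes \<sigma>: "\<sigma> \<in> {a..b}"
  shows "((\<lambda>t. \<integral>\<xi>. F_mode p n (Z (\<sigma> * t) \<xi>) * \<gamma> \<sigma> \<xi> \<partial>lebesgue) \<longlongrightarrow> (if n = 0 then main_term \<sigma> else 0)) at_top"
proof (cases "n = 0")
  case True
  then show ?thesis by (simp add: F_mode_0 cmod_Z main_term_def)
next
  case False
  have "((\<lambda>t. cis (real_of_int n * (- (pi / 4) * d)) * (\<integral>x. cis (real_of_int n * (\<sigma> * t * (norm x)\<^sup>2 + \<phi> (\<sigma> * t) x)) * F_mode p n (W x) * \<gamma> \<sigma> x \<partial>lebesgue)) \<longlongrightarrow> cis (real_of_int n * (- (pi / 4) * d)) * 0) at_top"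
    by (intro tendsto_mult tendsto_const mode_limit \<sigma> mode_W_L2 False)
  moreover have "cis (real_of_int n * (- (pi / 4) * d)) * (\<integral>x. cis (real_of_int n * (\<sigma> * t * (norm x)\<^sup>2 + \<phi> (\<sigma> * t) x)) * F_mode p n (W x) * \<gamma> \<sigma> x \<partial>lebesgue)
    = weighted \<sigma> (\<lambda>\<xi>. F_mode p n (Z (\<sigma> * t) \<xi>))" for t
    by (subst integral_mult_right_zero[symmetric]) (simp only: mode_Z mult.assoc)
  ultimately show ?thesis using False by simp
qed

text \<open>
  The hypothesis gives no uniformity in \<open>n\<close>. Truncating to finitely many modes costs an error that is
  uniform in \<open>t\<close> because the modulus of \<open>Z\<close> is independent of time.
\<close>

lemma F_Z_limit:
  assumes \<sigma>: "\<sigma> \<in> {a..b}"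
  shows "((\<lambda>t. \<integral>\<xi>. F (Z (\<sigma> * t) \<xi>) * \<gamma> \<sigma> \<xi> \<partial>lebesgue) \<longlongrightarrow> main_term \<sigma>) at_top"
proof (rule tendstoI)
  fix e :: real assume e: "e > 0"
  have \<sigma>0: "\<sigma> > 0" using \<sigma> ab by simp
  define K where "K = (\<integral>\<xi>. cmod (complex_of_real (cmod (W \<xi>) powr p) * \<gamma> \<sigma> \<xi>) \<partial>lebesgue)"
  have K0: "K \<ge> 0" by (simp add: K_def)
  have Ki: "integrable lebesgue (\<lambda>\<xi>. cmod (complex_of_real (cmod (W \<xi>) powr p) * \<gamma> \<sigma> \<xi>))"
    by (intro integrable_norm L2_product_integrable modulus_power_L2 \<gamma>_L2 \<sigma>0)
  \<comment> \<open>The summand \<open>1\<close> avoids a division by zero when \<open>W\<close> vanishes.\<close>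
  define e' where "e' = e / (2 * (K + 1))"
  have e': "e' > 0" using e K0 by (simp add: e'_def)
  obtain N where N: "finite N" "0 \<in> N" "\<And>z. cmod (F z - (\<Sum>n\<in>N. c n * F_mode p n z)) \<le> e' * cmod z powr p"
    using finite_mode_approximation[OF e'] by metis
  let ?S = "\<lambda>t. \<Sum>n\<in>N. c n * weighted \<sigma> (\<lambda>\<xi>. F_mode p n (Z (\<sigma> * t) \<xi>))"
  have "(?S \<longlongrightarrow> (\<Sum>n\<in>N. c n * (if n = 0 then main_term \<sigma> else 0))) at_top"
    by (intro tendsto_sum tendsto_mult tendsto_const mode_Z_limit \<sigma>)
  moreover have "(\<Sum>n\<in>N. c n * (if n = 0 then main_term \<sigma> else 0)) = main_term \<sigma>"
  proof -
    have "(\<Sum>n\<in>N. c n * (if n = 0 then main_term \<sigma> else 0)) = (\<Sum>n\<in>N. if n = 0 then main_term \<sigma> else 0)"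
      by (intro sum.cong refl) (simp add: c0)
    also have "\<dots> = main_term \<sigma>" using N(1,2) by (simp add: sum.delta')
    finally show ?thesis .
  qed
  ultimately have S: "(?S \<longlongrightarrow> main_term \<sigma>) at_top" by simp
  have close: "dist (weighted \<sigma> (\<lambda>\<xi>. F (Z (\<sigma> * t) \<xi>))) (?S t) \<le> e / 2" if t: "t > 0" for t
  proof -
    have s: "\<sigma> * t > 0" using t \<sigma>0 by simp
    have mL2: "(\<lambda>\<xi>. F_mode p n (Z (\<sigma> * t) \<xi>)) \<in> L2" for n
    proof -
      have "F_mode p n \<in> borel_measurable borel"
        by (rule borel_measurable_continuous_onI[OF continuous_on_F_mode[OF p]])
      then have m: "(\<lambda>\<xi>. F_mode p n (Z (\<sigma> * t) \<xi>)) \<in> borel_measurable lebesgue"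
        by (rule measurable_compose[OF Z_measurable[OF s]])
      show ?thesis
        by (rule L2_dominated[OF mode_W_L2[of n] m, of 1]) (simp add: F_mode_norm cmod_Z)
    qed
    have mi: "integrable lebesgue (\<lambda>\<xi>. F_mode p n (Z (\<sigma> * t) \<xi>) * \<gamma> \<sigma> \<xi>)" for n
      by (intro L2_product_integrable mL2 \<gamma>_L2 \<sigma>0)
    have Fi: "integrable lebesgue (\<lambda>\<xi>. F (Z (\<sigma> * t) \<xi>) * \<gamma> \<sigma> \<xi>)"
      by (intro L2_product_integrable F_Z_L2 s \<gamma>_L2 \<sigma>0)
    have si: "integrable lebesgue (\<lambda>\<xi>. \<Sum>n\<in>N. c n * (F_mode p n (Z (\<sigma> * t) \<xi>) * \<gamma> \<sigma> \<xi>))"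
      by (intro Bochner_Integration.integrable_sum integrable_mult_right mi)
    have "?S t = (\<integral>\<xi>. (\<Sum>n\<in>N. c n * (F_mode p n (Z (\<sigma> * t) \<xi>) * \<gamma> \<sigma> \<xi>)) \<partial>lebesgue)"
      by (subst Bochner_Integration.integral_sum) (intro integrable_mult_right mi, simp only: integral_mult_right_zero)
    then have "weighted \<sigma> (\<lambda>\<xi>. F (Z (\<sigma> * t) \<xi>)) - ?S t
       = (\<integral>\<xi>. F (Z (\<sigma> * t) \<xi>) * \<gamma> \<sigma> \<xi> - (\<Sum>n\<in>N. c n * (F_mode p n (Z (\<sigma> * t) \<xi>) * \<gamma> \<sigma> \<xi>)) \<partial>lebesgue)"
      using Fi si by simp
    also have "cmod \<dots> \<le> (\<integral>\<xi>. e' * cmod (complex_of_real (cmod (W \<xi>) powr p) * \<gamma> \<sigma> \<xi>) \<partial>lebesgue)"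
    proof (rule Bochner_Integration.integral_norm_bound_integral)
      show "integrable lebesgue (\<lambda>\<xi>. F (Z (\<sigma> * t) \<xi>) * \<gamma> \<sigma> \<xi> - (\<Sum>n\<in>N. c n * (F_mode p n (Z (\<sigma> * t) \<xi>) * \<gamma> \<sigma> \<xi>)))"
        using Fi si by (rule Bochner_Integration.integrable_diff)
      show "integrable lebesgue (\<lambda>\<xi>. e' * cmod (complex_of_real (cmod (W \<xi>) powr p) * \<gamma> \<sigma> \<xi>))"
        using Ki by (rule integrable_mult_right)
      fix \<xi>
      have "F (Z (\<sigma> * t) \<xi>) * \<gamma> \<sigma> \<xi> - (\<Sum>n\<in>N. c n * (F_mode p n (Z (\<sigma> * t) \<xi>) * \<gamma> \<sigma> \<xi>))
         = (F (Z (\<sigma> * t) \<xi>) - (\<Sum>n\<in>N. c n * F_mode p n (Z (\<sigma> * t) \<xi>))) * \<gamma> \<sigma> \<xi>"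
        by (simp only: left_diff_distrib sum_distrib_right mult.assoc)
      then have "norm (F (Z (\<sigma> * t) \<xi>) * \<gamma> \<sigma> \<xi> - (\<Sum>n\<in>N. c n * (F_mode p n (Z (\<sigma> * t) \<xi>) * \<gamma> \<sigma> \<xi>)))
         = cmod (F (Z (\<sigma> * t) \<xi>) - (\<Sum>n\<in>N. c n * F_mode p n (Z (\<sigma> * t) \<xi>))) * cmod (\<gamma> \<sigma> \<xi>)"
        by (simp only: norm_mult)
      also have "\<dots> \<le> e' * cmod (Z (\<sigma> * t) \<xi>) powr p * cmod (\<gamma> \<sigma> \<xi>)"
        by (intro mult_right_mono N) simp
      also have "\<dots> = e' * cmod (complex_of_real (cmod (W \<xi>) powr p) * \<gamma> \<sigma> \<xi>)"
        by (simp add: norm_mult cmod_Z)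
      finally show "norm (F (Z (\<sigma> * t) \<xi>) * \<gamma> \<sigma> \<xi> - (\<Sum>n\<in>N. c n * (F_mode p n (Z (\<sigma> * t) \<xi>) * \<gamma> \<sigma> \<xi>)))
         \<le> e' * cmod (complex_of_real (cmod (W \<xi>) powr p) * \<gamma> \<sigma> \<xi>)" .
    qed
    also have "\<dots> = e' * K" unfolding K_def by (rule integral_mult_right_zero)
    also have "\<dots> \<le> e' * (K + 1)" using e' by (intro mult_left_mono) auto
    also have "\<dots> = e / 2" using K0 by (simp add: e'_def field_simps)
    finally show ?thesis by (simp only: dist_norm)
  qed
  have "e / 2 > 0" using e by simp
  from tendstoD[OF S this] eventually_gt_at_top[of 0]
  show "\<forall>\<^sub>F t in at_top. dist (weighted \<sigma> (\<lambda>\<xi>. F (Z (\<sigma> * t) \<xi>))) (main_term \<sigma>) < e"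
  proof eventually_elim
    case (elim t)
    have "dist (weighted \<sigma> (\<lambda>\<xi>. F (Z (\<sigma> * t) \<xi>))) (main_term \<sigma>)
       \<le> dist (weighted \<sigma> (\<lambda>\<xi>. F (Z (\<sigma> * t) \<xi>))) (?S t) + dist (?S t) (main_term \<sigma>)"
      by (rule dist_triangle)
    then show ?case using close[OF elim(2)] elim(1) by linarith
  qed
qed

section \<open>Replacing the solution by the profile in the Duhamel integrand\<close>

text \<open>
  The decay of the space-time norm, raised to the power \<open>q\<close> and disintegrated in time. Since the slice
  integrals need not be measurable, they are replaced by a Borel function \<open>D\<close> that agrees with them
  almost everywhere.
\<close>

lemma deviation:
  obtains D :: "real \<Rightarrow> ennreal" where "D \<in> borel_measurable borel"
    "AE s in lebesgue. s \<ge> T0 \<longrightarrow> nn_power q (\<lambda>x. u s x - V s x) = D s"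
    "((\<lambda>t. ennreal t * (\<integral>\<^sup>+s. D s * indicator {t..} s \<partial>lebesgue)) \<longlongrightarrow> 0) at_top"
proof -
  have Ib: "{T0..} \<in> sets borel" by simp
  obtain D :: "real \<Rightarrow> ennreal" where D: "D \<in> borel_measurable borel"
    "AE s in lebesgue. s \<in> {T0..} \<longrightarrow> (\<integral>\<^sup>+x. ennreal (cmod (case (s, x) of (s, x) \<Rightarrow> u s x - V s x) powr q) \<partial>lebesgue) = D s"
    "\<And>J. J \<in> sets borel \<Longrightarrow> J \<subseteq> {T0..} \<Longrightarrow>
      (\<integral>\<^sup>+p. ennreal (cmod (case p of (s, x) \<Rightarrow> u s x - V s x) powr q) \<partial>(lebesgue_on (J \<times> UNIV))) = (\<integral>\<^sup>+s. D s * indicator J s \<partial>lebesgue)"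
    by (rule space_time_Tonelli[OF diff_joint_measurable Ib, of q]) (rule that)
  have q0: "q > 0" using p by (simp add: q_eq)
  define L where "L t = Lp_norm q ({t..} \<times> UNIV) (\<lambda>(s, x). u s x - V s x)" for t
  define \<Delta> where "\<Delta> t = (\<integral>\<^sup>+s. D s * indicator {t..} s \<partial>lebesgue)" for t
  have small: "\<forall>\<^sub>F t in at_top. ennreal t * \<Delta> t < e" if e: "e > 0" for e :: ennreal
  proof -
    obtain r where r: "r > 0" "ennreal r < e"
    proof (cases e)
      case (real x)
      then have "x > 0" using e by simp
      then show ?thesis using real by (intro that[of "x / 2"]) (simp_all add: ennreal_less_iff)
    next
      case top
      then show ?thesis by (intro that[of 1]) simp_all
    qed
    have "\<forall>\<^sub>F t in at_top. ennreal (t powr (1 / q)) * L t < ennreal (r powr (1 / q))"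
      using order_tendstoD(2)[OF limit_Lq, of "ennreal (r powr (1 / q))"] r unfolding L_def by simp
    then show ?thesis using eventually_ge_at_top[of T0]
    proof eventually_elim
      case (elim t)
      have t: "t > 0" using elim(2) T0 by simp
      have Lfin: "L t \<noteq> \<infinity>"
      proof
        assume "L t = \<infinity>"
        then show False using elim(1) t by (simp add: ennreal_mult_eq_top_iff)
      qed
      have int: "(\<integral>\<^sup>+p. ennreal (cmod (case p of (s, x) \<Rightarrow> u s x - V s x) powr q) \<partial>(lebesgue_on ({t..} \<times> UNIV))) = \<Delta> t"
        unfolding \<Delta>_def using elim(2) by (intro D(3)) auto
      have "L t < \<infinity>" using Lfin by (simp add: less_top)
      then have fin: "\<Delta> t < \<infinity>" unfolding L_def Lp_norm_finite_iff int .
      then obtain y where y: "\<Delta> t = ennreal y" "y \<ge> 0" by (cases "\<Delta> t") auto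
      have Leq: "L t = ennreal (y powr (1 / q))"
        unfolding L_def Lp_norm_def int Let_def using y by simp
      have "(t * y) powr (1 / q) < r powr (1 / q)"
        using elim(1) unfolding Leq by (simp add: ennreal_mult[symmetric] powr_mult ennreal_less_iff)
      moreover have "r powr (1 / q) \<le> (t * y) powr (1 / q)" if "r \<le> t * y"
        using q0 r that by (intro powr_mono2) auto
      ultimately have "t * y < r" by (meson not_less)
      then have "ennreal t * \<Delta> t < ennreal r"
        unfolding y using t y r by (simp add: ennreal_mult[symmetric] ennreal_less_iff)
      then show ?case using r(2) by (rule less_trans)
    qed
  qed
  have lim: "((\<lambda>t. ennreal t * (\<integral>\<^sup>+s. D s * indicator {t..} s \<partial>lebesgue)) \<longlongrightarrow> 0) at_top"
    unfolding \<Delta>_def[symmetric] by (rule order_tendstoI) (use small in auto)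
  have "AE s in lebesgue. s \<ge> T0 \<longrightarrow> nn_power q (\<lambda>x. u s x - V s x) = D s"
    using D(2) by simp
  then show ?thesis by (rule that[OF D(1) _ lim])
qed

text \<open>
  The error has two sources: removing the free evolution from the test function, and replacing \<open>F(u)\<close>
  by \<open>F(V)\<close>. Over the interval from \<open>a t\<close> to \<open>b t\<close> the first term of the bound integrates to a multiple
  of \<open>e\<close>, and the second to a multiple of \<open>t\<close> times the integrated deviation, which tends to zero.
\<close>

lemma pointwise_error:
  assumes e: "e > 0"
  obtains B t0 where "B \<ge> 0" "t0 \<ge> T0"
    "\<And>t s \<delta>. t \<ge> t0 \<Longrightarrow> s \<in> {a * t..b * t} \<Longrightarrow> T0 \<le> s \<Longrightarrow> 0 \<le> \<delta> \<Longrightarrow>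
     nn_power q (\<lambda>x. u s x - V s x) = ennreal \<delta> \<Longrightarrow>
     cmod (tested t (schroedinger_group (b * t - s) (\<lambda>x. F (u s x)))
       - tested t (\<lambda>x. F (V s x))) \<le> e / t + B * t * \<delta>"
proof -
  define H where "H = pi powr (d / 2)"
  have H0: "H \<ge> 0" by (simp add: H_def)
  define C1 where "C1 = sqrt (8 * (2 * pi) powr (d / 2))"
  have C1: "C1 \<ge> 0" by (simp add: C1_def)
  define K1 where "K1 = (Q / (4 * a\<^sup>2) + H) / 2"
  have K1: "K1 \<ge> 0" using Q_nonneg H0 by (simp add: K1_def)
  have frac: "y / (X + 1) * X \<le> y" if "0 \<le> X" "0 \<le> y" for X y :: real
  proof -
    have "y / (X + 1) * X \<le> y / (X + 1) * (X + 1)" using that by (intro mult_left_mono) auto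
    then show ?thesis using that by simp
  qed
  \<comment> \<open>The three contributions of size \<open>1/t\<close> are each made smaller than \<open>e / (3t)\<close>: by the choice of \<open>e1\<close> for
    the part of the difference bound in \<open>|V|\<^sup>p\<close>, of \<open>\<eta>\<close> for the part in \<open>|u - V|\<^sup>p\<close>, and of \<open>t0\<close> for the
    free evolution. The mean inequality is used with the weights \<open>\<alpha> = t\<close> and \<open>\<beta> = t / \<eta>\<close>.\<close>
  define e1 where "e1 = e / 3 / (K1 + 1)"
  have e1: "e1 > 0" using e K1 by (simp add: e1_def)
  obtain C where C: "C \<ge> 0" "\<And>z w. cmod (F z - F w) \<le> e1 * cmod w powr p + C * cmod (z - w) powr p"
    using F_difference[OF hom e1] by metis
  have CH: "C * H \<ge> 0" using C(1) H0 by (rule mult_nonneg_nonneg)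
  define \<eta> where "\<eta> = 2 * (e / 3 / (C * H + 1))"
  have \<eta>: "\<eta> > 0" unfolding \<eta>_def using e CH by (intro mult_pos_pos divide_pos_pos) auto
  define k where "k = coeff_norm\<^sup>2 * 2 powr q"
  have k: "k \<ge> 0" by (simp add: k_def)
  define K0 where "K0 = C1 * (b - a) / 2 * (1 + k * (Q / (4 * a\<^sup>2)))"
  have K0: "K0 \<ge> 0" using C1 ab k Q_nonneg by (simp add: K0_def)
  define B where "B = C1 * (b - a) / 2 * k + C / (2 * \<eta>)"
  have B: "B \<ge> 0" using C1 ab k C \<eta> by (simp add: B_def)
  define t0 where "t0 = max T0 (3 * K0 / e)"
  have q2: "q = 2 * p" by (rule q_eq)
  have q0: "q \<ge> 0" using p by (simp add: q_eq)
  have tri: "cmod (x - z) \<le> cmod (x - y) + cmod (y - z)" for x y z :: complex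
    using norm_triangle_ineq[of "x - y" "y - z"] by simp
  have main: "cmod (tested t (schroedinger_group (b * t - s) (\<lambda>x. F (u s x)))
       - tested t (\<lambda>x. F (V s x))) \<le> e / t + B * t * \<delta>"
    if t: "t \<ge> t0" and s: "s \<in> {a*t..b*t}" "T0 \<le> s" and \<delta>: "0 \<le> \<delta>"
      and dev: "nn_power q (\<lambda>x. u s x - V s x) = ennreal \<delta>" for t s \<delta>
  proof -
    have t1: "t \<ge> 1" "t > 0" using t T0 by (auto simp: t0_def)
    have s0: "s > 0" "s \<ge> T" using s(2) T0 by auto
    have at: "a * t > 0" using ab t1 by simp
    have um: "u s \<in> borel_measurable lebesgue" by (rule L2_measurable[OF u_L2[OF s0(2)]])
    have Vm: "V s \<in> borel_measurable lebesgue" by (rule V_measurable[OF s0(1)])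
    let ?h = "\<lambda>x::real^'n. complex_of_real (test_fun t x)"
    have h: "?h \<in> L2" "(l2 ?h)\<^sup>2 = H" using test_fun_L2[OF t1(2), where 'n = 'n] by (simp_all add: H_def d)
    have di: "integrable lebesgue (\<lambda>x. cmod (u s x - V s x) powr q)"
      using um Vm dev by (intro integrableI_bounded) (auto simp: less_top)
    have dI: "(\<integral>x. cmod (u s x - V s x) powr q \<partial>lebesgue) = \<delta>"
      using nn_integral_eq_integral[OF di] dev \<delta> by simp
    note Vi = V_Lq[OF s0(1)]
    have Vle: "(\<integral>x. cmod (V s x) powr q \<partial>lebesgue) \<le> Q / (4 * a\<^sup>2) / t\<^sup>2"
    proof -
      have "(a * t)\<^sup>2 \<le> s\<^sup>2" using s(1) at by (intro power_mono) auto
      then have "Q / (4 * s\<^sup>2) \<le> Q / (4 * (a * t)\<^sup>2)"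
        by (intro divide_left_mono mult_pos_pos zero_less_power Q_nonneg at s0(1)) simp_all
      then show ?thesis unfolding Vi(2) by (simp add: power_mult_distrib)
    qed
    have ule: "cmod (u s x) powr q \<le> 2 powr q * (cmod (u s x - V s x) powr q + cmod (V s x) powr q)" for x
    proof -
      have "cmod (u s x) powr q \<le> (cmod (u s x - V s x) + cmod (V s x)) powr q"
        using q0 norm_triangle_ineq[of "u s x - V s x" "V s x"] by (intro powr_mono2) auto
      also have "\<dots> \<le> 2 powr q * (cmod (u s x - V s x) powr q + cmod (V s x) powr q)"
        using q0 by (intro powr_add_le) auto
      finally show ?thesis .
    qed
    have bi: "integrable lebesgue (\<lambda>x. 2 powr q * (cmod (u s x - V s x) powr q + cmod (V s x) powr q))"
      using di Vi(1) by (intro integrable_mult_right Bochner_Integration.integrable_add)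
    have ui: "integrable lebesgue (\<lambda>x. cmod (u s x) powr q)"
    proof (rule Bochner_Integration.integrable_bound[OF bi])
      show "(\<lambda>x. cmod (u s x) powr q) \<in> borel_measurable lebesgue" using um by measurable
    qed (use ule in \<open>auto intro!: AE_I2 order_trans[OF ule] simp: abs_of_nonneg\<close>)
    have uI: "(\<integral>x. cmod (u s x) powr q \<partial>lebesgue) \<le> 2 powr q * (\<delta> + Q / (4 * a\<^sup>2) / t\<^sup>2)"
    proof -
      have "(\<integral>x. cmod (u s x) powr q \<partial>lebesgue) \<le> (\<integral>x. 2 powr q * (cmod (u s x - V s x) powr q + cmod (V s x) powr q) \<partial>lebesgue)"
        by (rule integral_mono[OF ui bi ule])
      also have "\<dots> = 2 powr q * (\<delta> + (\<integral>x. cmod (V s x) powr q \<partial>lebesgue))"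
        using di Vi(1) dI by simp
      also have "\<dots> \<le> 2 powr q * (\<delta> + Q / (4 * a\<^sup>2) / t\<^sup>2)" using Vle by (intro mult_left_mono add_left_mono) auto
      finally show ?thesis .
    qed
    have FuL2: "(\<lambda>x. F (u s x)) \<in> L2" using F_compose_L2(1)[OF um] ui by (simp add: q2)
    let ?N = "l2 (\<lambda>x. F (u s x))"
    have N: "?N\<^sup>2 \<le> k * (\<delta> + Q / (4 * a\<^sup>2) / t\<^sup>2)"
    proof -
      have "?N\<^sup>2 \<le> coeff_norm\<^sup>2 * (\<integral>x. cmod (u s x) powr q \<partial>lebesgue)"
        using F_compose_L2(2)[OF um] ui by (simp add: q2)
      also have "\<dots> \<le> coeff_norm\<^sup>2 * (2 powr q * (\<delta> + Q / (4 * a\<^sup>2) / t\<^sup>2))" by (intro mult_left_mono uI) simp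
      finally show ?thesis by (simp add: k_def mult.assoc)
    qed
    have E1: "cmod (tested t (schroedinger_group (b * t - s) (\<lambda>x. F (u s x))) - tested t (\<lambda>x. F (u s x)))
       \<le> K0 / t\<^sup>2 + C1 * (b - a) / 2 * k * \<delta>"
    proof -
      have "cmod (tested t (schroedinger_group (b * t - s) (\<lambda>x. F (u s x))) - tested t (\<lambda>x. F (u s x)))
         \<le> C1 * ?N * \<bar>b * t - s\<bar> / t\<^sup>2"
        using schroedinger_group_test_fun(2)[OF FuL2 t1(2), of "b * t - s"] by (simp add: C1_def d)
      also have "\<dots> \<le> C1 * ?N * ((b - a) * t) / t\<^sup>2"
        using s(1) C1 by (intro divide_right_mono mult_left_mono) (auto simp: left_diff_distrib)
      also have "\<dots> = C1 * (b - a) * (?N / t)" using t1 by (simp add: power2_eq_square field_simps)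
      also have "\<dots> \<le> C1 * (b - a) * ((1 / t\<^sup>2 + ?N\<^sup>2) / 2)"
      proof (rule mult_left_mono)
        show "?N / t \<le> (1 / t\<^sup>2 + ?N\<^sup>2) / 2"
          using sum_squares_bound[of "1 / t" ?N] by (simp add: power_divide mult.commute)
      qed (use C1 ab in simp)
      also have "\<dots> \<le> C1 * (b - a) * ((1 / t\<^sup>2 + k * (\<delta> + Q / (4 * a\<^sup>2) / t\<^sup>2)) / 2)"
        using C1 ab N by (intro mult_left_mono divide_right_mono add_left_mono) auto
      also have "\<dots> = K0 / t\<^sup>2 + C1 * (b - a) / 2 * k * \<delta>"
        unfolding K0_def by (simp add: distrib_left distrib_right add_divide_distrib)
      finally show ?thesis .
    qed
    have E2: "cmod (tested t (\<lambda>x. F (u s x)) - tested t (\<lambda>x. F (V s x)))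
       \<le> e1 / 2 * (t * (Q / (4 * a\<^sup>2) / t\<^sup>2) + H / t) + C / 2 * (t / \<eta> * \<delta> + H / (t / \<eta>))"
    proof -
      have "cmod (tested t (\<lambda>x. F (u s x)) - tested t (\<lambda>x. F (V s x)))
        \<le> e1 / 2 * (t * (\<integral>x. cmod (V s x) powr (2 * p) \<partial>lebesgue) + (l2 ?h)\<^sup>2 / t)
         + C / 2 * (t / \<eta> * (\<integral>x. cmod (u s x - V s x) powr (2 * p) \<partial>lebesgue) + (l2 ?h)\<^sup>2 / (t / \<eta>))"
        using ui Vi(1) di e1 C t1 \<eta> by (intro F_difference_pairing um Vm h(1)) (auto simp: q2)
      also have "\<dots> \<le> e1 / 2 * (t * (Q / (4 * a\<^sup>2) / t\<^sup>2) + H / t) + C / 2 * (t / \<eta> * \<delta> + H / (t / \<eta>))"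
        unfolding h(2) q2[symmetric] dI using Vle e1 t1 by (intro add_mono mult_left_mono order_refl) auto
      finally show ?thesis .
    qed
    have e1K: "e1 / 2 * (t * (Q / (4 * a\<^sup>2) / t\<^sup>2) + H / t) \<le> e / 3 / t"
    proof -
      have "e1 / 2 * (t * (Q / (4 * a\<^sup>2) / t\<^sup>2) + H / t) = e1 * K1 / t"
        unfolding K1_def using t1 by (simp add: power2_eq_square field_simps)
      also have "\<dots> \<le> e / 3 / t"
        using frac[OF K1, of "e / 3"] e t1 unfolding e1_def by (intro divide_right_mono) auto
      finally show ?thesis .
    qed
    have e2K: "C / 2 * (t / \<eta> * \<delta> + H / (t / \<eta>)) \<le> C / (2 * \<eta>) * t * \<delta> + e / 3 / t"
    proof -
      have "C / 2 * (t / \<eta> * \<delta> + H / (t / \<eta>)) = C / (2 * \<eta>) * t * \<delta> + (C * H) * \<eta> / 2 / t"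
        using t1 \<eta> by (simp add: field_simps)
      moreover have "(C * H) * \<eta> / 2 \<le> e / 3"
      proof -
        have "(C * H) * (2 * X) / 2 = X * (C * H)" for X by simp
        then show ?thesis unfolding \<eta>_def using frac[OF CH, of "e / 3"] e by (simp only:)
      qed
      then have "(C * H) * \<eta> / 2 / t \<le> e / 3 / t" using t1 by (intro divide_right_mono) auto
      ultimately show ?thesis by linarith
    qed
    have e0K: "K0 / t\<^sup>2 \<le> e / 3 / t"
    proof -
      have "3 * K0 / e \<le> t" using t by (simp add: t0_def)
      then have "K0 \<le> e / 3 * t" using e by (simp add: field_simps)
      then have "K0 / t\<^sup>2 \<le> e / 3 * t / t\<^sup>2" by (rule divide_right_mono) simp
      then show ?thesis using t1 by (simp add: power2_eq_square)
    qed
    have dK: "C1 * (b - a) / 2 * k * \<delta> \<le> C1 * (b - a) / 2 * k * t * \<delta>"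
    proof -
      have "C1 * (b - a) / 2 * k * 1 \<le> C1 * (b - a) / 2 * k * t"
        using C1 ab k t1 by (intro mult_left_mono) auto
      then show ?thesis using \<delta> by (intro mult_right_mono) auto
    qed
    have "cmod (tested t (schroedinger_group (b * t - s) (\<lambda>x. F (u s x))) - tested t (\<lambda>x. F (V s x)))
       \<le> cmod (tested t (schroedinger_group (b * t - s) (\<lambda>x. F (u s x))) - tested t (\<lambda>x. F (u s x)))
       + cmod (tested t (\<lambda>x. F (u s x)) - tested t (\<lambda>x. F (V s x)))"
      by (rule tri)
    also have "\<dots> \<le> (e / 3 / t + C1 * (b - a) / 2 * k * t * \<delta>) + (e / 3 / t + (C / (2 * \<eta>) * t * \<delta> + e / 3 / t))"
      using E1 E2 e1K e2K e0K dK by linarith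
    also have "\<dots> = e / t + B * t * \<delta>"
      by (simp add: B_def distrib_right)
    finally show ?thesis .
  qed
  have "t0 \<ge> T0" by (simp add: t0_def)
  then show ?thesis by (rule that[OF B _ main])
qed

section \<open>The time-averaged limit\<close>

text \<open>
  This is \<open>t\<close> times the pairing of \<open>F(V(\<sigma>t))\<close> with the test function, by \<open>F_V_pairing\<close>.
\<close>

definition rescaled_pairing :: "real \<Rightarrow> real \<Rightarrow> complex" where
  "rescaled_pairing t \<sigma> = complex_of_real ((2 * \<sigma>) powr (d / 2 - 1)) * weighted \<sigma> (\<lambda>\<xi>. F (Z (\<sigma> * t) \<xi>))"

definition limit_pairing :: "real \<Rightarrow> complex" where
  "limit_pairing \<sigma> = complex_of_real ((2 * \<sigma>) powr (d / 2 - 1)) * main_term \<sigma>"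

text \<open>
  Domination for the limit under the integral over \<open>\<sigma>\<close>: the modulus of \<open>Z\<close> does not depend on time, and
  the Gaussian weights are largest at \<open>\<sigma> = a\<close>.
\<close>

lemma rescaled_pairing_bound:
  assumes t: "t > 0" and \<sigma>: "\<sigma> \<in> {a..b}"
  shows "cmod (rescaled_pairing t \<sigma>) \<le> ((2 * a) powr (d / 2 - 1) + (2 * b) powr (d / 2 - 1)) * (coeff_norm * l2 (\<lambda>\<xi>. complex_of_real (cmod (W \<xi>) powr p)) * l2 (\<gamma> a))"
proof -
  have \<sigma>0: "\<sigma> > 0" using \<sigma> ab by simp
  have s: "\<sigma> * t > 0" using \<sigma>0 t by simp
  \<comment> \<open>The exponent is negative for \<open>d = 1\<close>, and then the maximum is attained at \<open>a\<close> instead of \<open>b\<close>.\<close>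
  have pw: "(2 * \<sigma>) powr (d / 2 - 1) \<le> (2 * a) powr (d / 2 - 1) + (2 * b) powr (d / 2 - 1)"
  proof (cases "d / 2 - 1 \<ge> 0")
    case True
    then have "(2 * \<sigma>) powr (d / 2 - 1) \<le> (2 * b) powr (d / 2 - 1)"
      using \<sigma> \<sigma>0 by (intro powr_mono2) auto
    then show ?thesis by (simp add: add_increasing)
  next
    case False
    then have "(2 * \<sigma>) powr (d / 2 - 1) \<le> (2 * a) powr (d / 2 - 1)"
      using \<sigma> ab by (intro powr_mono2') auto
    then show ?thesis by (simp add: add_increasing2)
  qed
  let ?P = "\<lambda>\<xi>. complex_of_real (cmod (W \<xi>) powr p)"
  have \<gamma>le: "cmod (\<gamma> \<sigma> \<xi>) \<le> cmod (\<gamma> a \<xi>)" for \<xi>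
  proof -
    have "a\<^sup>2 \<le> \<sigma>\<^sup>2" using \<sigma> ab by (intro power_mono) auto
    then have "2 * a\<^sup>2 * (norm \<xi>)\<^sup>2 \<le> 2 * \<sigma>\<^sup>2 * (norm \<xi>)\<^sup>2" by (intro mult_right_mono) auto
    then have "- (2 * \<sigma>\<^sup>2) * (norm \<xi>)\<^sup>2 \<le> - (2 * a\<^sup>2) * (norm \<xi>)\<^sup>2" by simp
    then show ?thesis unfolding \<gamma>_def norm_of_real abs_exp_cancel by (simp only: exp_le_cancel_iff)
  qed
  have a0: "a > 0" by (rule ab)
  have Fi: "integrable lebesgue (\<lambda>\<xi>. F (Z (\<sigma> * t) \<xi>) * \<gamma> \<sigma> \<xi>)"
    by (intro L2_product_integrable F_Z_L2 s \<gamma>_L2 \<sigma>0)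
  have Pi: "integrable lebesgue (\<lambda>\<xi>. cmod (?P \<xi>) * cmod (\<gamma> a \<xi>))"
    using integrable_norm[OF L2_product_integrable[OF modulus_power_L2 \<gamma>_L2[OF a0]]] by (simp only: norm_mult)
  have "cmod (weighted \<sigma> (\<lambda>\<xi>. F (Z (\<sigma> * t) \<xi>))) \<le> (\<integral>\<xi>. coeff_norm * (cmod (?P \<xi>) * cmod (\<gamma> a \<xi>)) \<partial>lebesgue)"
  proof (rule Bochner_Integration.integral_norm_bound_integral[OF Fi])
    show "integrable lebesgue (\<lambda>\<xi>. coeff_norm * (cmod (?P \<xi>) * cmod (\<gamma> a \<xi>)))" using Pi by (rule integrable_mult_right)
    fix \<xi>
    have "norm (F (Z (\<sigma> * t) \<xi>) * \<gamma> \<sigma> \<xi>) \<le> (coeff_norm * cmod (Z (\<sigma> * t) \<xi>) powr p) * cmod (\<gamma> a \<xi>)"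
      unfolding norm_mult by (intro mult_mono F_le \<gamma>le mult_nonneg_nonneg coeff_norm_nonneg) auto
    then show "norm (F (Z (\<sigma> * t) \<xi>) * \<gamma> \<sigma> \<xi>) \<le> coeff_norm * (cmod (?P \<xi>) * cmod (\<gamma> a \<xi>))"
      by (simp add: cmod_Z mult.assoc)
  qed
  also have "\<dots> = coeff_norm * (\<integral>\<xi>. cmod (?P \<xi>) * cmod (\<gamma> a \<xi>) \<partial>lebesgue)" by (rule integral_mult_right_zero)
  also have "\<dots> \<le> coeff_norm * (l2 ?P * l2 (\<gamma> a))"
    by (intro mult_left_mono integral_abs_product_le_l2 modulus_power_L2 \<gamma>_L2 a0 coeff_norm_nonneg)
  finally have I: "cmod (weighted \<sigma> (\<lambda>\<xi>. F (Z (\<sigma> * t) \<xi>))) \<le> coeff_norm * l2 ?P * l2 (\<gamma> a)" by (simp only: mult.assoc)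
  have "cmod (rescaled_pairing t \<sigma>) = (2 * \<sigma>) powr (d / 2 - 1) * cmod (weighted \<sigma> (\<lambda>\<xi>. F (Z (\<sigma> * t) \<xi>)))"
    by (simp add: rescaled_pairing_def norm_mult)
  also have "\<dots> \<le> ((2 * a) powr (d / 2 - 1) + (2 * b) powr (d / 2 - 1)) * (coeff_norm * l2 ?P * l2 (\<gamma> a))"
    by (intro mult_mono pw I) auto
  finally show ?thesis .
qed

lemma rescaled_pairing_measurable:
  assumes t: "t > 0"
  shows "(\<lambda>\<sigma>. indicator {a..b} \<sigma> *\<^sub>R rescaled_pairing t \<sigma>) \<in> borel_measurable lebesgue"
proof -
  let ?S = "{0<..} \<times> UNIV :: (real \<times> (real^'n)) set"
  have Sb: "?S \<in> sets (borel :: (real \<times> (real^'n)) measure)"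
    by (intro borel_open open_Times) auto
  have "?S \<in> sets lebesgue" by (rule sets_completionI_sets) (simp only: sets_lborel Sb)
  then have S': "?S \<inter> space lebesgue \<in> sets lebesgue" by simp
  define f where "f p = indicator ?S p *\<^sub>R (F (case p of (s, \<xi>) \<Rightarrow> Z s \<xi>) * complex_of_real (gauss (2 * (fst p / t)\<^sup>2) (snd p)))" for p
  have "(\<lambda>p. F (case p of (s, \<xi>) \<Rightarrow> Z s \<xi>) * complex_of_real (gauss (2 * (fst p / t)\<^sup>2) (snd p))) \<in> borel_measurable (lebesgue_on ?S)"
  proof (rule borel_measurable_times)
    show "(\<lambda>p. F (case p of (s, \<xi>) \<Rightarrow> Z s \<xi>)) \<in> borel_measurable (lebesgue_on ?S)"
      by (rule measurable_compose[OF Z_joint_measurable F_measurable])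
    show "(\<lambda>p. complex_of_real (gauss (2 * (fst p / t)\<^sup>2) (snd p))) \<in> borel_measurable (lebesgue_on ?S)"
      by (rule borel_space_time) measurable
  qed
  then have fm: "f \<in> borel_measurable lebesgue"
    unfolding f_def by (rule borel_measurable_restrict_space_iff[OF S', THEN iffD1])
  have sl: "(\<lambda>\<xi>. f (s, \<xi>)) \<in> borel_measurable lebesgue" for s
  proof (cases "s > 0")
    case True
    have eq: "(\<lambda>\<xi>. f (s, \<xi>)) = (\<lambda>\<xi>. F (Z s \<xi>) * complex_of_real (gauss (2 * (s / t)\<^sup>2) \<xi>))"
      using True by (simp add: f_def)
    have g: "(\<lambda>\<xi>::real^'n. complex_of_real (gauss (2 * (s / t)\<^sup>2) \<xi>)) \<in> borel_measurable lebesgue"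
      by (rule borel_measurable_imp_lebesgue) measurable
    show ?thesis unfolding eq
      by (intro borel_measurable_times g measurable_compose[OF Z_measurable[OF True] F_measurable])
  qed (simp add: f_def)
  have m1: "(\<lambda>s. \<integral>\<xi>. f (s, \<xi>) \<partial>lebesgue) \<in> borel_measurable lebesgue"
    by (rule slice_integral_measurable[OF fm sl])
  have m2: "(\<lambda>\<sigma>. \<integral>\<xi>. f (t *\<^sub>R \<sigma>, \<xi>) \<partial>lebesgue) \<in> borel_measurable lebesgue"
    by (rule scaling_measurable[OF m1])
  have m3: "(\<lambda>\<sigma>. indicator {a..b} \<sigma> *\<^sub>R complex_of_real ((2 * \<sigma>) powr (d / 2 - 1))) \<in> borel_measurable lebesgue"
    by (rule borel_measurable_imp_lebesgue) measurable
  have eq: "indicator {a..b} \<sigma> *\<^sub>R rescaled_pairing t \<sigma> = (indicator {a..b} \<sigma> *\<^sub>R complex_of_real ((2 * \<sigma>) powr (d / 2 - 1))) * (\<integral>\<xi>. f (t *\<^sub>R \<sigma>, \<xi>) \<partial>lebesgue)" for \<sigma>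
  proof (cases "\<sigma> \<in> {a..b}")
    case True
    then have \<sigma>0: "\<sigma> > 0" using ab by simp
    have "f (t *\<^sub>R \<sigma>, \<xi>) = F (Z (\<sigma> * t) \<xi>) * \<gamma> \<sigma> \<xi>" for \<xi>
      using \<sigma>0 t by (simp add: f_def \<gamma>_def mult.commute)
    then show ?thesis by (simp add: rescaled_pairing_def)
  qed simp
  show ?thesis unfolding eq by (intro borel_measurable_times m2 m3)
qed

lemma rescaled_pairing_limit:
  assumes "\<sigma> \<in> {a..b}"
  shows "((\<lambda>t. rescaled_pairing t \<sigma>) \<longlongrightarrow> limit_pairing \<sigma>) at_top"
  unfolding rescaled_pairing_def limit_pairing_def by (intro tendsto_mult tendsto_const F_Z_limit assms)

text \<open>
  Dominated convergence is applied along a sequence of times, which suffices to identify the limit.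
\<close>

definition sample_time :: "nat \<Rightarrow> real" where "sample_time k = real (Suc k)"

lemma sample_time: "sample_time k > 0" "filterlim sample_time at_top sequentially"
proof -
  show "sample_time k > 0" by (simp add: sample_time_def)
  show "filterlim sample_time at_top sequentially"
    unfolding sample_time_def by (rule filterlim_compose[OF filterlim_real_sequentially filterlim_Suc])
qed

lemma rescaled_pairing_integral_limit:
  shows "integrable lebesgue (\<lambda>\<sigma>. indicator {a..b} \<sigma> *\<^sub>R limit_pairing \<sigma>)"
    and "\<And>t. t > 0 \<Longrightarrow> integrable lebesgue (\<lambda>\<sigma>. indicator {a..b} \<sigma> *\<^sub>R rescaled_pairing t \<sigma>)"
    and "(\<lambda>k. \<integral>\<sigma>. indicator {a..b} \<sigma> *\<^sub>R rescaled_pairing (sample_time k) \<sigma> \<partial>lebesgue) \<longlonglongrightarrow> (\<integral>\<sigma>. indicator {a..b} \<sigma> *\<^sub>R limit_pairing \<sigma> \<partial>lebesgue)"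
proof -
  define M where "M = ((2 * a) powr (d / 2 - 1) + (2 * b) powr (d / 2 - 1)) * (coeff_norm * l2 (\<lambda>\<xi>. complex_of_real (cmod (W \<xi>) powr p)) * l2 (\<gamma> a))"
  have w: "integrable lebesgue (\<lambda>\<sigma>. indicator {a..b} \<sigma> * M)"
  proof -
    have "integrable lebesgue (indicat_real {a..b})"
      using lmeasurable_interval(1)[of a b] by (intro integrable_real_indicator) (auto simp: fmeasurable_def)
    then show ?thesis by (rule integrable_mult_left)
  qed
  have le: "norm (indicator {a..b} \<sigma> *\<^sub>R rescaled_pairing t \<sigma>) \<le> indicator {a..b} \<sigma> * M" if "t > 0" for t \<sigma>
    using rescaled_pairing_bound[OF that, of \<sigma>] by (cases "\<sigma> \<in> {a..b}") (simp_all add: M_def)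
  have lim: "(\<lambda>k. indicator {a..b} \<sigma> *\<^sub>R rescaled_pairing (sample_time k) \<sigma>) \<longlonglongrightarrow> indicator {a..b} \<sigma> *\<^sub>R limit_pairing \<sigma>" for \<sigma>
  proof (cases "\<sigma> \<in> {a..b}")
    case True
    from filterlim_compose[OF rescaled_pairing_limit[OF True] sample_time(2)] True show ?thesis by simp
  qed simp
  have m0: "(\<lambda>\<sigma>. indicator {a..b} \<sigma> *\<^sub>R limit_pairing \<sigma>) \<in> borel_measurable lebesgue"
    by (rule borel_measurable_LIMSEQ_metric[OF rescaled_pairing_measurable[OF sample_time(1)] lim])
  show "integrable lebesgue (\<lambda>\<sigma>. indicator {a..b} \<sigma> *\<^sub>R rescaled_pairing t \<sigma>)" if t: "t > 0" for t
    by (rule Bochner_Integration.integrable_bound[OF w rescaled_pairing_measurable[OF t]], rule AE_I2,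
        rule order_trans[OF le[OF t]], simp only: real_norm_def abs_ge_self)
  show "integrable lebesgue (\<lambda>\<sigma>. indicator {a..b} \<sigma> *\<^sub>R limit_pairing \<sigma>)"
    by (rule integrable_dominated_convergence[OF m0 rescaled_pairing_measurable[OF sample_time(1)] w])
       (rule AE_I2, rule lim, rule AE_I2, rule le[OF sample_time(1)])
  show "(\<lambda>k. \<integral>\<sigma>. indicator {a..b} \<sigma> *\<^sub>R rescaled_pairing (sample_time k) \<sigma> \<partial>lebesgue) \<longlonglongrightarrow> (\<integral>\<sigma>. indicator {a..b} \<sigma> *\<^sub>R limit_pairing \<sigma> \<partial>lebesgue)"
    by (rule integral_dominated_convergence[OF m0 rescaled_pairing_measurable[OF sample_time(1)] w])
       (rule AE_I2, rule lim, rule AE_I2, rule le[OF sample_time(1)])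
qed

lemma F_V_time_integral:
  assumes t: "t > 0"
  shows "has_bochner_integral (lebesgue_on {a * t..b * t}) (\<lambda>s. \<integral>x. F (V s x) * complex_of_real (test_fun t x) \<partial>lebesgue)
     (\<integral>\<sigma>. indicator {a..b} \<sigma> *\<^sub>R rescaled_pairing t \<sigma> \<partial>lebesgue)"
proof -
  define g where "g s = indicator {a * t..b * t} s *\<^sub>R (tested t (\<lambda>x. F (V s x)))" for s
  have eq: "t *\<^sub>R g (0 + t * \<sigma>) = indicator {a..b} \<sigma> *\<^sub>R rescaled_pairing t \<sigma>" for \<sigma>
  proof (cases "\<sigma> \<in> {a..b}")
    case True
    then have \<sigma>0: "\<sigma> > 0" using ab by simp
    have "t * \<sigma> \<in> {a * t..b * t}" using True t by (simp add: mult.commute)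
    then show ?thesis
      using F_V_pairing[OF t \<sigma>0] True by (simp add: g_def rescaled_pairing_def scaleR_conv_of_real mult.commute[of t])
  next
    case False
    then have "t * \<sigma> \<notin> {a * t..b * t}" using t by (simp add: mult.commute)
    then show ?thesis using False by (simp add: g_def)
  qed
  have "integrable lebesgue (\<lambda>\<sigma>. t *\<^sub>R g (0 + t * \<sigma>))" unfolding eq by (rule rescaled_pairing_integral_limit(2)[OF t])
  then have "integrable lebesgue (\<lambda>\<sigma>. (1 / t) *\<^sub>R (t *\<^sub>R g (0 + t * \<sigma>)))" by (rule integrable_scaleR_right)
  then have "integrable lebesgue (\<lambda>\<sigma>. g (0 + t * \<sigma>))" using t by simp
  then have gi: "integrable lebesgue g" using t lebesgue_integrable_real_affine_iff[of t g 0] by simp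
  have gI: "(\<integral>s. g s \<partial>lebesgue) = (\<integral>\<sigma>. indicator {a..b} \<sigma> *\<^sub>R rescaled_pairing t \<sigma> \<partial>lebesgue)"
  proof -
    have "(\<integral>s. g s \<partial>lebesgue) = t *\<^sub>R (\<integral>\<sigma>. g (0 + t * \<sigma>) \<partial>lebesgue)"
      using lebesgue_integral_real_affine[of t g 0] t by simp
    also have "\<dots> = (\<integral>\<sigma>. t *\<^sub>R g (0 + t * \<sigma>) \<partial>lebesgue)" by (rule integral_scaleR_right[symmetric])
    finally show ?thesis unfolding eq .
  qed
  have Im: "{a * t..b * t} \<inter> space lebesgue \<in> sets lebesgue" by simp
  show ?thesis
    unfolding has_bochner_integral_iff
    using gi gI integrable_restrict_space[OF Im, of "\<lambda>s. \<integral>x. F (V s x) * complex_of_real (test_fun t x) \<partial>lebesgue"]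
      integral_restrict_space[OF Im, of "\<lambda>s. \<integral>x. F (V s x) * complex_of_real (test_fun t x) \<partial>lebesgue"]
    unfolding g_def[abs_def] by simp
qed

text \<open>
  Pairing the Duhamel formula with the test function expresses the integral through the solution at the
  two end points. The propagator acting on the initial value is removed at the cost of \<open>O(1/t)\<close>.
\<close>

lemma duhamel_pairing:
  assumes t: "t > 0" and at: "a * t \<ge> T"
  obtains J where "has_bochner_integral (lebesgue_on {a * t..b * t})
      (\<lambda>s. \<integral>x. schroedinger_group (b * t - s) (\<lambda>x. F (u s x)) x * complex_of_real (test_fun t x) \<partial>lebesgue) J"
    "cmod J \<le> cmod (tested t (u (b * t)))
       + cmod (tested t (u (a * t)))
       + sqrt (8 * (2 * pi) powr (real CARD('n) / 2)) * l2 (u (a * t)) * (b - a) / t"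
proof -
  let ?h = "\<lambda>x::real^'n. complex_of_real (test_fun t x)"
  have hL2: "?h \<in> L2" by (rule test_fun_L2[OF t])
  have le: "a * t \<le> b * t" using ab t by simp
  have bt: "b * t \<ge> T" using at le by simp
  obtain w where w: "has_L2_interval_integral (\<lambda>s. schroedinger_group (b * t - s) (\<lambda>x. F (u s x))) (a * t) (b * t) w"
    "AE x in lebesgue. u (b * t) x = schroedinger_group (b * t - a * t) (u (a * t)) x - \<i> * w x"
    using solution at bt unfolding is_solution_def by (meson atLeast_iff)
  have wI: "has_L2_integral (\<lambda>s. schroedinger_group (b * t - s) (\<lambda>x. F (u s x))) {a * t..b * t} w"
    using w(1) le unfolding has_L2_interval_integral_def by simp
  have wL2: "w \<in> L2" using wI unfolding has_L2_integral_def by simp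
  let ?J = "\<integral>x. w x * ?h x \<partial>lebesgue"
  have 1: "has_bochner_integral (lebesgue_on {a * t..b * t})
      (\<lambda>s. \<integral>x. schroedinger_group (b * t - s) (\<lambda>x. F (u s x)) x * ?h x \<partial>lebesgue) ?J"
    by (rule has_L2_integral_pairing[OF _ wI hL2]) simp
  have ua: "u (a * t) \<in> L2" and ub: "u (b * t) \<in> L2" using u_L2 at bt by auto
  note U = schroedinger_group_test_fun[OF ua t, of "b * t - a * t"]
  have "tested t (u (b * t)) = (\<integral>x. schroedinger_group (b * t - a * t) (u (a * t)) x * ?h x - \<i> * (w x * ?h x) \<partial>lebesgue)"
  proof (rule integral_cong_AE)
    show "(\<lambda>x. u (b * t) x * ?h x) \<in> borel_measurable lebesgue"
      using L2_product_integrable[OF ub hL2] by (rule borel_measurable_integrable)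
    show "(\<lambda>x. schroedinger_group (b * t - a * t) (u (a * t)) x * ?h x - \<i> * (w x * ?h x)) \<in> borel_measurable lebesgue"
      by (intro borel_measurable_diff borel_measurable_times borel_measurable_const L2_measurable hL2 wL2 U(1))
    show "AE x in lebesgue. u (b * t) x * ?h x = schroedinger_group (b * t - a * t) (u (a * t)) x * ?h x - \<i> * (w x * ?h x)"
      using w(2) by eventually_elim (simp add: left_diff_distrib)
  qed
  also have "\<dots> = tested t (schroedinger_group (b * t - a * t) (u (a * t))) - \<i> * ?J"
    using L2_product_integrable[OF U(1) hL2] L2_product_integrable[OF wL2 hL2]
    by (subst Bochner_Integration.integral_diff) (auto simp: integral_mult_right_zero)
  finally have "\<i> * ?J = (tested t (schroedinger_group (b * t - a * t) (u (a * t))) - tested t (u (a * t)))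
      + tested t (u (a * t)) - tested t (u (b * t))" by simp
  then have "cmod ?J = cmod ((tested t (schroedinger_group (b * t - a * t) (u (a * t))) - tested t (u (a * t)))
      + tested t (u (a * t)) - tested t (u (b * t)))"
    by (metis norm_mult norm_ii mult_1)
  also have "\<dots> \<le> cmod (tested t (schroedinger_group (b * t - a * t) (u (a * t))) - tested t (u (a * t)))
      + cmod (tested t (u (a * t))) + cmod (tested t (u (b * t)))"
    by (meson norm_triangle_ineq4 norm_triangle_ineq order_trans add_right_mono)
  also have "cmod (tested t (schroedinger_group (b * t - a * t) (u (a * t))) - tested t (u (a * t)))
      \<le> sqrt (8 * (2 * pi) powr (real CARD('n) / 2)) * l2 (u (a * t)) * (b - a) / t"
  proof -
    have "\<bar>b * t - a * t\<bar> / t\<^sup>2 = (b - a) / t"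
      using t le by (simp add: power2_eq_square left_diff_distrib[symmetric])
    then show ?thesis using U(2) by (simp only: times_divide_eq_right[symmetric])
  qed
  finally show ?thesis by (intro that[OF 1]) linarith
qed

text \<open>
  The test function has constant norm, so \<open>u\<close> may be replaced by the profile, whose phase oscillates
  with \<open>n = 1\<close>.
\<close>

lemma u_pairing_limit:
  assumes \<sigma>: "\<sigma> \<in> {a..b}"
  shows "((\<lambda>t. \<integral>x. u (\<sigma> * t) x * complex_of_real (test_fun t x) \<partial>lebesgue) \<longlongrightarrow> 0) at_top"
    and "((\<lambda>t. l2 (u (\<sigma> * t)) / t) \<longlongrightarrow> 0) at_top"
proof -
  have \<sigma>0: "\<sigma> > 0" using \<sigma> ab by simp
  have scale: "filterlim (\<lambda>t. \<sigma> * t) at_top at_top"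
    by (rule filterlim_tendsto_pos_mult_at_top[OF tendsto_const \<sigma>0 filterlim_ident])
  have ev: "\<forall>\<^sub>F t in at_top. t > 0 \<and> \<sigma> * t \<ge> T0"
    using eventually_gt_at_top[of 0] scale[unfolded filterlim_at_top, rule_format, of T0] by eventually_elim simp
  have dL2: "(\<lambda>x. u s x - V s x) \<in> L2" if "s \<ge> T0" for s
    using that T0 by (intro L2_diff u_L2 V_L2) auto
  have dl: "((\<lambda>s. l2 (\<lambda>x. u s x - V s x)) \<longlongrightarrow> 0) at_top"
  proof (rule L2_norm_tendsto_0_iff[THEN iffD1, OF _ limit_L2])
    show "\<forall>\<^sub>F s in at_top. (\<lambda>x. u s x - V s x) \<in> L2"
      using eventually_ge_at_top[of T0] by eventually_elim (rule dL2)
  qed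
  have dl': "((\<lambda>t. l2 (\<lambda>x. u (\<sigma> * t) x - V (\<sigma> * t) x)) \<longlongrightarrow> 0) at_top"
    by (rule filterlim_compose[OF dl scale])
  have 1: "((\<lambda>t. l2 (\<lambda>x. u (\<sigma> * t) x - V (\<sigma> * t) x) * sqrt (pi powr (d / 2))) \<longlongrightarrow> 0) at_top"
    using tendsto_mult_right[OF dl', of "sqrt (pi powr (d / 2))"] by simp
  have 2: "((\<lambda>t. cmod (complex_of_real ((2 * \<sigma>) powr (d / 2)) * weighted \<sigma> (Z (\<sigma> * t)))) \<longlongrightarrow> 0) at_top"
    using tendsto_norm[OF tendsto_mult[OF tendsto_const[of "complex_of_real ((2 * \<sigma>) powr (d / 2))"] Z_limit[OF \<sigma>]]] by simp
  show "((\<lambda>t. \<integral>x. u (\<sigma> * t) x * complex_of_real (test_fun t x) \<partial>lebesgue) \<longlongrightarrow> 0) at_top"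
  proof (rule Lim_null_comparison)
    show "((\<lambda>t. l2 (\<lambda>x. u (\<sigma> * t) x - V (\<sigma> * t) x) * sqrt (pi powr (d / 2)) + cmod (complex_of_real ((2 * \<sigma>) powr (d / 2)) * weighted \<sigma> (Z (\<sigma> * t)))) \<longlongrightarrow> 0) at_top"
      using tendsto_add[OF 1 2] by simp
    show "\<forall>\<^sub>F t in at_top. norm (tested t (u (\<sigma> * t)))
       \<le> l2 (\<lambda>x. u (\<sigma> * t) x - V (\<sigma> * t) x) * sqrt (pi powr (d / 2)) + cmod (complex_of_real ((2 * \<sigma>) powr (d / 2)) * weighted \<sigma> (Z (\<sigma> * t)))"
      using ev
    proof eventually_elim
      case (elim t)
      let ?h = "\<lambda>x::real^'n. complex_of_real (test_fun t x)"
      have h: "?h \<in> L2" "l2 ?h = sqrt (pi powr (d / 2))"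
        using test_fun_L2[of t, where 'n = 'n] elim by (auto simp: d real_sqrt_unique)
      have uL2: "u (\<sigma> * t) \<in> L2" and VL2: "V (\<sigma> * t) \<in> L2" using elim T0 \<sigma>0 by (auto intro!: u_L2 V_L2)
      have "tested t (u (\<sigma> * t)) = tested t (\<lambda>x. (u (\<sigma> * t) x - V (\<sigma> * t) x)) + tested t (V (\<sigma> * t))"
        using L2_product_integrable[OF uL2 h(1)] L2_product_integrable[OF VL2 h(1)] by (simp add: left_diff_distrib)
      then have "norm (tested t (u (\<sigma> * t)))
        \<le> cmod (tested t (\<lambda>x. (u (\<sigma> * t) x - V (\<sigma> * t) x))) + cmod (tested t (V (\<sigma> * t)))"
        by (simp add: norm_triangle_ineq)
      also have "cmod (tested t (\<lambda>x. (u (\<sigma> * t) x - V (\<sigma> * t) x))) \<le> l2 (\<lambda>x. u (\<sigma> * t) x - V (\<sigma> * t) x) * sqrt (pi powr (d / 2))"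
        using L2_Cauchy_Schwarz[OF dL2 h(1), of "\<sigma> * t"] elim unfolding h(2) by simp
      also have "tested t (V (\<sigma> * t)) = complex_of_real ((2 * \<sigma>) powr (d / 2)) * weighted \<sigma> (Z (\<sigma> * t))"
        using elim \<sigma>0 by (intro V_pairing) auto
      finally show ?case by simp
    qed
  qed
  show "((\<lambda>t. l2 (u (\<sigma> * t)) / t) \<longlongrightarrow> 0) at_top"
  proof (rule Lim_null_comparison)
    have "((\<lambda>t. (l2 (\<lambda>x. u (\<sigma> * t) x - V (\<sigma> * t) x) + l2 W) * inverse t) \<longlongrightarrow> (0 + l2 W) * 0) at_top"
      by (intro tendsto_mult tendsto_add tendsto_const dl' tendsto_inverse_0_at_top filterlim_ident)
    then show "((\<lambda>t. (l2 (\<lambda>x. u (\<sigma> * t) x - V (\<sigma> * t) x) + l2 W) * inverse t) \<longlongrightarrow> 0) at_top" by simp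
    show "\<forall>\<^sub>F t in at_top. norm (l2 (u (\<sigma> * t)) / t) \<le> (l2 (\<lambda>x. u (\<sigma> * t) x - V (\<sigma> * t) x) + l2 W) * inverse t"
      using ev
    proof eventually_elim
      case (elim t)
      have "u (\<sigma> * t) \<in> L2" "V (\<sigma> * t) \<in> L2" "l2 (V (\<sigma> * t)) = l2 W" using elim T0 \<sigma>0 by (auto intro!: u_L2 V_L2)
      then have "l2 (u (\<sigma> * t)) \<le> l2 (\<lambda>x. u (\<sigma> * t) x - V (\<sigma> * t) x) + l2 W"
        using l2_le_diff_add by metis
      then have "l2 (u (\<sigma> * t)) * inverse t \<le> (l2 (\<lambda>x. u (\<sigma> * t) x - V (\<sigma> * t) x) + l2 W) * inverse t"
        using elim by (intro mult_right_mono) auto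
      then show ?case using elim by (simp add: divide_inverse)
    qed
  qed
qed

lemma integral_difference_le:
  fixes f g :: "real \<Rightarrow> complex"
  assumes f: "has_bochner_integral M f I" and g: "has_bochner_integral M g J"
    and le: "AE s in M. ennreal (cmod (f s - g s)) \<le> E s"
  shows "ennreal (cmod (I - J)) \<le> (\<integral>\<^sup>+s. E s \<partial>M)"
proof -
  have "has_bochner_integral M (\<lambda>s. f s - g s) (I - J)" by (rule has_bochner_integral_diff[OF f g])
  then have "ennreal (cmod (I - J)) \<le> (\<integral>\<^sup>+s. ennreal (norm (f s - g s)) \<partial>M)"
    by (rule has_bochner_integral_norm_bound)
  also have "\<dots> \<le> (\<integral>\<^sup>+s. E s \<partial>M)" using le by (intro nn_integral_mono_AE) simp
  finally show ?thesis .
qed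

text \<open>
  The integral over \<open>\<sigma>\<close> of the rescaled pairing has two limits: the integral of \<open>limit_pairing\<close> by
  dominated convergence, and zero because it differs little from the Duhamel integral, which is
  controlled by the boundary terms.
\<close>

lemma main_integral_zero: "(\<integral>\<sigma>. indicator {a..b} \<sigma> *\<^sub>R limit_pairing \<sigma> \<partial>lebesgue) = 0"
proof -
  define K where "K t = (\<integral>\<sigma>. indicator {a..b} \<sigma> *\<^sub>R rescaled_pairing t \<sigma> \<partial>lebesgue)" for t
  obtain D :: "real \<Rightarrow> ennreal" where D: "D \<in> borel_measurable borel"
    "AE s in lebesgue. s \<ge> T0 \<longrightarrow> nn_power q (\<lambda>x. u s x - V s x) = D s"
    "((\<lambda>t. ennreal t * (\<integral>\<^sup>+s. D s * indicator {t..} s \<partial>lebesgue)) \<longlongrightarrow> 0) at_top"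
    by (rule deviation) (rule that)
  have scale: "filterlim (\<lambda>t. a * t) at_top at_top"
    by (rule filterlim_tendsto_pos_mult_at_top[OF tendsto_const ab(1) filterlim_ident])
  define bdry where "bdry t = cmod (tested t (u (b * t)))
       + cmod (tested t (u (a * t)))
       + sqrt (8 * (2 * pi) powr (real CARD('n) / 2)) * l2 (u (a * t)) * (b - a) / t" for t
  have bdry: "(bdry \<longlongrightarrow> 0) at_top"
  proof -
    have ab': "a \<in> {a..b}" "b \<in> {a..b}" using ab by auto
    have "((\<lambda>t. cmod (tested t (u (b * t)))
       + cmod (tested t (u (a * t)))
       + (sqrt (8 * (2 * pi) powr (real CARD('n) / 2)) * (b - a)) * (l2 (u (a * t)) / t)) \<longlongrightarrow>
       0 + 0 + (sqrt (8 * (2 * pi) powr (real CARD('n) / 2)) * (b - a)) * 0) at_top"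
      by (intro tendsto_add tendsto_norm_zero tendsto_mult tendsto_const u_pairing_limit ab')
    moreover have "bdry = (\<lambda>t. cmod (tested t (u (b * t)))
       + cmod (tested t (u (a * t)))
       + (sqrt (8 * (2 * pi) powr (real CARD('n) / 2)) * (b - a)) * (l2 (u (a * t)) / t))"
      by (rule ext) (simp add: bdry_def)
    ultimately show ?thesis by simp
  qed
  have K0: "(K \<longlongrightarrow> 0) at_top"
  proof (rule tendstoI)
    fix e :: real assume e: "e > 0"
    \<comment> \<open>The interval of integration has length \<open>(b - a) t\<close>, so the term \<open>e1 / t\<close> contributes \<open>e / 4\<close>. The
      deviation and the boundary terms contribute \<open>e / 4\<close> each.\<close>
    define e1 where "e1 = e / 4 / (b - a)"
    have e1: "e1 > 0" using e ab by (simp add: e1_def)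
    obtain B t0 where B: "B \<ge> 0" "t0 \<ge> T0" "\<And>t s \<delta>. t \<ge> t0 \<Longrightarrow> s \<in> {a * t..b * t} \<Longrightarrow> T0 \<le> s \<Longrightarrow> 0 \<le> \<delta> \<Longrightarrow>
     nn_power q (\<lambda>x. u s x - V s x) = ennreal \<delta> \<Longrightarrow>
     cmod (tested t (schroedinger_group (b * t - s) (\<lambda>x. F (u s x)))
       - tested t (\<lambda>x. F (V s x))) \<le> e1 / t + B * t * \<delta>"
      by (rule pointwise_error[OF e1]) (rule that)
    have "e * a / (4 * (B + 1)) > 0" using e ab B(1) by simp
    then have "\<forall>\<^sub>F t in at_top. ennreal (a * t) * (\<integral>\<^sup>+s. D s * indicator {a * t..} s \<partial>lebesgue) < ennreal (e * a / (4 * (B + 1)))"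
      using order_tendstoD(2)[OF filterlim_compose[OF D(3) scale], of "ennreal (e * a / (4 * (B + 1)))"] by simp
    moreover have "\<forall>\<^sub>F t in at_top. bdry t < e / 4" using order_tendstoD(2)[OF bdry, of "e / 4"] e by simp
    moreover have "\<forall>\<^sub>F t in at_top. a * t \<ge> T0" using scale[unfolded filterlim_at_top] by blast
    ultimately show "\<forall>\<^sub>F t in at_top. dist (K t) 0 < e"
      using eventually_ge_at_top[of t0]
    proof eventually_elim
      case (elim t)
      have t: "t > 0" using elim(4) B(2) T0 by simp
      have atT: "a * t \<ge> T" using elim(3) T0 by simp
      have at: "a * t > 0" using ab t by simp
      let ?A = "{a * t..b * t}"
      obtain J where J: "has_bochner_integral (lebesgue_on ?A)
          (\<lambda>s. \<integral>x. schroedinger_group (b * t - s) (\<lambda>x. F (u s x)) x * complex_of_real (test_fun t x) \<partial>lebesgue) J" "cmod J \<le> bdry t"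
        by (rule duhamel_pairing[OF t atT, folded bdry_def]) (rule that)
      define \<Delta> where "\<Delta> = (\<integral>\<^sup>+s. D s * indicator {a * t..} s \<partial>lebesgue)"
      have D1: "ennreal (a * t) * \<Delta> < ennreal (e * a / (4 * (B + 1)))" using elim(1) unfolding \<Delta>_def .
      have Dfin: "\<Delta> \<noteq> \<infinity>"
      proof
        assume "\<Delta> = \<infinity>"
        moreover have "ennreal (a * t) \<noteq> 0" using at by (simp only: ennreal_eq_0_iff not_le)
        ultimately have "ennreal (a * t) * \<Delta> = top" by (simp only: infinity_ennreal_def ennreal_mult_top if_False)
        then show False using D1 by simp
      qed
      then obtain y where y: "\<Delta> = ennreal y" "y \<ge> 0" by (cases \<Delta>) auto
      have Dm: "(\<lambda>s. D s * indicator {a * t..} s) \<in> borel_measurable lebesgue"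
        using D(1) by (intro borel_measurable_times_ennreal borel_measurable_indicator borel_measurable_imp_lebesgue) auto
      have Dae: "AE s in lebesgue. D s * indicator {a * t..} s \<noteq> \<infinity>"
        using Dfin unfolding \<Delta>_def by (intro nn_integral_noteq_infinite Dm)
      let ?E = "\<lambda>s. ennreal (e1 / t) + ennreal (B * t) * D s"
      have A': "?A \<inter> space lebesgue \<in> sets lebesgue" by simp
      have ae: "AE s in lebesgue_on ?A. ennreal (cmod (tested t (schroedinger_group (b * t - s) (\<lambda>x. F (u s x)))
          - tested t (\<lambda>x. F (V s x)))) \<le> ?E s"
        unfolding AE_restrict_space_iff[OF A']
        using D(2) Dae
      proof eventually_elim
        case s: (elim s)
        show ?case
        proof
          assume sA: "s \<in> ?A"
          then have sT: "s \<ge> T0" "s \<in> {a * t..}" using elim(3) by auto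
          then have "D s \<noteq> \<infinity>" using s(2) by simp
          then obtain \<delta> where \<delta>: "D s = ennreal \<delta>" "\<delta> \<ge> 0" by (cases "D s") auto
          have dev: "nn_power q (\<lambda>x. u s x - V s x) = ennreal \<delta>" using s(1) sT(1) \<delta>(1) by simp
          have "ennreal (cmod (tested t (schroedinger_group (b * t - s) (\<lambda>x. F (u s x)))
          - tested t (\<lambda>x. F (V s x)))) \<le> ennreal (e1 / t + B * t * \<delta>)"
            by (rule ennreal_leI[OF B(3)[OF elim(4) sA sT(1) \<delta>(2) dev]])
          also have "\<dots> = ?E s" unfolding \<delta>(1) using e1 t B(1) \<delta>(2) by (simp add: ennreal_mult)
          finally show "ennreal (cmod (tested t (schroedinger_group (b * t - s) (\<lambda>x. F (u s x)))
          - tested t (\<lambda>x. F (V s x)))) \<le> ?E s" .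
        qed
      qed
      have "ennreal (cmod (J - K t)) \<le> (\<integral>\<^sup>+s. ?E s \<partial>(lebesgue_on ?A))"
        unfolding K_def by (rule integral_difference_le[OF J(1) F_V_time_integral[OF t] ae])
      also have "\<dots> = (\<integral>\<^sup>+s. ?E s * indicator ?A s \<partial>lebesgue)" by (rule nn_integral_restrict_space[OF A'])
      also have "\<dots> \<le> (\<integral>\<^sup>+s. ennreal (e1 / t) * indicator ?A s + ennreal (B * t) * (D s * indicator {a * t..} s) \<partial>lebesgue)"
        by (intro nn_integral_mono) (auto simp: indicator_def)
      also have "\<dots> = ennreal (e1 / t) * emeasure lebesgue ?A + ennreal (B * t) * \<Delta>"
      proof -
        have Al: "?A \<in> sets lebesgue" by simp
        have m1: "(\<lambda>s. ennreal (e1 / t) * indicator ?A s) \<in> borel_measurable lebesgue"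
          by (intro borel_measurable_times_ennreal borel_measurable_const borel_measurable_indicator Al)
        have m2: "(\<lambda>s. ennreal (B * t) * (D s * indicator {a * t..} s)) \<in> borel_measurable lebesgue"
          by (intro borel_measurable_times_ennreal borel_measurable_const Dm)
        show ?thesis
          unfolding \<Delta>_def nn_integral_add[OF m1 m2] nn_integral_cmult[OF Dm] nn_integral_cmult_indicator[OF Al] ..
      qed
      also have "emeasure lebesgue ?A = ennreal ((b - a) * t)"
        using ab t by (simp add: left_diff_distrib)
      also have "ennreal (e1 / t) * ennreal ((b - a) * t) + ennreal (B * t) * \<Delta> = ennreal (e1 / t * ((b - a) * t) + B * t * y)"
      proof -
        have n: "0 \<le> e1 / t" "0 \<le> (b - a) * t" "0 \<le> B * t" using e1 t ab B(1) by simp_all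
        show ?thesis
          unfolding y(1) ennreal_mult[OF n(1,2), symmetric] ennreal_mult[OF n(3) y(2), symmetric]
          by (intro ennreal_plus[symmetric] mult_nonneg_nonneg n y(2))
      qed
      finally have "cmod (J - K t) \<le> e1 / t * ((b - a) * t) + B * t * y"
        using e1 t ab B(1) y(2) by (subst (asm) ennreal_le_iff) auto
      also have "e1 / t * ((b - a) * t) = e / 4"
      proof -
        have cancel: "x / l / t * (l * t) = x" if "l \<noteq> 0" for x l :: real using that t by simp
        have "b - a \<noteq> 0" using ab by simp
        then show ?thesis unfolding e1_def by (rule cancel)
      qed
      also have "B * t * y \<le> e / 4"
      proof -
        have aty: "0 \<le> a * t" using at by simp
        have "a * t * y < e * a / (4 * (B + 1))"
          using D1 unfolding y(1) ennreal_mult[OF aty y(2), symmetric]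
          using aty y(2) by (simp only: ennreal_less_iff mult_nonneg_nonneg)
        also have "e * a / (4 * (B + 1)) = a * (e / (4 * (B + 1)))" by simp
        finally have "a * (t * y) < a * (e / (4 * (B + 1)))" by (simp only: mult.assoc)
        then have ty: "t * y < e / (4 * (B + 1))" using ab(1) by (simp only: mult_less_cancel_left_pos)
        have "B * (t * y) \<le> (B + 1) * (t * y)" using t y(2) by (intro mult_right_mono) auto
        also have "\<dots> \<le> (B + 1) * (e / (4 * (B + 1)))" using ty B(1) by (intro mult_left_mono) auto
        also have "\<dots> = e / 4"
        proof -
          have cancel: "X * (e / (4 * X)) = e / 4" if "X \<noteq> 0" for X using that by simp
          have "B + 1 \<noteq> 0" using B(1) by simp
          then show ?thesis by (rule cancel)
        qed
        finally show ?thesis by (simp only: mult.assoc)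
      qed
      finally have JK: "cmod (J - K t) \<le> e / 2" by simp
      have "cmod (K t) \<le> cmod J + cmod (J - K t)"
        using norm_triangle_ineq4[of J "J - K t"] by simp
      then show ?case using JK J(2) elim(2) e by simp
    qed
  qed
  have "(\<lambda>k. K (sample_time k)) \<longlonglongrightarrow> 0" by (rule filterlim_compose[OF K0 sample_time(2)])
  moreover have "(\<lambda>k. K (sample_time k)) \<longlonglongrightarrow> (\<integral>\<sigma>. indicator {a..b} \<sigma> *\<^sub>R limit_pairing \<sigma> \<partial>lebesgue)"
    unfolding K_def by (rule rescaled_pairing_integral_limit(3))
  ultimately show ?thesis using LIMSEQ_unique by blast
qed

text \<open>
  The limit is an average over \<open>\<sigma>\<close> of integrals of \<open>|W|\<^sup>p\<close> against positive weights, so one of these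
  integrals vanishes.
\<close>

lemma profile_zero: "AE x in lebesgue. v x = 0"
proof -
  define r where "r \<sigma> = (\<integral>\<xi>. cmod (W \<xi>) powr p * gauss (2 * \<sigma>\<^sup>2) \<xi> \<partial>lebesgue)" for \<sigma>
  have prod: "complex_of_real (cmod (W \<xi>) powr p) * \<gamma> \<sigma> \<xi> = complex_of_real (cmod (W \<xi>) powr p * gauss (2 * \<sigma>\<^sup>2) \<xi>)" for \<sigma> \<xi>
    by (simp only: \<gamma>_def of_real_mult)
  have ri: "integrable lebesgue (\<lambda>\<xi>. cmod (W \<xi>) powr p * gauss (2 * \<sigma>\<^sup>2) \<xi>)" if "\<sigma> > 0" for \<sigma>
    using L2_product_integrable[OF modulus_power_L2 \<gamma>_L2[OF that]] unfolding prod complex_of_real_integrable_eq .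
  have r: "main_term \<sigma> = complex_of_real (r \<sigma>)" for \<sigma>
    unfolding main_term_def prod r_def by (rule integral_complex_of_real)
  have r0: "r \<sigma> \<ge> 0" for \<sigma> unfolding r_def by (intro integral_nonneg_AE) simp
  have limit_pairing_real: "indicator {a..b} \<sigma> *\<^sub>R limit_pairing \<sigma> = complex_of_real (indicator {a..b} \<sigma> * ((2 * \<sigma>) powr (d / 2 - 1) * r \<sigma>))" for \<sigma>
    by (simp add: limit_pairing_def r scaleR_conv_of_real)
  have i: "integrable lebesgue (\<lambda>\<sigma>. indicator {a..b} \<sigma> * ((2 * \<sigma>) powr (d / 2 - 1) * r \<sigma>))"
    using rescaled_pairing_integral_limit(1) unfolding limit_pairing_real complex_of_real_integrable_eq .
  have "complex_of_real (\<integral>\<sigma>. indicator {a..b} \<sigma> * ((2 * \<sigma>) powr (d / 2 - 1) * r \<sigma>) \<partial>lebesgue) = 0"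
    using main_integral_zero unfolding limit_pairing_real by (simp only: integral_complex_of_real)
  then have "(\<integral>\<sigma>. indicator {a..b} \<sigma> * ((2 * \<sigma>) powr (d / 2 - 1) * r \<sigma>) \<partial>lebesgue) = 0" by simp
  then have ae: "AE \<sigma> in lebesgue. indicator {a..b} \<sigma> * ((2 * \<sigma>) powr (d / 2 - 1) * r \<sigma>) = 0"
    using integral_nonneg_eq_0_iff_AE[OF i] r0 by simp
  have "\<exists>\<sigma>\<in>{a..b}. r \<sigma> = 0"
  proof (rule ccontr)
    assume n: "\<not> ?thesis"
    from ae have "AE \<sigma> in lebesgue. \<sigma> \<notin> {a..b}"
    proof eventually_elim
      case (elim \<sigma>)
      show ?case
      proof
        assume "\<sigma> \<in> {a..b}"
        then have "r \<sigma> = 0" using elim ab by simp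
        then show False using n \<open>\<sigma> \<in> {a..b}\<close> by blast
      qed
    qed
    then have "{a..b} \<in> null_sets lebesgue" by (simp add: AE_iff_null_sets)
    then show False using ab by (simp add: null_sets_def)
  qed
  then obtain \<sigma> where \<sigma>: "\<sigma> \<in> {a..b}" "r \<sigma> = 0" by blast
  have \<sigma>0: "\<sigma> > 0" using \<sigma> ab by simp
  have "AE \<xi> in lebesgue. cmod (W \<xi>) powr p * gauss (2 * \<sigma>\<^sup>2) \<xi> = 0"
    using \<sigma>(2) integral_nonneg_eq_0_iff_AE[OF ri[OF \<sigma>0]] unfolding r_def by simp
  then have "AE \<xi> in lebesgue. W \<xi> = 0" by eventually_elim simp
  then show ?thesis
    unfolding W_def fourier_def by (rule fourier_limit_injective[OF v, rotated]) simp
qed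

end

lemma H0_imp_L2:
  assumes "v \<in> H0 s" "s \<ge> 0"
  shows "v \<in> L2"
proof -
  have m: "v \<in> borel_measurable lebesgue" and w: "(\<lambda>x. complex_of_real (japanese_bracket x powr s) * v x) \<in> L2"
    using assms(1) by (auto simp: H0_def)
  have "1 \<le> japanese_bracket x powr s" for x :: 'a
    using assms(2) by (intro ge_one_powr_ge_zero) (simp_all add: japanese_bracket_def)
  then have "cmod (v x) \<le> 1 * cmod (complex_of_real (japanese_bracket x powr s) * v x)" for x
    by (simp add: norm_mult mult_le_cancel_right1)
  then show ?thesis by (rule L2_dominated[OF w m])
qed

theorem theorem3p5:
  fixes F :: "complex \<Rightarrow> complex"
    and \<phi> :: "real \<Rightarrow> real^'n \<Rightarrow> real"
    and a b T :: real
    and u :: "real \<Rightarrow> real^'n \<Rightarrow> complex"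
    and u_plus :: "real^'n \<Rightarrow> complex"
  assumes hom: "homogeneous (1 + 2 / real CARD('n)) F"
    and decomposition: "\<And>z. ((\<lambda>n::int. F_coeff F n * F_mode (1 + 2 / real CARD('n)) n z) has_sum F z) UNIV"
    and coeff_l1: "(\<lambda>n::int. norm (F_coeff F n)) summable_on UNIV"
    and coeff_0: "F_coeff F 0 = 1"
    and phi_measurable: "(\<lambda>(t, x). \<phi> t x) \<in> borel_measurable (lebesgue_on ({0<..} \<times> UNIV))"
    and phi_slice_measurable: "\<And>t. t > 0 \<Longrightarrow> \<phi> t \<in> borel_measurable lebesgue"
    and ab: "0 < a" "a < b"
    and weak_limit: "\<And>f g \<sigma> n. f \<in> L2 \<Longrightarrow> g \<in> L2 \<Longrightarrow> \<sigma> \<in> {a..b} \<Longrightarrow> n \<noteq> (0::int) \<Longrightarrow>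
      ((\<lambda>t. L2_inner
              (\<lambda>x. cis (real_of_int n * (\<sigma> * t * (norm x)\<^sup>2 + \<phi> (\<sigma> * t) x)) * f x) g)
         \<longlongrightarrow> 0) at_top"
    and solution: "is_solution F {T..} u"
    and u_plus: "u_plus \<in> H0 (real CARD('n) / (real CARD('n) + 2))"
    and limit_L2: "((\<lambda>t. L2_norm (\<lambda>x. u t x - V_profile \<phi> u_plus t x)) \<longlongrightarrow> 0) at_top"
    and limit_Lq: "((\<lambda>t. ennreal (t powr (real CARD('n) / (2 * (real CARD('n) + 2)))) *
        Lp_norm (2 * (real CARD('n) + 2) / real CARD('n)) ({t..} \<times> UNIV)
          (\<lambda>(s, x). u s x - V_profile \<phi> u_plus s x)) \<longlongrightarrow> 0) at_top"
  shows "AE x in lebesgue. u_plus x = 0"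
proof -
  let ?d = "real CARD('n)"
  have d: "?d > 0" by simp
  have q: "2 * (?d + 2) / ?d = 2 * (1 + 2 / ?d)" "?d / (2 * (?d + 2)) = 1 / (2 * (1 + 2 / ?d))"
    using d by (simp_all add: field_simps)
  interpret critical_profile F "1 + 2 / ?d" "F_coeff F" ?d "2 * (1 + 2 / ?d)" \<phi> a b T u u_plus
  proof unfold_locales
    show "0 < 1 + 2 / ?d" using d by (simp add: add_pos_pos)
    show "u_plus \<in> L2" by (rule H0_imp_L2[OF u_plus]) simp
    show "((\<lambda>t. ennreal (t powr (1 / (2 * (1 + 2 / ?d)))) *
        Lp_norm (2 * (1 + 2 / ?d)) ({t..} \<times> UNIV) (\<lambda>(s, x). u s x - V_profile \<phi> u_plus s x)) \<longlongrightarrow> 0) at_top"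
      using limit_Lq unfolding q .
  qed (fact refl hom decomposition coeff_l1 coeff_0 phi_measurable phi_slice_measurable ab weak_limit solution limit_L2)+
  show ?thesis by (rule profile_zero)
qed

end
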